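(* Assigning the tangent complex is a (well-defined) functor $\mathfrak{T}$ from the category of simplicial manifolds to the category of chain complexes of smooth vector bundles.
   Context: A simplicial manifold $X_\bullet$ is a simplicial object in smooth manifolds, with faces $d_j=d^n_j:X_n\to X_{n-1}$. The base $X_0$ is regarded as a submanifold of $X_n$ via the unique iterated degeneracy embedding. The tangent complex of $X_\bullet$ is $(\mathfrak{T}_\bullet(X),\partial_\bullet)$ over the base $X_0$, with $$\mathfrak{T}_0(X)=TX_0,\qquad \mathfrak{T}_n(X)=\bigcap_{j=0}^{n-1}\ker\big(Td_j:TX_n|_{X_0}\to TX_{n-1}|_{X_0}\big)\ (n\ge1),$$ and differentials $\partial_n=(-1)^nTd^n_n$, $n\ge1$. A priori the $\mathfrak{T}_n(X)$ are only fiberwise linear subspaces; the assertion includes that they are smooth vector subbundles of $TX_n|_{X_0}$, so that this is a chain complex of vector bundles. On a simplicial morphism $f_\bullet:X_\bullet\to Y_\bullet$ of simplicial manifolds, $\mathfrak{T}_n(f):\mathfrak{T}_n(X)\to\mathfrak{T}_n(Y)$ is the restriction of $Tf_n$, covering $f_0:X_0\to Y_0$. Morphisms of chain complexes of vector bundles are degreewise smooth vector bundle morphisms over a common smooth base map, commuting with the differentials. *)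

theory Defs
  imports "HOL-Analysis.Analysis"
begin

section \<open>Smooth functions on open subsets of Euclidean spaces\<close>

text \<open>The dimensions of the levels of a simplicial manifold are unbounded, so R^k cannot be a type.
  We use the library's \<^const>\<open>Euclidean_space\<close>: the functions of type \<^typ>\<open>nat \<Rightarrow> real\<close> that
  vanish from index k on.\<close>

definition partial_deriv :: "nat \<Rightarrow> ((nat \<Rightarrow> real) \<Rightarrow> real) \<Rightarrow> (nat \<Rightarrow> real) \<Rightarrow> real" where
  "partial_deriv j g x = deriv (\<lambda>t. g (x(j := t))) (x j)"

text \<open>\<open>C_diff k r U g\<close>: the function g is of class C^r on the open subset U of R^k.\<close>

primrec C_diff :: "nat \<Rightarrow> nat \<Rightarrow> (nat \<Rightarrow> real) set \<Rightarrow> ((nat \<Rightarrow> real) \<Rightarrow> real) \<Rightarrow> bool" where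
  "C_diff k 0 U g \<longleftrightarrow> continuous_map (subtopology (Euclidean_space k) U) euclideanreal g"
| "C_diff k (Suc r) U g \<longleftrightarrow>
     continuous_map (subtopology (Euclidean_space k) U) euclideanreal g \<and>
     (\<forall>j<k. (\<forall>x\<in>U. (\<lambda>t. g (x(j := t))) field_differentiable at (x j)) \<and>
            C_diff k r U (partial_deriv j g))"

definition C_inf :: "nat \<Rightarrow> (nat \<Rightarrow> real) set \<Rightarrow> ((nat \<Rightarrow> real) \<Rightarrow> nat \<Rightarrow> real) \<Rightarrow> bool" where
  "C_inf k U g \<longleftrightarrow> (\<forall>i r. C_diff k r U (\<lambda>x. g x i))"

text \<open>The differential of g at a point x of R^k, applied to the vector w.\<close>

definition differential ::
    "nat \<Rightarrow> ((nat \<Rightarrow> real) \<Rightarrow> nat \<Rightarrow> real) \<Rightarrow> (nat \<Rightarrow> real) \<Rightarrow> (nat \<Rightarrow> real) \<Rightarrow> nat \<Rightarrow> real" where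
  "differential k g x w = (\<lambda>i. \<Sum>j<k. partial_deriv j (\<lambda>y. g y i) x * w j)"

definition append_coords :: "nat \<Rightarrow> (nat \<Rightarrow> real) \<Rightarrow> (nat \<Rightarrow> real) \<Rightarrow> nat \<Rightarrow> real" where
  "append_coords k x y = (\<lambda>i. if i < k then x i else y (i - k))"


section \<open>Smooth manifolds\<close>

record 'a chart =
  chart_dim :: nat
  chart_dom :: "'a set"
  chart_map :: "'a \<Rightarrow> nat \<Rightarrow> real"

record 'a manifold =
  mtop :: "'a topology"
  atlas :: "'a chart set"

abbreviation mpoints :: "'a manifold \<Rightarrow> 'a set" where
  "mpoints M \<equiv> topspace (mtop M)"

text \<open>Chart maps are partial functions, hence normalised outside their domain.\<close>

definition is_chart :: "'a topology \<Rightarrow> 'a chart \<Rightarrow> bool" where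
  "is_chart T c \<longleftrightarrow>
     openin T (chart_dom c) \<and>
     chart_map c \<in> extensional (chart_dom c) \<and>
     openin (Euclidean_space (chart_dim c)) (chart_map c ` chart_dom c) \<and>
     homeomorphic_map (subtopology T (chart_dom c))
       (subtopology (Euclidean_space (chart_dim c)) (chart_map c ` chart_dom c)) (chart_map c)"

text \<open>The local representative of a map f in the charts c and d.\<close>

definition local_rep ::
    "'a chart \<Rightarrow> 'b chart \<Rightarrow> ('a \<Rightarrow> 'b) \<Rightarrow> (nat \<Rightarrow> real) \<Rightarrow> nat \<Rightarrow> real" where
  "local_rep c d f = (\<lambda>y. chart_map d (f (inv_into (chart_dom c) (chart_map c) y)))"

definition compatible :: "'a chart \<Rightarrow> 'a chart \<Rightarrow> bool" where
  "compatible c d \<longleftrightarrow>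
     C_inf (chart_dim c) (chart_map c ` (chart_dom c \<inter> chart_dom d)) (local_rep c d (\<lambda>p. p)) \<and>
     C_inf (chart_dim d) (chart_map d ` (chart_dom c \<inter> chart_dom d)) (local_rep d c (\<lambda>p. p))"

definition maximal_atlas :: "'a topology \<Rightarrow> 'a chart set \<Rightarrow> 'a chart set" where
  "maximal_atlas T A = {c. is_chart T c \<and> (\<forall>a\<in>A. compatible c a)}"

text \<open>Charts carry their own dimension: components of different dimension are allowed.\<close>

definition smooth_manifold :: "'a manifold \<Rightarrow> bool" where
  "smooth_manifold M \<longleftrightarrow>
     Hausdorff_space (mtop M) \<and> second_countable (mtop M) \<and>
     (\<forall>c\<in>atlas M. is_chart (mtop M) c) \<and>
     (\<Union>c\<in>atlas M. chart_dom c) = mpoints M \<and>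
     (\<forall>c\<in>atlas M. \<forall>d\<in>atlas M. compatible c d) \<and>
     maximal_atlas (mtop M) (atlas M) \<subseteq> atlas M"

definition smooth_map :: "'a manifold \<Rightarrow> 'b manifold \<Rightarrow> ('a \<Rightarrow> 'b) \<Rightarrow> bool" where
  "smooth_map M N f \<longleftrightarrow>
     continuous_map (mtop M) (mtop N) f \<and>
     (\<forall>c\<in>atlas M. \<forall>d\<in>atlas N.
        C_inf (chart_dim c) (chart_map c ` (chart_dom c \<inter> f -` chart_dom d)) (local_rep c d f))"

definition diffeomorphism :: "'a manifold \<Rightarrow> 'b manifold \<Rightarrow> ('a \<Rightarrow> 'b) \<Rightarrow> bool" where
  "diffeomorphism M N f \<longleftrightarrow>
     bij_betw f (mpoints M) (mpoints N) \<and>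
     smooth_map M N f \<and> smooth_map N M (inv_into (mpoints M) f)"

definition euclidean_manifold :: "nat \<Rightarrow> (nat \<Rightarrow> real) manifold" where
  "euclidean_manifold k =
     \<lparr>mtop = Euclidean_space k,
      atlas = maximal_atlas (Euclidean_space k)
        {\<lparr>chart_dim = k, chart_dom = topspace (Euclidean_space k),
          chart_map = (\<lambda>x\<in>topspace (Euclidean_space k). x)\<rparr>}\<rparr>"

definition open_submanifold :: "'a manifold \<Rightarrow> 'a set \<Rightarrow> 'a manifold" where
  "open_submanifold M U = \<lparr>mtop = subtopology (mtop M) U, atlas = {c \<in> atlas M. chart_dom c \<subseteq> U}\<rparr>"

definition product_chart :: "'a chart \<Rightarrow> 'b chart \<Rightarrow> ('a \<times> 'b) chart" where
  "product_chart c d =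
     \<lparr>chart_dim = chart_dim c + chart_dim d,
      chart_dom = chart_dom c \<times> chart_dom d,
      chart_map = (\<lambda>z\<in>chart_dom c \<times> chart_dom d.
        append_coords (chart_dim c) (chart_map c (fst z)) (chart_map d (snd z)))\<rparr>"

definition product_manifold :: "'a manifold \<Rightarrow> 'b manifold \<Rightarrow> ('a \<times> 'b) manifold" where
  "product_manifold M N =
     \<lparr>mtop = prod_topology (mtop M) (mtop N),
      atlas = maximal_atlas (prod_topology (mtop M) (mtop N))
        {product_chart c d |c d. c \<in> atlas M \<and> d \<in> atlas N}\<rparr>"

text \<open>The manifold structure on a set S defined by a family A of charts: a set is open iff all
  its images in the charts are.\<close>

definition charted_topology :: "'a set \<Rightarrow> 'a chart set \<Rightarrow> 'a topology" where
  "charted_topology S A = topology (\<lambda>U. U \<subseteq> S \<and>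
     (\<forall>c\<in>A. openin (Euclidean_space (chart_dim c)) (chart_map c ` (U \<inter> chart_dom c))))"

definition charted_manifold :: "'a set \<Rightarrow> 'a chart set \<Rightarrow> 'a manifold" where
  "charted_manifold S A =
     \<lparr>mtop = charted_topology S A, atlas = maximal_atlas (charted_topology S A) A\<rparr>"


subsection \<open>Embedded submanifolds\<close>

text \<open>\<open>slice_chart M S k c\<close>: in the chart c of M, the set S is given by the vanishing of the
  coordinates of index k and beyond.  (As sets of functions, R^k is contained in R^m for k \<open>\<le>\<close> m.)\<close>

definition slice_chart :: "'a manifold \<Rightarrow> 'a set \<Rightarrow> nat \<Rightarrow> 'a chart \<Rightarrow> bool" where
  "slice_chart M S k c \<longleftrightarrow> c \<in> atlas M \<and> k \<le> chart_dim c \<and>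
     chart_map c ` (chart_dom c \<inter> S) = chart_map c ` chart_dom c \<inter> topspace (Euclidean_space k)"

definition induced_chart :: "'a set \<Rightarrow> nat \<Rightarrow> 'a chart \<Rightarrow> 'a chart" where
  "induced_chart S k c =
     \<lparr>chart_dim = k, chart_dom = chart_dom c \<inter> S,
      chart_map = restrict (chart_map c) (chart_dom c \<inter> S)\<rparr>"

definition embedded_submanifold :: "'a manifold \<Rightarrow> 'a set \<Rightarrow> bool" where
  "embedded_submanifold M S \<longleftrightarrow>
     S \<subseteq> mpoints M \<and> (\<forall>p\<in>S. \<exists>k c. slice_chart M S k c \<and> p \<in> chart_dom c)"

definition submanifold :: "'a manifold \<Rightarrow> 'a set \<Rightarrow> 'a manifold" where
  "submanifold M S =
     \<lparr>mtop = subtopology (mtop M) S,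
      atlas = maximal_atlas (subtopology (mtop M) S) {induced_chart S k c |k c. slice_chart M S k c}\<rparr>"


section \<open>Smooth vector bundles\<close>

record ('e, 'b) vbundle =
  total :: "'e manifold"
  base :: "'b manifold"
  proj :: "'e \<Rightarrow> 'b"
  vadd :: "'e \<Rightarrow> 'e \<Rightarrow> 'e"
  vzero :: "'b \<Rightarrow> 'e"
  vscale :: "real \<Rightarrow> 'e \<Rightarrow> 'e"

definition fibre :: "('e, 'b) vbundle \<Rightarrow> 'b \<Rightarrow> 'e set" where
  "fibre E x = {e \<in> mpoints (total E). proj E e = x}"

definition real_vector_space_on ::
    "'e set \<Rightarrow> ('e \<Rightarrow> 'e \<Rightarrow> 'e) \<Rightarrow> 'e \<Rightarrow> (real \<Rightarrow> 'e \<Rightarrow> 'e) \<Rightarrow> bool" where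
  "real_vector_space_on V add zero scl \<longleftrightarrow>
     zero \<in> V \<and> (\<forall>u\<in>V. \<forall>v\<in>V. add u v \<in> V) \<and> (\<forall>r. \<forall>v\<in>V. scl r v \<in> V) \<and>
     (\<forall>u\<in>V. \<forall>v\<in>V. \<forall>w\<in>V. add (add u v) w = add u (add v w)) \<and>
     (\<forall>u\<in>V. \<forall>v\<in>V. add u v = add v u) \<and>
     (\<forall>v\<in>V. add zero v = v) \<and>
     (\<forall>v\<in>V. \<exists>w\<in>V. add v w = zero) \<and>
     (\<forall>r. \<forall>u\<in>V. \<forall>v\<in>V. scl r (add u v) = add (scl r u) (scl r v)) \<and>
     (\<forall>r s. \<forall>v\<in>V. scl (r + s) v = add (scl r v) (scl s v)) \<and>
     (\<forall>r s. \<forall>v\<in>V. scl (r * s) v = scl r (scl s v)) \<and>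
     (\<forall>v\<in>V. scl 1 v = v)"

text \<open>A diffeomorphism from the part of the bundle over U to U \<open>\<times>\<close> R^k, over U and
  fibrewise linear.\<close>

definition local_trivialization ::
    "('e, 'b) vbundle \<Rightarrow> 'b set \<Rightarrow> nat \<Rightarrow> ('e \<Rightarrow> nat \<Rightarrow> real) \<Rightarrow> bool" where
  "local_trivialization E U k \<phi> \<longleftrightarrow>
     openin (mtop (base E)) U \<and>
     diffeomorphism (open_submanifold (total E) {e \<in> mpoints (total E). proj E e \<in> U})
       (product_manifold (open_submanifold (base E) U) (euclidean_manifold k))
       (\<lambda>e. (proj E e, \<phi> e)) \<and>
     (\<forall>x\<in>U. (\<forall>u\<in>fibre E x. \<forall>v\<in>fibre E x. \<phi> (vadd E u v) = (\<lambda>i. \<phi> u i + \<phi> v i)) \<and>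
            (\<forall>r. \<forall>v\<in>fibre E x. \<phi> (vscale E r v) = (\<lambda>i. r * \<phi> v i)))"

definition vector_bundle :: "('e, 'b) vbundle \<Rightarrow> bool" where
  "vector_bundle E \<longleftrightarrow>
     smooth_manifold (total E) \<and> smooth_manifold (base E) \<and>
     smooth_map (total E) (base E) (proj E) \<and>
     (\<forall>x\<in>mpoints (base E). real_vector_space_on (fibre E x) (vadd E) (vzero E x) (vscale E)) \<and>
     (\<forall>x\<in>mpoints (base E). \<exists>U k \<phi>. x \<in> U \<and> local_trivialization E U k \<phi>)"

text \<open>\<open>vbundle_morphism E E' f F\<close>: F is a smooth bundle map covering f.\<close>

definition vbundle_morphism ::
    "('e, 'b) vbundle \<Rightarrow> ('f, 'c) vbundle \<Rightarrow> ('b \<Rightarrow> 'c) \<Rightarrow> ('e \<Rightarrow> 'f) \<Rightarrow> bool" where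
  "vbundle_morphism E E' f F \<longleftrightarrow>
     smooth_map (base E) (base E') f \<and> smooth_map (total E) (total E') F \<and>
     (\<forall>e\<in>mpoints (total E). proj E' (F e) = f (proj E e)) \<and>
     (\<forall>x\<in>mpoints (base E).
        (\<forall>u\<in>fibre E x. \<forall>v\<in>fibre E x. F (vadd E u v) = vadd E' (F u) (F v)) \<and>
        (\<forall>r. \<forall>v\<in>fibre E x. F (vscale E r v) = vscale E' r (F v)))"

definition restrict_bundle :: "('e, 'b) vbundle \<Rightarrow> 'e set \<Rightarrow> ('e, 'b) vbundle" where
  "restrict_bundle E S = E\<lparr>total := submanifold (total E) S\<rparr>"

definition smooth_subbundle :: "('e, 'b) vbundle \<Rightarrow> 'e set \<Rightarrow> bool" where
  "smooth_subbundle E S \<longleftrightarrow>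
     vector_bundle E \<and> embedded_submanifold (total E) S \<and>
     (\<forall>x\<in>mpoints (base E). vzero E x \<in> S \<and>
        (\<forall>u\<in>fibre E x \<inter> S. \<forall>v\<in>fibre E x \<inter> S. vadd E u v \<in> S) \<and>
        (\<forall>r. \<forall>v\<in>fibre E x \<inter> S. vscale E r v \<in> S)) \<and>
     vector_bundle (restrict_bundle E S)"


section \<open>Tangent vectors\<close>

text \<open>A tangent vector at p is a family of coordinate vectors, one for each chart around p,
  transforming by the differentials of the coordinate changes.  The family is set to 0 at the
  remaining charts, so that the vector space operations on a tangent space are pointwise.\<close>

type_synonym 'a tvec = "'a chart \<Rightarrow> nat \<Rightarrow> real"

definition charts_at :: "'a manifold \<Rightarrow> 'a \<Rightarrow> 'a chart set" where
  "charts_at M p = {c \<in> atlas M. p \<in> chart_dom c}"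

definition tangent_space :: "'a manifold \<Rightarrow> 'a \<Rightarrow> 'a tvec set" where
  "tangent_space M p = {v.
     (\<forall>c\<in>charts_at M p. v c \<in> topspace (Euclidean_space (chart_dim c))) \<and>
     (\<forall>c\<in>charts_at M p. \<forall>d\<in>charts_at M p.
        v d = differential (chart_dim c) (local_rep c d (\<lambda>q. q)) (chart_map c p) (v c)) \<and>
     (\<forall>c. c \<notin> charts_at M p \<longrightarrow> v c = (\<lambda>i. 0))}"

definition tzero :: "'a tvec" where
  "tzero = (\<lambda>c i. 0)"

definition tscale :: "real \<Rightarrow> 'a tvec \<Rightarrow> 'a tvec" where
  "tscale r v = (\<lambda>c i. r * v c i)"

definition tadd :: "'a tvec \<Rightarrow> 'a tvec \<Rightarrow> 'a tvec" where
  "tadd v w = (\<lambda>c i. v c i + w c i)"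

text \<open>The tangent map of f at p; the choice of the chart c around p is immaterial.\<close>

definition tangent_map ::
    "'a manifold \<Rightarrow> 'b manifold \<Rightarrow> ('a \<Rightarrow> 'b) \<Rightarrow> 'a \<Rightarrow> 'a tvec \<Rightarrow> 'b tvec" where
  "tangent_map M N f p v = (\<lambda>d. if d \<in> charts_at N (f p)
     then let c = (SOME c. c \<in> charts_at M p)
          in differential (chart_dim c) (local_rep c d f) (chart_map c p) (v c)
     else (\<lambda>i. 0))"

text \<open>The restriction (pullback) of the tangent bundle of N along a map f from M to N: the bundle
  over M with fibre the tangent space of N at f x.  A chart c of M and a chart d of N give the
  bundle chart sending (x, v) to the coordinates of x in c followed by those of v in d.
  For f the identity this is the tangent bundle of M.\<close>

definition tangent_along_points :: "'a manifold \<Rightarrow> 'b manifold \<Rightarrow> ('a \<Rightarrow> 'b) \<Rightarrow> ('a \<times> 'b tvec) set" where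
  "tangent_along_points M N f = (SIGMA x:mpoints M. tangent_space N (f x))"

definition tangent_along_chart ::
    "'a manifold \<Rightarrow> 'b manifold \<Rightarrow> ('a \<Rightarrow> 'b) \<Rightarrow> 'a chart \<Rightarrow> 'b chart \<Rightarrow> ('a \<times> 'b tvec) chart" where
  "tangent_along_chart M N f c d =
    (let D = {(x, v) \<in> tangent_along_points M N f. x \<in> chart_dom c \<and> f x \<in> chart_dom d}
     in \<lparr>chart_dim = chart_dim c + chart_dim d, chart_dom = D,
         chart_map = (\<lambda>(x, v)\<in>D. append_coords (chart_dim c) (chart_map c x) (v d))\<rparr>)"

definition tangent_along ::
    "'a manifold \<Rightarrow> 'b manifold \<Rightarrow> ('a \<Rightarrow> 'b) \<Rightarrow> ('a \<times> 'b tvec, 'a) vbundle" where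
  "tangent_along M N f =
     \<lparr>total = charted_manifold (tangent_along_points M N f)
        {tangent_along_chart M N f c d |c d. c \<in> atlas M \<and> d \<in> atlas N},
      base = M,
      proj = fst,
      vadd = (\<lambda>(x, v) (y, w). (x, tadd v w)),
      vzero = (\<lambda>x. (x, tzero)),
      vscale = (\<lambda>r (x, v). (x, tscale r v))\<rparr>"


section \<open>Categories and functors\<close>

text \<open>Hom-sets need not be disjoint, so composition takes its three objects as arguments:
  \<open>Comp C X Y Z g f\<close> is g after f, for f from X to Y and g from Y to Z.\<close>

record ('o, 'm) cat =
  Obj :: "'o set"
  Hom :: "'o \<Rightarrow> 'o \<Rightarrow> 'm set"
  Ident :: "'o \<Rightarrow> 'm"
  Comp :: "'o \<Rightarrow> 'o \<Rightarrow> 'o \<Rightarrow> 'm \<Rightarrow> 'm \<Rightarrow> 'm"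

definition is_category :: "('o, 'm) cat \<Rightarrow> bool" where
  "is_category C \<longleftrightarrow>
     (\<forall>X\<in>Obj C. Ident C X \<in> Hom C X X) \<and>
     (\<forall>X\<in>Obj C. \<forall>Y\<in>Obj C. \<forall>Z\<in>Obj C. \<forall>f\<in>Hom C X Y. \<forall>g\<in>Hom C Y Z. Comp C X Y Z g f \<in> Hom C X Z) \<and>
     (\<forall>X\<in>Obj C. \<forall>Y\<in>Obj C. \<forall>f\<in>Hom C X Y.
        Comp C X X Y f (Ident C X) = f \<and> Comp C X Y Y (Ident C Y) f = f) \<and>
     (\<forall>W\<in>Obj C. \<forall>X\<in>Obj C. \<forall>Y\<in>Obj C. \<forall>Z\<in>Obj C. \<forall>f\<in>Hom C W X. \<forall>g\<in>Hom C X Y. \<forall>h\<in>Hom C Y Z.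
        Comp C W X Z (Comp C X Y Z h g) f = Comp C W Y Z h (Comp C W X Y g f))"

definition is_functor ::
    "('o, 'm) cat \<Rightarrow> ('p, 'n) cat \<Rightarrow> ('o \<Rightarrow> 'p) \<Rightarrow> ('o \<Rightarrow> 'o \<Rightarrow> 'm \<Rightarrow> 'n) \<Rightarrow> bool" where
  "is_functor C D F\<^sub>o F\<^sub>m \<longleftrightarrow>
     is_category C \<and> is_category D \<and>
     (\<forall>X\<in>Obj C. F\<^sub>o X \<in> Obj D) \<and>
     (\<forall>X\<in>Obj C. \<forall>Y\<in>Obj C. \<forall>f\<in>Hom C X Y. F\<^sub>m X Y f \<in> Hom D (F\<^sub>o X) (F\<^sub>o Y)) \<and>
     (\<forall>X\<in>Obj C. F\<^sub>m X X (Ident C X) = Ident D (F\<^sub>o X)) \<and>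
     (\<forall>X\<in>Obj C. \<forall>Y\<in>Obj C. \<forall>Z\<in>Obj C. \<forall>f\<in>Hom C X Y. \<forall>g\<in>Hom C Y Z.
        F\<^sub>m X Z (Comp C X Y Z g f) = Comp D (F\<^sub>o X) (F\<^sub>o Y) (F\<^sub>o Z) (F\<^sub>m Y Z g) (F\<^sub>m X Y f))"


section \<open>Simplicial manifolds\<close>

text \<open>\<open>face X n j\<close> is the j-th face map from level n to level n - 1 (for n \<open>\<ge>\<close> 1 and j \<open>\<le>\<close> n), and
  \<open>degen X n j\<close> the j-th degeneracy from level n to level n + 1 (for j \<open>\<le>\<close> n).\<close>

record 'a smfd =
  level :: "nat \<Rightarrow> 'a manifold"
  face :: "nat \<Rightarrow> nat \<Rightarrow> 'a \<Rightarrow> 'a"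
  degen :: "nat \<Rightarrow> nat \<Rightarrow> 'a \<Rightarrow> 'a"

definition simplicial_manifold :: "'a smfd \<Rightarrow> bool" where
  "simplicial_manifold X \<longleftrightarrow>
     (\<forall>n. smooth_manifold (level X n)) \<and>
     (\<forall>n j. j \<le> n + 1 \<longrightarrow> smooth_map (level X (n + 1)) (level X n) (face X (n + 1) j)) \<and>
     (\<forall>n j. j \<le> n \<longrightarrow> smooth_map (level X n) (level X (n + 1)) (degen X n j)) \<and>
     (\<forall>n i j. i < j \<and> j \<le> n + 2 \<longrightarrow> (\<forall>x\<in>mpoints (level X (n + 2)).
        face X (n + 1) i (face X (n + 2) j x) = face X (n + 1) (j - 1) (face X (n + 2) i x))) \<and>
     (\<forall>n i j. i \<le> j \<and> j \<le> n \<longrightarrow> (\<forall>x\<in>mpoints (level X n).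
        degen X (n + 1) i (degen X n j x) = degen X (n + 1) (j + 1) (degen X n i x))) \<and>
     (\<forall>n i j. i < j \<and> j \<le> n \<longrightarrow> (\<forall>x\<in>mpoints (level X n).
        face X (n + 1) i (degen X n j x) = degen X (n - 1) (j - 1) (face X n i x))) \<and>
     (\<forall>n i j. (i = j \<or> i = j + 1) \<and> j \<le> n \<longrightarrow> (\<forall>x\<in>mpoints (level X n).
        face X (n + 1) i (degen X n j x) = x)) \<and>
     (\<forall>n i j. j + 1 < i \<and> i \<le> n + 1 \<longrightarrow> (\<forall>x\<in>mpoints (level X n).
        face X (n + 1) i (degen X n j x) = degen X (n - 1) j (face X n (i - 1) x)))"

text \<open>Morphisms are normalised outside the underlying point sets, so that equality of morphisms is
  equality of functions.\<close>

definition simplicial_morphism :: "'a smfd \<Rightarrow> 'b smfd \<Rightarrow> (nat \<Rightarrow> 'a \<Rightarrow> 'b) \<Rightarrow> bool" where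
  "simplicial_morphism X Y f \<longleftrightarrow>
     (\<forall>n. smooth_map (level X n) (level Y n) (f n) \<and> f n \<in> extensional (mpoints (level X n))) \<and>
     (\<forall>n j. j \<le> n + 1 \<longrightarrow> (\<forall>x\<in>mpoints (level X (n + 1)).
        f n (face X (n + 1) j x) = face Y (n + 1) j (f (n + 1) x))) \<and>
     (\<forall>n j. j \<le> n \<longrightarrow> (\<forall>x\<in>mpoints (level X n).
        f (n + 1) (degen X n j x) = degen Y n j (f n x)))"

definition sMan :: "('a smfd, nat \<Rightarrow> 'a \<Rightarrow> 'a) cat" where
  "sMan =
     \<lparr>Obj = {X. simplicial_manifold X},
      Hom = (\<lambda>X Y. {f. simplicial_morphism X Y f}),
      Ident = (\<lambda>X n. \<lambda>x\<in>mpoints (level X n). x),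
      Comp = (\<lambda>X Y Z g f n. compose (mpoints (level X n)) (g n) (f n))\<rparr>"

text \<open>The iterated degeneracy from level 0 to level n.  By the simplicial identities the choice of
  the degeneracy in each step is immaterial.\<close>

primrec iter_degen :: "'a smfd \<Rightarrow> nat \<Rightarrow> 'a \<Rightarrow> 'a" where
  "iter_degen X 0 x = x"
| "iter_degen X (Suc n) x = degen X n 0 (iter_degen X n x)"


section \<open>Chain complexes of vector bundles\<close>

text \<open>\<open>cdiff K n\<close> is the differential from degree n to degree n - 1, for n \<open>\<ge>\<close> 1.\<close>

record ('e, 'b) vbcomplex =
  cbase :: "'b manifold"
  cbundle :: "nat \<Rightarrow> ('e, 'b) vbundle"
  cdiff :: "nat \<Rightarrow> 'e \<Rightarrow> 'e"

definition chain_complex :: "('e, 'b) vbcomplex \<Rightarrow> bool" where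
  "chain_complex K \<longleftrightarrow>
     (\<forall>n. vector_bundle (cbundle K n) \<and> base (cbundle K n) = cbase K) \<and>
     (\<forall>n. vbundle_morphism (cbundle K (n + 1)) (cbundle K n) (\<lambda>x. x) (cdiff K (n + 1))) \<and>
     (\<forall>n. \<forall>e\<in>mpoints (total (cbundle K (n + 2))).
        cdiff K (n + 1) (cdiff K (n + 2) e) = vzero (cbundle K n) (proj (cbundle K (n + 2)) e))"

definition chain_morphism ::
    "('e, 'b) vbcomplex \<Rightarrow> ('f, 'c) vbcomplex \<Rightarrow> ('b \<Rightarrow> 'c) \<times> (nat \<Rightarrow> 'e \<Rightarrow> 'f) \<Rightarrow> bool" where
  "chain_morphism K L = (\<lambda>(f, F).
     f \<in> extensional (mpoints (cbase K)) \<and>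
     (\<forall>n. F n \<in> extensional (mpoints (total (cbundle K n)))) \<and>
     (\<forall>n. vbundle_morphism (cbundle K n) (cbundle L n) f (F n)) \<and>
     (\<forall>n. \<forall>e\<in>mpoints (total (cbundle K (n + 1))).
        F n (cdiff K (n + 1) e) = cdiff L (n + 1) (F (n + 1) e)))"

definition ChVB :: "(('e, 'b) vbcomplex, ('b \<Rightarrow> 'b) \<times> (nat \<Rightarrow> 'e \<Rightarrow> 'e)) cat" where
  "ChVB =
     \<lparr>Obj = {K. chain_complex K},
      Hom = (\<lambda>K L. {f. chain_morphism K L f}),
      Ident = (\<lambda>K. ((\<lambda>x\<in>mpoints (cbase K). x), \<lambda>n. \<lambda>e\<in>mpoints (total (cbundle K n)). e)),
      Comp = (\<lambda>K L M (g, G) (f, F).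
        (compose (mpoints (cbase K)) g f,
         \<lambda>n. compose (mpoints (total (cbundle K n))) (G n) (F n)))\<rparr>"


section \<open>The tangent complex\<close>

text \<open>The restriction to \<open>X\<^sub>0\<close> of the tangent bundle of \<open>X\<^sub>n\<close>.  Its points are pairs of a point
  x of \<open>X\<^sub>0\<close> and a tangent vector of \<open>X\<^sub>n\<close> at the image of x.\<close>

definition restricted_tangent :: "'a smfd \<Rightarrow> nat \<Rightarrow> ('a \<times> 'a tvec, 'a) vbundle" where
  "restricted_tangent X n = tangent_along (level X 0) (level X n) (iter_degen X n)"

text \<open>In degree 0 the condition is empty and this is the whole tangent bundle of \<open>X\<^sub>0\<close>.\<close>

definition tangent_complex_points :: "'a smfd \<Rightarrow> nat \<Rightarrow> ('a \<times> 'a tvec) set" where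
  "tangent_complex_points X n =
     {(x, v). x \<in> mpoints (level X 0) \<and> v \<in> tangent_space (level X n) (iter_degen X n x) \<and>
        (\<forall>j<n. tangent_map (level X n) (level X (n - 1)) (face X n j) (iter_degen X n x) v = tzero)}"

definition tangent_complex :: "'a smfd \<Rightarrow> ('a \<times> 'a tvec, 'a) vbcomplex" where
  "tangent_complex X =
     \<lparr>cbase = level X 0,
      cbundle = (\<lambda>n. restrict_bundle (restricted_tangent X n) (tangent_complex_points X n)),
      cdiff = (\<lambda>n (x, v). (x, tscale ((-1) ^ n)
        (tangent_map (level X n) (level X (n - 1)) (face X n n) (iter_degen X n x) v)))\<rparr>"

definition tangent_complex_map ::
    "'a smfd \<Rightarrow> 'b smfd \<Rightarrow> (nat \<Rightarrow> 'a \<Rightarrow> 'b) \<Rightarrow>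
     ('a \<Rightarrow> 'b) \<times> (nat \<Rightarrow> 'a \<times> 'a tvec \<Rightarrow> 'b \<times> 'b tvec)" where
  "tangent_complex_map X Y f =
     (f 0,
      \<lambda>n. \<lambda>(x, v)\<in>tangent_complex_points X n.
        (f 0 x, tangent_map (level X n) (level Y n) (f n) (iter_degen X n x) v))"

end

theory Submission
  imports Defs "Jordan_Normal_Form.Determinant"
begin

text \<open>All faces and degeneracies preserve the base points, so that the fibres of the bundles
  \<open>TX\<^sub>n\<close> over \<open>X\<^sub>0\<close> form a simplicial vector space.  As in the Dold-Kan correspondence,
  the product of the operators 1 - \<open>s\<^sub>j d\<^sub>j\<close> for j < n is a smooth idempotent bundle endomorphism whose image
  is the intersection of the kernels of the \<open>d\<^sub>j\<close>, j < n.  The image of a smooth family of idempotents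
  q(x) is a subbundle: near a point \<open>x\<^sub>0\<close> the endomorphism q(x) q(\<open>x\<^sub>0\<close>) + (1 - q(x)) (1 - q(\<open>x\<^sub>0\<close>)) is
  invertible and carries the image of q(\<open>x\<^sub>0\<close>) to that of q(x), which gives slice charts.  Functoriality is the
  chain rule.\<close>

section \<open>Calculus on open subsets of Euclidean spaces\<close>

text \<open>The obstacle is rank: an intersection of kernels of smoothly varying linear maps may
  change dimension from point to point. In a continuous family of idempotents the rank is locally
  constant, and the image is the set of fixed vectors, which is a linear condition. The factors need
  not commute and their order matters: 1 - s_j d_j is applied after the factors of smaller index,
  because d_i s_j = s_(j-1) d_i and d_i d_j = d_(j-1) d_i for i < j show that it preserves the
  vanishing of d_i. Slice charts are obtained by changes of coordinates that are linear in the
  fibre. These are inverted pointwise by cofactors, so smoothness of the inverse is visible from a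
  formula and no inverse function theorem enters. A bundle needs both a manifold structure on its
  total space and trivializations. Both come from charts whose image is a full cylinder U x R^m and
  in which bundle maps are linear in the last m coordinates. One commuting square of smooth maps,
  together with a scalar, provides the changes of bundle charts, the differentials of the complex
  and the action on morphisms.\<close>

abbreviation rvec :: "nat \<Rightarrow> (nat \<Rightarrow> real) set" where
  "rvec k \<equiv> topspace (Euclidean_space k)"

lemma mem_rvec: "x \<in> rvec k \<longleftrightarrow> (\<forall>i\<ge>k. x i = 0)"
  by (simp add: topspace_Euclidean_space)

section \<open>Topology of R^k inside the space of real sequences\<close>

lemma Euclidean_space_eq_top_of_set: "Euclidean_space k = top_of_set (rvec k)"
  by (simp add: Euclidean_space_def euclidean_product_topology)

lemma subtopology_Euclidean_space:
  assumes "U \<subseteq> rvec k"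
  shows "subtopology (Euclidean_space k) U = top_of_set U"
proof -
  have "rvec k \<inter> U = U" using assms by blast
  then show ?thesis
    by (subst Euclidean_space_eq_top_of_set) (simp add: subtopology_subtopology)
qed

lemma openin_Euclidean_space_subset: "openin (Euclidean_space k) U \<Longrightarrow> U \<subseteq> rvec k"
  by (rule openin_subset)

lemma continuous_map_Euclidean_subset:
  assumes "U \<subseteq> rvec k"
  shows "continuous_map (subtopology (Euclidean_space k) U) euclideanreal g \<longleftrightarrow> continuous_on U g"
  by (simp add: subtopology_Euclidean_space[OF assms])

lemma openin_Euclidean_space_iff:
  "openin (Euclidean_space k) U \<longleftrightarrow> (\<exists>S. open S \<and> U = S \<inter> rvec k)"
  by (subst Euclidean_space_eq_top_of_set) (auto simp: openin_open)

text \<open>A basic neighbourhood in the product topology restricts finitely many coordinates, so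
  one radius serves them all; from index k on both points are 0 and no condition arises. Such boxes
  allow coordinates to be moved one at a time.\<close>

lemma openin_Euclidean_box:
  assumes "openin (Euclidean_space k) U" "a \<in> U"
  shows "\<exists>e>0. \<forall>x\<in>rvec k. (\<forall>i<k. \<bar>x i - a i\<bar> < e) \<longrightarrow> x \<in> U"
proof -
  obtain S where S: "open S" "U = S \<inter> rvec k"
    using assms(1) by (auto simp: openin_Euclidean_space_iff)
  have "openin (product_topology (\<lambda>i::nat. euclidean :: real topology) UNIV) S"
    using S(1) by (simp add: open_openin flip: euclidean_product_topology)
  moreover have "a \<in> S" using S assms(2) by simp
  ultimately have "\<exists>X. a \<in> Pi\<^sub>E UNIV X \<and> (\<forall>i. openin euclideanreal (X i)) \<and>
      finite {i. X i \<noteq> topspace euclideanreal} \<and> Pi\<^sub>E UNIV X \<subseteq> S"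
    by (rule product_topology_open_contains_basis)
  then obtain X where X: "a \<in> Pi\<^sub>E UNIV X" "\<And>i. openin euclideanreal (X i)"
      "finite {i. X i \<noteq> topspace euclideanreal}" "Pi\<^sub>E UNIV X \<subseteq> S"
    by (elim exE conjE) (rule that, auto)
  have Xo: "open (X i)" for i by (rule open_openin[THEN iffD2]) (rule X(2))
  have "\<exists>d>0. \<forall>y. \<bar>y - a i\<bar> < d \<longrightarrow> y \<in> X i" for i
  proof -
    have "a i \<in> X i" using X(1) by auto
    then show ?thesis using Xo[of i] unfolding open_real by blast
  qed
  then obtain d where d: "\<And>i. d i > 0" "\<And>i y. \<bar>y - a i\<bar> < d i \<Longrightarrow> y \<in> X i" by metis
  \<comment> \<open>The 1 keeps the set nonempty when no coordinate is restricted.\<close>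
  define e where "e = Min (insert 1 (d ` {i. X i \<noteq> UNIV}))"
  have fin: "finite (insert 1 (d ` {i. X i \<noteq> UNIV}))" using X(3) by (simp del: insert_iff)
  have e0: "e > 0" unfolding e_def using fin d(1) by (subst Min_gr_iff) auto
  have ed: "e \<le> d i" if "X i \<noteq> UNIV" for i unfolding e_def using fin that by (intro Min_le) auto
  have "x \<in> U" if x: "x \<in> rvec k" "\<forall>i<k. \<bar>x i - a i\<bar> < e" for x
  proof -
    have "x i \<in> X i" for i
    proof (cases "X i = UNIV")
      case False
      have "\<bar>x i - a i\<bar> < d i"
      proof (cases "i < k")
        case True then show ?thesis using x(2) ed[OF False] by force
      next
        case F: False
        have "a \<in> rvec k" using S(2) assms(2) by auto
        then have "x i - a i = 0" using F x(1) by (simp add: mem_rvec)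
        then show ?thesis using d(1)[of i] by simp
      qed
      then show ?thesis by (rule d(2))
    qed auto
    then have "x \<in> S" using X(4) by auto
    then show ?thesis using S(2) x(1) by simp
  qed
  then show ?thesis using e0 by blast
qed

lemma rvec_fun_upd: "x \<in> rvec k \<Longrightarrow> j < k \<Longrightarrow> x(j := t) \<in> rvec k"
  by (auto simp: mem_rvec)

text \<open>Partial derivatives at a point of an open set see only points of that set; the
  congruence arguments for them go through this.\<close>

lemma eventually_fun_upd:
  assumes "openin (Euclidean_space k) U" "x \<in> U" "j < k"
  shows "\<forall>\<^sub>F t in nhds (x j). x(j := t) \<in> U"
proof -
  obtain e where e: "e > 0" "\<And>y. y \<in> rvec k \<Longrightarrow> (\<And>i. i < k \<Longrightarrow> \<bar>y i - x i\<bar> < e) \<Longrightarrow> y \<in> U"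
    using openin_Euclidean_box[OF assms(1,2)] by blast
  have "x \<in> rvec k" using assms openin_Euclidean_space_subset by blast
  then have "x(j := t) \<in> U" if "dist t (x j) < e" for t
    using that e(1) assms(3) by (intro e(2)) (auto simp: rvec_fun_upd dist_real_def)
  then show ?thesis unfolding eventually_nhds_metric using e(1) by blast
qed

section \<open>Functions of class C^r and their algebra\<close>

lemma C_diff_continuous_on: "C_diff k r U g \<Longrightarrow> U \<subseteq> rvec k \<Longrightarrow> continuous_on U g"
  by (cases r) (auto simp: continuous_map_Euclidean_subset)

lemma C_diff_Suc_partial:
  assumes "C_diff k (Suc r) U g" "j < k" "x \<in> U"
  shows "((\<lambda>t. g (x(j := t))) has_real_derivative partial_deriv j g x) (at (x j))"
  using assms unfolding partial_deriv_def by (auto simp: DERIV_deriv_iff_field_differentiable)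

text \<open>Openness of U enters through \<open>eventually_fun_upd\<close>: f and g agree on a piece
  of every coordinate line through a point of U, so their partial derivatives agree on U and the
  induction can pass to them.\<close>

lemma C_diff_cong:
  assumes "openin (Euclidean_space k) U" "\<And>x. x \<in> U \<Longrightarrow> f x = g x" "C_diff k r U f"
  shows "C_diff k r U g"
  using assms(2,3)
proof (induction r arbitrary: f g)
  case 0
  then show ?case using assms(1) openin_Euclidean_space_subset
    by (metis C_diff.simps(1) C_diff_continuous_on continuous_map_Euclidean_subset continuous_on_cong)
next
  case (Suc r)
  have U: "U \<subseteq> rvec k" using assms(1) openin_Euclidean_space_subset by blast
  have ev: "\<forall>\<^sub>F t in nhds (x j). f (x(j := t)) = g (x(j := t))" if "x \<in> U" "j < k" for x j
    by (rule eventually_mono[OF eventually_fun_upd[OF assms(1) that]]) (rule Suc.prems)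
  have pd: "partial_deriv j f x = partial_deriv j g x" if "x \<in> U" "j < k" for x j
    unfolding partial_deriv_def by (rule deriv_cong_ev[OF ev[OF that]]) simp
  have "continuous_on U g" using C_diff_continuous_on[OF Suc.prems(2) U] Suc.prems(1) by (simp cong: continuous_on_cong)
  moreover have "(\<lambda>t. g (x(j := t))) field_differentiable at (x j)" if "x \<in> U" "j < k" for x j
    using C_diff_Suc_partial[OF Suc.prems(2) that(2,1)] DERIV_cong_ev[OF refl ev[OF that] refl]
    unfolding field_differentiable_def by blast
  moreover have "C_diff k r U (partial_deriv j g)" if "j < k" for j
    by (rule Suc.IH[of "partial_deriv j f"]) (use pd that Suc.prems(2) in auto)
  ultimately show ?case by (simp add: continuous_map_Euclidean_subset[OF U])
qed

text \<open>Introduction rule with freely chosen derivative formulas D. Closure lemmas can then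
  supply the Leibniz rule, the chain rule and so on as they stand, and \<open>C_diff_cong\<close>
  identifies them with \<open>partial_deriv\<close>.\<close>

lemma C_diff_SucI:
  assumes U: "openin (Euclidean_space k) U" and "continuous_on U g"
    and D: "\<And>j x. j < k \<Longrightarrow> x \<in> U \<Longrightarrow> ((\<lambda>t. g (x(j := t))) has_real_derivative D j x) (at (x j))"
    and "\<And>j. j < k \<Longrightarrow> C_diff k r U (D j)"
  shows "C_diff k (Suc r) U g"
proof -
  have "partial_deriv j g x = D j x" if "j < k" "x \<in> U" for j x
    unfolding partial_deriv_def using D[OF that] by (rule DERIV_imp_deriv)
  then have "C_diff k r U (partial_deriv j g)" if "j < k" for j
    using C_diff_cong[OF U, of "D j" "partial_deriv j g"] assms(4) that by simp
  moreover have "(\<lambda>t. g (x(j := t))) field_differentiable at (x j)" if "x \<in> U" "j < k" for x j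
    using D[OF that(2,1)] field_differentiable_def by blast
  ultimately show ?thesis
    using assms(2) openin_Euclidean_space_subset[OF U] by (simp add: continuous_map_Euclidean_subset)
qed

lemma C_diff_SucD: "C_diff k (Suc r) U g \<Longrightarrow> C_diff k r U g"
  by (induction r arbitrary: g) auto

lemma C_diff_subset:
  assumes "openin (Euclidean_space k) U" "V \<subseteq> U" "C_diff k r U g"
  shows "C_diff k r V g"
  using assms(3)
proof (induction r arbitrary: g)
  case 0
  then show ?case using assms openin_Euclidean_space_subset[OF assms(1)]
    by (auto simp: continuous_map_Euclidean_subset intro: continuous_on_subset)
next
  case (Suc r)
  then have "continuous_on V g" using assms openin_Euclidean_space_subset[OF assms(1)]
    by (meson C_diff_continuous_on continuous_on_subset)
  moreover have "V \<subseteq> rvec k" using assms openin_Euclidean_space_subset[OF assms(1)] by blast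
  ultimately show ?case using Suc assms(2) by (auto simp: continuous_map_Euclidean_subset)
qed

lemma C_diff_const: "openin (Euclidean_space k) U \<Longrightarrow> C_diff k r U (\<lambda>x. c)"
proof (induction r arbitrary: c)
  case 0 then show ?case by simp
next
  case (Suc r)
  show ?case by (rule C_diff_SucI[where D = "\<lambda>j x. 0"]) (use Suc in auto)
qed

lemma C_diff_coord:
  assumes "openin (Euclidean_space k) U"
  shows "C_diff k r U (\<lambda>x. x i)"
proof -
  have c: "continuous_on U (\<lambda>x. x i)" for U :: "(nat \<Rightarrow> real) set"
    by (rule continuous_on_product_then_coordinatewise[OF continuous_on_id])
  show ?thesis
  proof (cases r)
    case 0
    then show ?thesis using c openin_Euclidean_space_subset[OF assms] by (simp add: continuous_map_Euclidean_subset)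
  next
    case (Suc q)
    have "C_diff k (Suc q) U (\<lambda>x. x i)"
      by (rule C_diff_SucI[where D = "\<lambda>j x. if i = j then 1 else 0", OF assms c])
        (use assms C_diff_const in auto)
    then show ?thesis using Suc by simp
  qed
qed

lemma C_diff_add:
  assumes U: "openin (Euclidean_space k) U" and "C_diff k r U f" "C_diff k r U g"
  shows "C_diff k r U (\<lambda>x. f x + g x)"
  using assms(2,3)
proof (induction r arbitrary: f g)
  case 0
  then show ?case using openin_Euclidean_space_subset[OF U]
    by (auto simp: continuous_map_Euclidean_subset intro: continuous_intros)
next
  case (Suc r)
  show ?case
  proof (rule C_diff_SucI[where D = "\<lambda>j x. partial_deriv j f x + partial_deriv j g x", OF U])
    show "continuous_on U (\<lambda>x. f x + g x)"
      using Suc.prems C_diff_continuous_on openin_Euclidean_space_subset[OF U] by (blast intro: continuous_on_add)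
    show "((\<lambda>t. f (x(j := t)) + g (x(j := t))) has_real_derivative
       partial_deriv j f x + partial_deriv j g x) (at (x j))" if "j < k" "x \<in> U" for j x
      using DERIV_add[OF C_diff_Suc_partial[OF Suc.prems(1) that] C_diff_Suc_partial[OF Suc.prems(2) that]] .
  qed (use Suc in auto)
qed

text \<open>Both factors vary in the induction: the Leibniz rule pairs a derivative with an
  undifferentiated factor, which \<open>C_diff_SucD\<close> lowers to the order of the induction
  hypothesis.\<close>

lemma C_diff_mult:
  assumes U: "openin (Euclidean_space k) U" and "C_diff k r U f" "C_diff k r U g"
  shows "C_diff k r U (\<lambda>x. f x * g x)"
  using assms(2,3)
proof (induction r arbitrary: f g)
  case 0
  then show ?case using openin_Euclidean_space_subset[OF U]
    by (auto simp: continuous_map_Euclidean_subset intro: continuous_intros)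
next
  case (Suc r)
  show ?case
  proof (rule C_diff_SucI[where D = "\<lambda>j x. partial_deriv j f x * g x + f x * partial_deriv j g x", OF U])
    show "continuous_on U (\<lambda>x. f x * g x)"
      using Suc.prems C_diff_continuous_on openin_Euclidean_space_subset[OF U] by (blast intro: continuous_on_mult)
    show "((\<lambda>t. f (x(j := t)) * g (x(j := t))) has_real_derivative
       partial_deriv j f x * g x + f x * partial_deriv j g x) (at (x j))" if "j < k" "x \<in> U" for j x
      using DERIV_mult[OF C_diff_Suc_partial[OF Suc.prems(1) that] C_diff_Suc_partial[OF Suc.prems(2) that]]
      by (simp add: algebra_simps del: fun_upd_apply)
    show "C_diff k r U (\<lambda>x. partial_deriv j f x * g x + f x * partial_deriv j g x)" if "j < k" for j
      using Suc.prems that by (intro C_diff_add[OF U] Suc.IH) (auto intro: C_diff_SucD[OF Suc.prems(1)] C_diff_SucD[OF Suc.prems(2)])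
  qed
qed

text \<open>Here f stays fixed: the derivative -f' / f^2 contains 1 / f again, in the order already
  treated, and the rest is closure under products.\<close>

lemma C_diff_inverse:
  assumes U: "openin (Euclidean_space k) U" and "C_diff k r U f" and nz: "\<And>x. x \<in> U \<Longrightarrow> f x \<noteq> 0"
  shows "C_diff k r U (\<lambda>x. inverse (f x))"
  using assms(2)
proof (induction r)
  case 0
  then show ?case using openin_Euclidean_space_subset[OF U] nz
    by (auto simp: continuous_map_Euclidean_subset intro!: continuous_on_inverse)
next
  case (Suc r)
  have IH: "C_diff k r U (\<lambda>x. inverse (f x))" using Suc C_diff_SucD by blast
  show ?case
  proof (rule C_diff_SucI[where D = "\<lambda>j x. (- 1) * (partial_deriv j f x * (inverse (f x) * inverse (f x)))", OF U])
    show "continuous_on U (\<lambda>x. inverse (f x))"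
      using Suc.prems C_diff_continuous_on openin_Euclidean_space_subset[OF U] nz by (blast intro: continuous_on_inverse)
    show "((\<lambda>t. inverse (f (x(j := t)))) has_real_derivative
       (- 1) * (partial_deriv j f x * (inverse (f x) * inverse (f x)))) (at (x j))" if "j < k" "x \<in> U" for j x
      using DERIV_inverse'[OF C_diff_Suc_partial[OF Suc.prems(1) that]] nz[OF that(2)]
      by (simp add: algebra_simps del: fun_upd_apply)
    show "C_diff k r U (\<lambda>x. (- 1) * (partial_deriv j f x * (inverse (f x) * inverse (f x))))" if "j < k" for j
      using Suc.prems that by (intro C_diff_mult[OF U] C_diff_const[OF U] IH) auto
  qed
qed

section \<open>Chain rule and composition\<close>

lemma MVT_unordered:
  fixes f f' :: "real \<Rightarrow> real"
  assumes "\<And>s. min a b \<le> s \<Longrightarrow> s \<le> max a b \<Longrightarrow> (f has_real_derivative f' s) (at s)"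
  shows "\<exists>s. min a b \<le> s \<and> s \<le> max a b \<and> f b - f a = f' s * (b - a)"
proof (cases a b rule: linorder_cases)
  case less
  then obtain z where "a < z" "z < b" "f b - f a = (b - a) * f' z"
    using MVT2[of a b f f'] assms by auto
  then show ?thesis by (intro exI[of _ z]) auto
next
  case greater
  then obtain z where "b < z" "z < a" "f a - f b = (a - b) * f' z"
    using MVT2[of b a f f'] assms by auto
  then show ?thesis by (intro exI[of _ z]) (auto simp: algebra_simps)
qed auto

text \<open>Telescoping one coordinate at a time reduces this to the mean value theorem.\<close>

lemma C_diff_chain_curve:
  fixes c :: "real \<Rightarrow> nat \<Rightarrow> real"
  assumes V: "openin (Euclidean_space m) V" and g: "C_diff m (Suc 0) V g"
    and c0: "c t0 \<in> V"
    and c': "\<And>i. i < m \<Longrightarrow> ((\<lambda>t. c t i) has_real_derivative c' i) (at t0)"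
    and cV: "\<forall>\<^sub>F t in nhds t0. c t \<in> rvec m"
  shows "((\<lambda>t. g (c t)) has_real_derivative (\<Sum>i<m. partial_deriv i g (c t0) * c' i)) (at t0)"
proof -
  define a where "a = c t0"
  have arv: "a \<in> rvec m" using c0 openin_Euclidean_space_subset[OF V] by (auto simp: a_def)
  obtain e where e: "e > 0" "\<And>y. y \<in> rvec m \<Longrightarrow> (\<And>i. i < m \<Longrightarrow> \<bar>y i - a i\<bar> < e) \<Longrightarrow> y \<in> V"
    using openin_Euclidean_box[OF V c0] unfolding a_def by blast
  \<comment> \<open>\<open>G p t\<close> has moved its first p coordinates along the curve and keeps
    the others at a. So \<open>G 0 t\<close> is a, and \<open>G m t\<close> is the curve for t near
    t0.\<close>
  define G where "G p t = (\<lambda>i. if i < p then c t i else a i)" for p t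
  have Gt0: "G p t0 = a" for p by (auto simp: G_def a_def)
  have cont: "((\<lambda>t. c t i) \<longlongrightarrow> a i) (nhds t0)" if "i < m" for i
    using DERIV_isCont[OF c'[OF that]] unfolding isCont_def a_def
    by (metis tendsto_at_iff_tendsto_nhds)
  have "\<forall>\<^sub>F t in nhds t0. \<forall>i\<in>{..<m}. \<bar>c t i - a i\<bar> < e"
    using cont e(1) by (intro eventually_ball_finite) (auto simp: tendsto_iff dist_real_def)
  then have near: "\<forall>\<^sub>F t in nhds t0. c t \<in> rvec m \<and> (\<forall>i<m. \<bar>c t i - a i\<bar> < e)"
    using cV by eventually_elim auto
  have step: "((\<lambda>t. g (G p t)) has_real_derivative (\<Sum>i<p. partial_deriv i g a * c' i)) (at t0)" if "p \<le> m" for p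
    using that
  proof (induction p)
    case 0
    then show ?case by (simp add: G_def)
  next
    case (Suc p)
    then have p: "p < m" by simp
    have "\<exists>s. min (a p) (c t p) \<le> s \<and> s \<le> max (a p) (c t p) \<and>
        g (G (Suc p) t) - g (G p t) = partial_deriv p g ((G p t)(p := s)) * (c t p - a p) \<and> (G p t)(p := s) \<in> V"
      if t: "c t \<in> rvec m" "\<forall>i<m. \<bar>c t i - a i\<bar> < e" for t
    proof -
      have inV: "(G p t)(p := s) \<in> V" if "min (a p) (c t p) \<le> s" "s \<le> max (a p) (c t p)" for s
      proof (rule e(2))
        show "(G p t)(p := s) \<in> rvec m" using arv t(1) p by (auto simp: G_def mem_rvec)
        show "\<bar>((G p t)(p := s)) i - a i\<bar> < e" if "i < m" for i
        proof (cases "i = p")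
          case True
          have "\<bar>c t p - a p\<bar> < e" using t(2) p by blast
          then show ?thesis using True \<open>min (a p) (c t p) \<le> s\<close> \<open>s \<le> max (a p) (c t p)\<close>
            by (auto simp: min_def max_def split: if_splits)
        qed (use that t(2) e(1) in \<open>auto simp: G_def\<close>)
      qed
      \<comment> \<open>Only coordinate p moves between \<open>G p t\<close> and
        \<open>G (Suc p) t\<close>, so the mean value theorem in one variable applies. The increment
        may have either sign or vanish, hence the unordered form.\<close>
      have "\<exists>s. min (a p) (c t p) \<le> s \<and> s \<le> max (a p) (c t p) \<and>
        g ((G p t)(p := c t p)) - g ((G p t)(p := a p)) = partial_deriv p g ((G p t)(p := s)) * (c t p - a p)"
      proof (rule MVT_unordered)
        fix s assume "min (a p) (c t p) \<le> s" "s \<le> max (a p) (c t p)"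
        then show "((\<lambda>s. g ((G p t)(p := s))) has_real_derivative partial_deriv p g ((G p t)(p := s))) (at s)"
          using C_diff_Suc_partial[OF g p inV] by simp
      qed
      moreover have "(G p t)(p := c t p) = G (Suc p) t" "(G p t)(p := a p) = G p t"
        by (auto simp: G_def less_Suc_eq fun_eq_iff)
      ultimately show ?thesis using inV by auto
    qed
    then have ev1: "\<forall>\<^sub>F t in nhds t0. \<exists>s. min (a p) (c t p) \<le> s \<and> s \<le> max (a p) (c t p) \<and>
        g (G (Suc p) t) - g (G p t) = partial_deriv p g ((G p t)(p := s)) * (c t p - a p) \<and> (G p t)(p := s) \<in> V"
      by (rule eventually_mono[OF near]) auto
    \<comment> \<open>An arbitrary choice of intermediate points. Nothing is known about its
      regularity, but it is squeezed between a p and c t p.\<close>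
    define s where "s t = (SOME s. min (a p) (c t p) \<le> s \<and> s \<le> max (a p) (c t p) \<and>
        g (G (Suc p) t) - g (G p t) = partial_deriv p g ((G p t)(p := s)) * (c t p - a p) \<and> (G p t)(p := s) \<in> V)" for t
    have ev: "\<forall>\<^sub>F t in nhds t0. min (a p) (c t p) \<le> s t \<and> s t \<le> max (a p) (c t p) \<and>
        g (G (Suc p) t) - g (G p t) = partial_deriv p g ((G p t)(p := s t)) * (c t p - a p) \<and> (G p t)(p := s t) \<in> V"
      using ev1 unfolding s_def by eventually_elim (rule someI_ex)
    define q where "q t = partial_deriv p g ((G p t)(p := s t))" for t
    have st: "(s \<longlongrightarrow> a p) (nhds t0)"
    proof (rule real_tendsto_sandwich)
      show "\<forall>\<^sub>F t in nhds t0. min (a p) (c t p) \<le> s t" "\<forall>\<^sub>F t in nhds t0. s t \<le> max (a p) (c t p)"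
        using ev by (auto elim: eventually_mono)
      show "((\<lambda>t. min (a p) (c t p)) \<longlongrightarrow> a p) (nhds t0)" "((\<lambda>t. max (a p) (c t p)) \<longlongrightarrow> a p) (nhds t0)"
        using tendsto_min[OF tendsto_const cont[OF p], of "a p"] tendsto_max[OF tendsto_const cont[OF p], of "a p"] by auto
    qed
    have lim: "((\<lambda>t. (G p t)(p := s t)) \<longlongrightarrow> a) (nhds t0)"
    proof -
      have "((\<lambda>t. ((G p t)(p := s t)) i) \<longlongrightarrow> a i) (nhds t0)" for i
      proof (cases "i = p")
        case False then show ?thesis using cont[of i] p by (cases "i < p") (auto simp: G_def)
      qed (use st in simp)
      then show ?thesis
        using limitin_componentwise[of "\<lambda>i. euclideanreal" UNIV "\<lambda>t. (G p t)(p := s t)" a "nhds t0"]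
        by (simp add: euclidean_product_topology)
    qed
    have "continuous_on V (partial_deriv p g)"
      using g p openin_Euclidean_space_subset[OF V] by (simp add: continuous_map_Euclidean_subset)
    then have "(q \<longlongrightarrow> partial_deriv p g a) (nhds t0)"
      unfolding q_def using lim c0 ev
      by (intro continuous_on_tendsto_compose[where f = "partial_deriv p g" and s = V]) (auto simp: a_def elim: eventually_mono)
    then have q0: "isCont q t0" "q t0 = partial_deriv p g a"
    proof -
      assume q: "(q \<longlongrightarrow> partial_deriv p g a) (nhds t0)"
      \<comment> \<open>At t0 the interval of admissible points degenerates, which determines the
        arbitrary choice there.\<close>
      have "s t0 = a p" using eventually_nhds_x_imp_x[OF ev] by (auto simp: a_def)
      then show "q t0 = partial_deriv p g a" by (simp add: q_def Gt0)
      then show "isCont q t0" unfolding isCont_def using q tendsto_at_iff_tendsto_nhds[of q t0] by metis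
    qed
    obtain kk where kk: "\<And>z. c z p - c t0 p = kk z * (z - t0)" "isCont kk t0" "kk t0 = c' p"
      using c'[OF p] unfolding CARAT_DERIV by blast
    have "((\<lambda>t. q t * (c t p - a p)) has_real_derivative (partial_deriv p g a * c' p)) (at t0)"
      unfolding CARAT_DERIV
      by (rule exI[of _ "\<lambda>t. q t * kk t"]) (use kk q0 in \<open>auto simp: a_def\<close>)
    moreover have "\<forall>\<^sub>F t in nhds t0. q t * (c t p - a p) = g (G (Suc p) t) - g (G p t)"
      using ev by eventually_elim (simp add: q_def)
    ultimately have "((\<lambda>t. g (G (Suc p) t) - g (G p t)) has_real_derivative (partial_deriv p g a * c' p)) (at t0)"
      by (subst (asm) DERIV_cong_ev[OF refl _ refl])
    from DERIV_add[OF this Suc.IH] p show ?case by (simp add: add.commute)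
  qed
  have "\<forall>\<^sub>F t in nhds t0. g (G m t) = g (c t)"
    using cV
  proof eventually_elim
    case (elim t)
    then have "G m t = c t" using arv by (auto simp: G_def mem_rvec fun_eq_iff)
    then show ?case by simp
  qed
  then show ?thesis using step[of m] DERIV_cong_ev[OF refl _ refl, of "\<lambda>t. g (G m t)" "\<lambda>t. g (c t)" t0] by (simp add: a_def)
qed

text \<open>Coordinates from m on are 0 on U, hence continuous as well.\<close>

lemma continuous_on_rvec:
  assumes "\<And>i. i < m \<Longrightarrow> continuous_on U (\<lambda>x. h x i)" "\<And>x. x \<in> U \<Longrightarrow> h x \<in> rvec m"
  shows "continuous_on U h"
proof (rule continuous_on_coordinatewise_then_product)
  fix i
  show "continuous_on U (\<lambda>x. h x i)"
  proof (cases "i < m")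
    case False
    then have "h x i = 0" if "x \<in> U" for x using assms(2)[OF that] by (simp add: mem_rvec)
    then show ?thesis by (simp cong: continuous_on_cong)
  qed (rule assms)
qed

lemma C_diff_chain:
  assumes U: "openin (Euclidean_space k) U" and V: "openin (Euclidean_space m) V"
    and g: "C_diff m (Suc 0) V g" and h: "\<And>i. i < m \<Longrightarrow> C_diff k (Suc 0) U (\<lambda>x. h x i)"
    and hV: "\<And>x. x \<in> U \<Longrightarrow> h x \<in> V" and x: "x \<in> U" "j < k"
  shows "((\<lambda>t. g (h (x(j := t)))) has_real_derivative
     (\<Sum>i<m. partial_deriv i g (h x) * partial_deriv j (\<lambda>y. h y i) x)) (at (x j))"
proof -
  have "((\<lambda>t. g ((\<lambda>t. h (x(j := t))) t)) has_real_derivative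
     (\<Sum>i<m. partial_deriv i g (h (x(j := x j))) * partial_deriv j (\<lambda>y. h y i) x)) (at (x j))"
  proof (rule C_diff_chain_curve[OF V g])
    show "h (x(j := x j)) \<in> V" using hV x by simp
    show "((\<lambda>t. h (x(j := t)) i) has_real_derivative partial_deriv j (\<lambda>y. h y i) x) (at (x j))" if "i < m" for i
      by (rule C_diff_Suc_partial[OF h[OF that] x(2,1)])
    show "\<forall>\<^sub>F t in nhds (x j). h (x(j := t)) \<in> rvec m"
      using eventually_fun_upd[OF U x] by eventually_elim (use hV openin_Euclidean_space_subset[OF V] in auto)
  qed
  then show ?thesis by simp
qed

lemma C_diff_sum:
  assumes "openin (Euclidean_space k) U" "\<And>i. i \<in> I \<Longrightarrow> C_diff k r U (f i)"
  shows "C_diff k r U (\<lambda>x. \<Sum>i\<in>I. f i x)"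
  using assms(2) by (induction I rule: infinite_finite_induct) (auto intro: C_diff_add C_diff_const assms(1))

lemma C_diff_prod:
  assumes "openin (Euclidean_space k) U" "\<And>i. i \<in> I \<Longrightarrow> C_diff k r U (f i)"
  shows "C_diff k r U (\<lambda>x. \<Prod>i\<in>I. f i x)"
  using assms(2) by (induction I rule: infinite_finite_induct) (auto intro: C_diff_mult C_diff_const assms(1))

lemma C_diff_one: "C_diff k (Suc r) U f \<Longrightarrow> C_diff k (Suc 0) U f"
proof (induction r)
  case (Suc r)
  then show ?case using C_diff_SucD[of k "Suc r"] by blast
qed

text \<open>Induction with h fixed and g varying. The chain rule writes a partial derivative of the
  composite as a sum of products of a partial derivative of g after h, to which the induction
  hypothesis applies, and a partial derivative of h.\<close>

lemma C_diff_compose: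
  assumes U: "openin (Euclidean_space k) U" and V: "openin (Euclidean_space m) V"
    and "C_diff m r V g" and "\<And>i. i < m \<Longrightarrow> C_diff k r U (\<lambda>x. h x i)"
    and hV: "\<And>x. x \<in> U \<Longrightarrow> h x \<in> V"
  shows "C_diff k r U (\<lambda>x. g (h x))"
proof -
  have sub: "U \<subseteq> rvec k" "V \<subseteq> rvec m" using U V openin_Euclidean_space_subset by blast+
  have cont: "continuous_on U (\<lambda>x. g (h x))" if "C_diff m r V g" "\<And>i. i < m \<Longrightarrow> C_diff k r U (\<lambda>x. h x i)" for r g
  proof (rule continuous_on_compose2[OF C_diff_continuous_on[OF that(1)]])
    show "continuous_on U h"
      by (rule continuous_on_rvec[of m]) (use that C_diff_continuous_on sub hV in blast)+
  qed (use hV sub in auto)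
  show ?thesis
    using assms(3,4)
  proof (induction r arbitrary: g)
    case 0
    then show ?case using cont[of 0] sub by (simp add: continuous_map_Euclidean_subset)
  next
    case (Suc r)
    show ?case
    proof (rule C_diff_SucI[OF U, where D = "\<lambda>j x. \<Sum>i<m. partial_deriv i g (h x) * partial_deriv j (\<lambda>y. h y i) x"])
      show "continuous_on U (\<lambda>x. g (h x))" using cont Suc.prems by blast
      show "((\<lambda>t. g (h (x(j := t)))) has_real_derivative
        (\<Sum>i<m. partial_deriv i g (h x) * partial_deriv j (\<lambda>y. h y i) x)) (at (x j))" if "j < k" "x \<in> U" for j x
        using Suc.prems that hV by (intro C_diff_chain[OF U V]) (auto intro: C_diff_one[OF Suc.prems(1)] C_diff_one[OF Suc.prems(2)] simp del: C_diff.simps)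
      show "C_diff k r U (\<lambda>x. \<Sum>i<m. partial_deriv i g (h x) * partial_deriv j (\<lambda>y. h y i) x)" if "j < k" for j
      proof (intro C_diff_sum[OF U] C_diff_mult[OF U])
        fix i assume i: "i \<in> {..<m}"
        show "C_diff k r U (\<lambda>x. partial_deriv i g (h x))"
          by (rule Suc.IH) (use Suc.prems(1) C_diff_SucD[OF Suc.prems(2)] i in auto)
        show "C_diff k r U (partial_deriv j (\<lambda>y. h y i))" using Suc.prems(2)[of i] i that by simp
      qed
    qed
  qed
qed

lemma C_diff_local:
  assumes U: "openin (Euclidean_space k) U"
    and "\<And>x. x \<in> U \<Longrightarrow> \<exists>V. openin (Euclidean_space k) V \<and> x \<in> V \<and> C_diff k r V g"
  shows "C_diff k r U g"
  using assms(2)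
proof (induction r arbitrary: g)
  case 0
  have "continuous (at x within U) g" if x: "x \<in> U" for x
  proof -
    obtain V where V: "openin (Euclidean_space k) V" "x \<in> V" "C_diff k 0 V g" using 0 x by blast
    obtain S where S: "open S" "V = S \<inter> rvec k"
      using V(1) by (auto simp: openin_Euclidean_space_iff)
    have "continuous_on (U \<inter> V) g"
      by (meson C_diff_continuous_on V continuous_on_subset inf_le2 openin_Euclidean_space_subset)
    then have "continuous (at x within (U \<inter> V)) g" using x V(2) by (simp add: continuous_on_eq_continuous_within)
    moreover have "at x within (U \<inter> V) = at x within U"
      by (rule at_within_nhd[of x S]) (use S V U openin_Euclidean_space_subset[OF U] in auto)
    ultimately show ?thesis by simp
  qed
  then show ?case using openin_Euclidean_space_subset[OF U]
    by (simp add: continuous_map_Euclidean_subset continuous_on_eq_continuous_within)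
next
  case (Suc r)
  \<comment> \<open>Continuity comes from the induction hypothesis applied to g itself, at order
    r.\<close>
  have "C_diff k 0 U g"
  proof (rule Suc.IH[THEN C_diff_subset[OF U subset_refl], THEN C_diff_continuous_on,
      unfolded continuous_map_Euclidean_subset[OF openin_Euclidean_space_subset[OF U], symmetric], folded C_diff.simps(1)])
    show "\<exists>V. openin (Euclidean_space k) V \<and> x \<in> V \<and> C_diff k r V g" if "x \<in> U" for x
      using Suc.prems[OF that] C_diff_SucD by blast
  qed (use openin_Euclidean_space_subset[OF U] in auto)
  moreover have "(\<lambda>t. g (x(j := t))) field_differentiable at (x j)" if "x \<in> U" "j < k" for x j
    using Suc.prems[OF that(1)] that by auto
  moreover have "C_diff k r U (partial_deriv j g)" if "j < k" for j
  proof (rule Suc.IH)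
    fix x assume "x \<in> U"
    then obtain V where "openin (Euclidean_space k) V" "x \<in> V" "C_diff k (Suc r) V g" using Suc.prems by blast
    then show "\<exists>V. openin (Euclidean_space k) V \<and> x \<in> V \<and> C_diff k r V (partial_deriv j g)" using that by auto
  qed
  ultimately show ?case by simp
qed

text \<open>The scalar counterpart of \<open>C_inf\<close>: closure under sums, products and
  inverses concerns single coordinates.\<close>

definition smooth_on :: "nat \<Rightarrow> (nat \<Rightarrow> real) set \<Rightarrow> ((nat \<Rightarrow> real) \<Rightarrow> real) \<Rightarrow> bool" where
  "smooth_on k U g \<longleftrightarrow> (\<forall>r. C_diff k r U g)"

lemma C_inf_iff: "C_inf k U g \<longleftrightarrow> (\<forall>i. smooth_on k U (\<lambda>x. g x i))"
  by (auto simp: C_inf_def smooth_on_def)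

lemma smooth_on_cong:
  "openin (Euclidean_space k) U \<Longrightarrow> (\<And>x. x \<in> U \<Longrightarrow> f x = g x) \<Longrightarrow> smooth_on k U f \<Longrightarrow> smooth_on k U g"
  unfolding smooth_on_def by (intro allI C_diff_cong[of k U f g]) auto

lemma smooth_on_subset:
  "openin (Euclidean_space k) U \<Longrightarrow> V \<subseteq> U \<Longrightarrow> smooth_on k U g \<Longrightarrow> smooth_on k V g"
  unfolding smooth_on_def by (intro allI C_diff_subset[of k U V]) auto

lemma smooth_on_const: "openin (Euclidean_space k) U \<Longrightarrow> smooth_on k U (\<lambda>x. c)"
  unfolding smooth_on_def by (intro allI C_diff_const)

lemma smooth_on_coord: "openin (Euclidean_space k) U \<Longrightarrow> smooth_on k U (\<lambda>x. x i)"
  unfolding smooth_on_def by (intro allI C_diff_coord)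

lemma smooth_on_add:
  "openin (Euclidean_space k) U \<Longrightarrow> smooth_on k U f \<Longrightarrow> smooth_on k U g \<Longrightarrow> smooth_on k U (\<lambda>x. f x + g x)"
  unfolding smooth_on_def by (intro allI C_diff_add) auto

lemma smooth_on_mult:
  "openin (Euclidean_space k) U \<Longrightarrow> smooth_on k U f \<Longrightarrow> smooth_on k U g \<Longrightarrow> smooth_on k U (\<lambda>x. f x * g x)"
  unfolding smooth_on_def by (intro allI C_diff_mult) auto

lemma smooth_on_diff:
  assumes "openin (Euclidean_space k) U" "smooth_on k U f" "smooth_on k U g"
  shows "smooth_on k U (\<lambda>x. f x - g x)"
  using smooth_on_add[OF assms(1,2) smooth_on_mult[OF assms(1) smooth_on_const[OF assms(1)] assms(3)], of "-1"] by simp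

lemma smooth_on_sum:
  "openin (Euclidean_space k) U \<Longrightarrow> (\<And>i. i \<in> I \<Longrightarrow> smooth_on k U (f i)) \<Longrightarrow> smooth_on k U (\<lambda>x. \<Sum>i\<in>I. f i x)"
  unfolding smooth_on_def by (intro allI C_diff_sum) auto

lemma smooth_on_prod:
  "openin (Euclidean_space k) U \<Longrightarrow> (\<And>i. i \<in> I \<Longrightarrow> smooth_on k U (f i)) \<Longrightarrow> smooth_on k U (\<lambda>x. \<Prod>i\<in>I. f i x)"
  unfolding smooth_on_def by (intro allI C_diff_prod) auto

lemma smooth_on_inverse:
  "openin (Euclidean_space k) U \<Longrightarrow> smooth_on k U f \<Longrightarrow> (\<And>x. x \<in> U \<Longrightarrow> f x \<noteq> 0) \<Longrightarrow> smooth_on k U (\<lambda>x. inverse (f x))"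
  unfolding smooth_on_def by (intro allI C_diff_inverse) auto

lemma smooth_on_compose:
  assumes "openin (Euclidean_space k) U" "openin (Euclidean_space m) V"
    and "smooth_on m V g" "\<And>i. i < m \<Longrightarrow> smooth_on k U (\<lambda>x. h x i)" "\<And>x. x \<in> U \<Longrightarrow> h x \<in> V"
  shows "smooth_on k U (\<lambda>x. g (h x))"
  unfolding smooth_on_def
proof
  fix r show "C_diff k r U (\<lambda>x. g (h x))"
    by (rule C_diff_compose[OF assms(1,2), of r g h]) (use assms(3-5) in \<open>simp_all add: smooth_on_def\<close>)
qed

lemma smooth_on_local:
  assumes "openin (Euclidean_space k) U"
    and "\<And>x. x \<in> U \<Longrightarrow> \<exists>V. openin (Euclidean_space k) V \<and> x \<in> V \<and> smooth_on k V g"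
  shows "smooth_on k U g"
  unfolding smooth_on_def
proof
  fix r show "C_diff k r U g"
  proof (rule C_diff_local[OF assms(1)])
    fix x assume "x \<in> U"
    from assms(2)[OF this] show "\<exists>V. openin (Euclidean_space k) V \<and> x \<in> V \<and> C_diff k r V g"
      unfolding smooth_on_def by fast
  qed
qed

lemma smooth_on_partial_deriv: "smooth_on k U g \<Longrightarrow> j < k \<Longrightarrow> smooth_on k U (partial_deriv j g)"
  unfolding smooth_on_def
proof
  fix r assume "\<forall>r. C_diff k r U g" "j < k"
  then have "C_diff k (Suc r) U g" by blast
  then show "C_diff k r U (partial_deriv j g)" using \<open>j < k\<close> by simp
qed

lemma smooth_on_continuous_on: "smooth_on k U g \<Longrightarrow> openin (Euclidean_space k) U \<Longrightarrow> continuous_on U g"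
  using C_diff_continuous_on[of k 0 U g] openin_Euclidean_space_subset[of k U] unfolding smooth_on_def by iprover

lemma rvec_mono: "k \<le> n \<Longrightarrow> rvec k \<subseteq> rvec n"
  by (rule subset_Euclidean_space[THEN iffD2])

text \<open>Points of R^k and R^n are functions of one type, so on the slice the function g and its
  partial derivatives in the directions j < k are literally the same. Smoothness in charts induced
  on submanifolds rests on this.\<close>

lemma smooth_on_Int_rvec:
  assumes U: "openin (Euclidean_space n) U" and "smooth_on n U g" and k: "k \<le> n"
  shows "smooth_on k (U \<inter> rvec k) g"
proof -
  have "C_diff k r (U \<inter> rvec k) g" if "C_diff n r U g" for r g
    using that
  proof (induction r arbitrary: g)
    case 0
    then have "continuous_on U g" using C_diff_continuous_on openin_Euclidean_space_subset[OF U] by blast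
    then show ?case by (auto simp: continuous_map_Euclidean_subset intro: continuous_on_subset)
  next
    case (Suc r)
    then have "continuous_on U g" using C_diff_continuous_on openin_Euclidean_space_subset[OF U] by blast
    then have "continuous_on (U \<inter> rvec k) g" by (auto intro: continuous_on_subset)
    then show ?case using Suc k by (simp add: continuous_map_Euclidean_subset)
  qed
  then show ?thesis using assms(2) by (simp add: smooth_on_def)
qed

lemma openin_Int_rvec:
  assumes "openin (Euclidean_space n) U" "k \<le> n"
  shows "openin (Euclidean_space k) (U \<inter> rvec k)"
proof -
  obtain S where "open S" "U = S \<inter> rvec n" using assms(1) openin_Euclidean_space_iff by blast
  then have "open S \<and> U \<inter> rvec k = S \<inter> rvec k" using rvec_mono[OF assms(2)] by blast
  then show ?thesis using openin_Euclidean_space_iff by blast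
qed

lemma openin_preimage_rvec:
  assumes "openin (Euclidean_space k) U" "openin (Euclidean_space m) V"
    and "\<And>i. i < m \<Longrightarrow> continuous_on U (\<lambda>x. h x i)" "\<And>x. x \<in> U \<Longrightarrow> h x \<in> rvec m"
  shows "openin (Euclidean_space k) {x \<in> U. h x \<in> V}"
proof -
  obtain S where S: "open S" "V = S \<inter> rvec m" using assms(2) by (auto simp: openin_Euclidean_space_iff)
  have "continuous_on U h" using continuous_on_rvec assms(3,4) by blast
  then have "openin (top_of_set U) (U \<inter> h -` S)" using S(1) continuous_openin_preimage_gen by blast
  moreover have "U \<inter> h -` S = {x \<in> U. h x \<in> V}" using S assms(4) by auto
  ultimately have "openin (subtopology (Euclidean_space k) U) {x \<in> U. h x \<in> V}"
    by (simp add: subtopology_Euclidean_space[OF openin_Euclidean_space_subset[OF assms(1)]])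
  then show ?thesis using assms(1) openin_trans_full by blast
qed

section \<open>Differentials of maps between Euclidean spaces\<close>

lemma partial_deriv_cong:
  assumes "openin (Euclidean_space k) U" "\<And>x. x \<in> U \<Longrightarrow> f x = g x" "x \<in> U" "j < k"
  shows "partial_deriv j f x = partial_deriv j g x"
proof -
  have "\<forall>\<^sub>F t in nhds (x j). f (x(j := t)) = g (x(j := t))"
    using eventually_fun_upd[OF assms(1,3,4)] by eventually_elim (rule assms(2))
  then show ?thesis unfolding partial_deriv_def by (rule deriv_cong_ev) simp
qed

lemma differential_cong:
  assumes "openin (Euclidean_space k) U" "\<And>x. x \<in> U \<Longrightarrow> f x = g x" "x \<in> U"
  shows "differential k f x w = differential k g x w"
proof -
  have "partial_deriv j (\<lambda>y. f y i) x = partial_deriv j (\<lambda>y. g y i) x" if "j < k" for i j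
    by (rule partial_deriv_cong[OF assms(1) _ assms(3) that]) (simp add: assms(2))
  then show ?thesis by (simp add: differential_def)
qed

text \<open>From index m on the coordinate functions are constantly 0 near x, so their partial
  derivatives vanish.\<close>

lemma differential_rvec:
  assumes "openin (Euclidean_space k) U" "\<And>x. x \<in> U \<Longrightarrow> f x \<in> rvec m" "x \<in> U"
  shows "differential k f x w \<in> rvec m"
proof -
  have "partial_deriv j (\<lambda>y. f y i) x = 0" if "i \<ge> m" "j < k" for i j
  proof -
    have "partial_deriv j (\<lambda>y. f y i) x = partial_deriv j (\<lambda>y. 0) x"
      by (rule partial_deriv_cong[OF assms(1)]) (use assms that in \<open>auto simp: mem_rvec\<close>)
    then show ?thesis by (simp add: partial_deriv_def)
  qed
  then show ?thesis by (simp add: mem_rvec differential_def)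
qed

lemma differential_id:
  assumes "w \<in> rvec k"
  shows "differential k (\<lambda>x. x) x w = w"
proof
  fix i
  have "partial_deriv j (\<lambda>y. y i) x = (if i = j then 1 else 0)" for j
    unfolding partial_deriv_def by (cases "i = j") auto
  then have "differential k (\<lambda>x. x) x w i = (\<Sum>j<k. if i = j then w j else 0)"
    unfolding differential_def by (intro sum.cong) auto
  then show "differential k (\<lambda>x. x) x w i = w i"
    using assms by (simp add: mem_rvec)
qed

lemma differential_add: "differential k f x (\<lambda>i. v i + w i) = (\<lambda>i. differential k f x v i + differential k f x w i)"
  by (simp add: differential_def algebra_simps sum.distrib)

lemma differential_scale: "differential k f x (\<lambda>i. r * w i) = (\<lambda>i. r * differential k f x w i)"
  by (simp add: differential_def sum_distrib_left algebra_simps)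

lemma differential_compose:
  assumes U: "openin (Euclidean_space k) U" and V: "openin (Euclidean_space m) V"
    and g: "C_inf m V g" and h: "C_inf k U h" and hV: "\<And>x. x \<in> U \<Longrightarrow> h x \<in> V" and x: "x \<in> U"
  shows "differential k (\<lambda>x. g (h x)) x w = differential m g (h x) (differential k h x w)"
proof
  fix l
  have "partial_deriv j (\<lambda>y. g (h y) l) x = (\<Sum>i<m. partial_deriv i (\<lambda>y. g y l) (h x) * partial_deriv j (\<lambda>y. h y i) x)"
    if "j < k" for j
    unfolding partial_deriv_def[of j "\<lambda>y. g (h y) l"]
    using C_diff_chain[where h = h and g = "\<lambda>y. g y l", OF U V _ _ hV x that] g h
    by (intro DERIV_imp_deriv) (simp add: C_inf_def del: C_diff.simps)
  then have "differential k (\<lambda>x. g (h x)) x w l =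
      (\<Sum>j<k. \<Sum>i<m. partial_deriv i (\<lambda>y. g y l) (h x) * partial_deriv j (\<lambda>y. h y i) x * w j)"
    by (simp add: differential_def sum_distrib_right)
  also have "\<dots> = (\<Sum>i<m. \<Sum>j<k. partial_deriv i (\<lambda>y. g y l) (h x) * partial_deriv j (\<lambda>y. h y i) x * w j)"
    by (rule sum.swap)
  also have "\<dots> = differential m g (h x) (differential k h x w) l"
    by (simp add: differential_def sum_distrib_left mult.assoc)
  finally show "differential k (\<lambda>x. g (h x)) x w l = differential m g (h x) (differential k h x w) l" .
qed


section \<open>Charts and smooth maps\<close>

definition chart_inv :: "'a chart \<Rightarrow> (nat \<Rightarrow> real) \<Rightarrow> 'a" where
  "chart_inv c = inv_into (chart_dom c) (chart_map c)"

lemma local_rep_eq: "local_rep c d f y = chart_map d (f (chart_inv c y))"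
  by (simp add: local_rep_def chart_inv_def)

lemma is_chart_dom: "is_chart T c \<Longrightarrow> openin T (chart_dom c)"
  by (simp add: is_chart_def)

lemma is_chart_inj:
  assumes "is_chart T c"
  shows "inj_on (chart_map c) (chart_dom c)"
proof -
  have "topspace (subtopology T (chart_dom c)) = chart_dom c"
    using openin_subset[OF is_chart_dom[OF assms]] by auto
  then show ?thesis using assms homeomorphic_imp_injective_map unfolding is_chart_def by metis
qed

lemma is_chart_rvec: "is_chart T c \<Longrightarrow> p \<in> chart_dom c \<Longrightarrow> chart_map c p \<in> rvec (chart_dim c)"
  unfolding is_chart_def using openin_Euclidean_space_subset by blast

lemma chart_inv_map: "is_chart T c \<Longrightarrow> p \<in> chart_dom c \<Longrightarrow> chart_inv c (chart_map c p) = p"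
  unfolding chart_inv_def by (rule inv_into_f_f[OF is_chart_inj])

lemma local_rep_chart_map: "is_chart T c \<Longrightarrow> p \<in> chart_dom c \<Longrightarrow> local_rep c d f (chart_map c p) = chart_map d (f p)"
  by (simp add: local_rep_eq chart_inv_map)

lemma openin_chart_image:
  assumes "is_chart T c" "openin T W" "W \<subseteq> chart_dom c"
  shows "openin (Euclidean_space (chart_dim c)) (chart_map c ` W)"
proof -
  have "open_map (subtopology T (chart_dom c))
     (subtopology (Euclidean_space (chart_dim c)) (chart_map c ` chart_dom c)) (chart_map c)"
    using assms(1) homeomorphic_imp_open_map unfolding is_chart_def by blast
  moreover have "openin (subtopology T (chart_dom c)) W"
    using assms by (metis openin_subset_topspace_eq openin_subtopology inf.absorb_iff2 inf_commute)
  ultimately have "openin (subtopology (Euclidean_space (chart_dim c)) (chart_map c ` chart_dom c)) (chart_map c ` W)"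
    by (simp add: open_map_def)
  then show ?thesis using assms(1) openin_trans_full unfolding is_chart_def by blast
qed

lemma openin_chart_preimage:
  assumes "is_chart T c" "openin (Euclidean_space (chart_dim c)) V"
  shows "openin T {p \<in> chart_dom c. chart_map c p \<in> V}"
proof -
  have "continuous_map (subtopology T (chart_dom c))
     (subtopology (Euclidean_space (chart_dim c)) (chart_map c ` chart_dom c)) (chart_map c)"
    using assms(1) homeomorphic_imp_continuous_map unfolding is_chart_def by blast
  then have "continuous_map (subtopology T (chart_dom c)) (Euclidean_space (chart_dim c)) (chart_map c)"
    by (simp add: continuous_map_in_subtopology)
  then have "openin (subtopology T (chart_dom c)) {p \<in> topspace (subtopology T (chart_dom c)). chart_map c p \<in> V}"
    using assms(2) openin_continuous_map_preimage by blast
  moreover have "topspace (subtopology T (chart_dom c)) = chart_dom c"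
    using openin_subset[OF is_chart_dom[OF assms(1)]] by auto
  ultimately show ?thesis using is_chart_dom[OF assms(1)] openin_trans_full by fastforce
qed

text \<open>Splits the homeomorphism condition into images and preimages of open sets of the two
  full spaces, the form in which new charts are checked.\<close>

lemma is_chartI:
  assumes dom: "openin T (chart_dom c)" and "chart_map c \<in> extensional (chart_dom c)"
    and im: "openin (Euclidean_space (chart_dim c)) (chart_map c ` chart_dom c)"
    and "inj_on (chart_map c) (chart_dom c)"
    and 1: "\<And>W. openin T W \<Longrightarrow> W \<subseteq> chart_dom c \<Longrightarrow> openin (Euclidean_space (chart_dim c)) (chart_map c ` W)"
    and 2: "\<And>V. openin (Euclidean_space (chart_dim c)) V \<Longrightarrow> openin T {p \<in> chart_dom c. chart_map c p \<in> V}"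
  shows "is_chart T c"
proof -
  let ?X = "subtopology T (chart_dom c)"
  let ?Y = "subtopology (Euclidean_space (chart_dim c)) (chart_map c ` chart_dom c)"
  have X: "topspace ?X = chart_dom c" using openin_subset[OF dom] by auto
  have Y: "topspace ?Y = chart_map c ` chart_dom c" using openin_subset[OF im] by auto
  have "continuous_map ?X ?Y (chart_map c)"
    unfolding continuous_map_in_subtopology
  proof
    show "continuous_map ?X (Euclidean_space (chart_dim c)) (chart_map c)"
      unfolding continuous_map_def
    proof (intro conjI allI impI)
      show "chart_map c \<in> topspace ?X \<rightarrow> rvec (chart_dim c)" using X openin_subset[OF im] by auto
      fix V assume "openin (Euclidean_space (chart_dim c)) V"
      from 2[OF this] show "openin ?X {x \<in> topspace ?X. chart_map c x \<in> V}"
        unfolding X by (subst openin_open_subtopology[OF dom]) auto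
    qed
    show "chart_map c \<in> topspace ?X \<rightarrow> chart_map c ` chart_dom c" using X by auto
  qed
  moreover have "open_map ?X ?Y (chart_map c)"
    unfolding open_map_def using 1 openin_open_subtopology[OF dom] openin_open_subtopology[OF im] by (simp add: image_mono)
  ultimately have "homeomorphic_map ?X ?Y (chart_map c)"
    using bijective_open_imp_homeomorphic_map assms(4) X Y by metis
  then show ?thesis using assms by (simp add: is_chart_def)
qed

text \<open>Smoothness of f in one pair of charts over an explicit set W. Compatibility of charts
  and smoothness of maps are both instances, so that locality and composition need to be proved only
  once.\<close>

definition chart_smooth :: "'a chart \<Rightarrow> 'b chart \<Rightarrow> ('a \<Rightarrow> 'b) \<Rightarrow> 'a set \<Rightarrow> bool" where
  "chart_smooth c d f W \<longleftrightarrow> C_inf (chart_dim c) (chart_map c ` W) (local_rep c d f)"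

lemma compatible_iff:
  "compatible c d \<longleftrightarrow> chart_smooth c d (\<lambda>p. p) (chart_dom c \<inter> chart_dom d) \<and> chart_smooth d c (\<lambda>p. p) (chart_dom c \<inter> chart_dom d)"
  by (simp add: compatible_def chart_smooth_def)

lemma chart_smooth_cong:
  assumes "is_chart T c" "openin T W" "W \<subseteq> chart_dom c" "\<And>p. p \<in> W \<Longrightarrow> f p = g p" "chart_smooth c d f W"
  shows "chart_smooth c d g W"
proof -
  have "local_rep c d f y = local_rep c d g y" if "y \<in> chart_map c ` W" for y
    using that assms(3,4) chart_inv_map[OF assms(1)] by (auto simp: local_rep_eq subset_iff)
  then show ?thesis
    using assms(5) smooth_on_cong[OF openin_chart_image[OF assms(1-3)]]
    unfolding chart_smooth_def C_inf_iff by (metis (no_types, lifting))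
qed

lemma chart_smooth_subset:
  assumes "is_chart T c" "openin T W" "W \<subseteq> chart_dom c" "W' \<subseteq> W" "chart_smooth c d f W"
  shows "chart_smooth c d f W'"
  using assms(5) smooth_on_subset[OF openin_chart_image[OF assms(1-3)] image_mono[OF assms(4)]]
  by (simp add: chart_smooth_def C_inf_iff)

lemma chart_smooth_id:
  assumes "is_chart T c" "openin T W" "W \<subseteq> chart_dom c"
  shows "chart_smooth c c (\<lambda>p. p) W"
proof -
  have "local_rep c c (\<lambda>p. p) y = y" if "y \<in> chart_map c ` W" for y
    using that assms(3) chart_inv_map[OF assms(1)] by (auto simp: local_rep_eq subset_iff)
  then show ?thesis
    using smooth_on_cong[OF openin_chart_image[OF assms] _ smooth_on_coord[OF openin_chart_image[OF assms]]]
    unfolding chart_smooth_def C_inf_iff by (metis (no_types, lifting))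
qed

lemma chart_smooth_local:
  assumes "is_chart T c" "openin T W" "W \<subseteq> chart_dom c"
    and "\<And>p. p \<in> W \<Longrightarrow> \<exists>W'. openin T W' \<and> p \<in> W' \<and> W' \<subseteq> chart_dom c \<and> chart_smooth c d f W'"
  shows "chart_smooth c d f W"
  unfolding chart_smooth_def C_inf_iff
proof
  fix i
  show "smooth_on (chart_dim c) (chart_map c ` W) (\<lambda>x. local_rep c d f x i)"
  proof (rule smooth_on_local[OF openin_chart_image[OF assms(1-3)]])
    fix y assume "y \<in> chart_map c ` W"
    then obtain p where "p \<in> W" "y = chart_map c p" by blast
    with assms(4) obtain W' where "openin T W'" "p \<in> W'" "W' \<subseteq> chart_dom c" "chart_smooth c d f W'" by blast
    then show "\<exists>V. openin (Euclidean_space (chart_dim c)) V \<and> y \<in> V \<and> smooth_on (chart_dim c) V (\<lambda>x. local_rep c d f x i)"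
      using openin_chart_image[OF assms(1)] \<open>y = chart_map c p\<close> unfolding chart_smooth_def C_inf_iff by blast
  qed
qed

lemma chart_smooth_compose:
  assumes c: "is_chart T c" "openin T W" "W \<subseteq> chart_dom c"
    and d: "is_chart T' d" "openin T' W'" "W' \<subseteq> chart_dom d"
    and f: "f ` W \<subseteq> W'" "chart_smooth c d f W" and g: "chart_smooth d e g W'"
  shows "chart_smooth c e (\<lambda>p. g (f p)) W"
proof -
  have U: "openin (Euclidean_space (chart_dim c)) (chart_map c ` W)" by (rule openin_chart_image[OF c])
  have V: "openin (Euclidean_space (chart_dim d)) (chart_map d ` W')" by (rule openin_chart_image[OF d])
  have inV: "local_rep c d f y \<in> chart_map d ` W'" if "y \<in> chart_map c ` W" for y
    using that f(1) c(3) by (auto simp: local_rep_chart_map[OF c(1)] subset_iff)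
  have eq: "local_rep d e g (local_rep c d f y) = local_rep c e (\<lambda>p. g (f p)) y" if y: "y \<in> chart_map c ` W" for y
  proof -
    obtain p where p: "p \<in> W" "y = chart_map c p" using y by blast
    have "p \<in> chart_dom c" "f p \<in> chart_dom d" using p f(1) c(3) d(3) by blast+
    then show ?thesis unfolding p(2) by (simp add: local_rep_chart_map[OF c(1)] local_rep_chart_map[OF d(1)])
  qed
  show ?thesis unfolding chart_smooth_def C_inf_iff
  proof
    fix i
    have "smooth_on (chart_dim c) (chart_map c ` W) (\<lambda>y. local_rep d e g (local_rep c d f y) i)"
      by (rule smooth_on_compose[OF U V, where g = "\<lambda>y. local_rep d e g y i"])
        (use f(2) g inV in \<open>auto simp: chart_smooth_def C_inf_iff\<close>)
    then show "smooth_on (chart_dim c) (chart_map c ` W) (\<lambda>y. local_rep c e (\<lambda>p. g (f p)) y i)"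
      by (rule smooth_on_cong[OF U, rotated]) (simp add: eq)
  qed
qed

text \<open>A smooth local representative is continuous and charts are homeomorphisms onto open
  sets. Continuity of f on W is thus a consequence, which \<open>smooth_mapI\<close> uses to produce
  the continuity clause of a smooth map.\<close>

lemma chart_smooth_openin_preimage:
  assumes c: "is_chart T c" "openin T W" "W \<subseteq> chart_dom c"
    and d: "is_chart T' d" and f: "f ` W \<subseteq> chart_dom d" "chart_smooth c d f W" and S: "openin T' S"
  shows "openin T {p \<in> W. f p \<in> S}"
proof -
  let ?V = "chart_map d ` (S \<inter> chart_dom d)"
  have V: "openin (Euclidean_space (chart_dim d)) ?V"
    using openin_chart_image[OF d] S is_chart_dom[OF d] by blast
  have U: "openin (Euclidean_space (chart_dim c)) (chart_map c ` W)" by (rule openin_chart_image[OF c])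
  have "openin (Euclidean_space (chart_dim c)) {y \<in> chart_map c ` W. local_rep c d f y \<in> ?V}"
  proof (rule openin_preimage_rvec[OF U V])
    show "continuous_on (chart_map c ` W) (\<lambda>x. local_rep c d f x i)" for i
      using f(2) smooth_on_continuous_on[OF _ U] by (simp add: chart_smooth_def C_inf_iff)
    show "local_rep c d f x \<in> rvec (chart_dim d)" if x: "x \<in> chart_map c ` W" for x
    proof -
      obtain p where p: "p \<in> W" "x = chart_map c p" using x by blast
      then have "p \<in> chart_dom c" "f p \<in> chart_dom d" using f(1) c(3) by blast+
      then show ?thesis unfolding p(2) by (simp add: local_rep_chart_map[OF c(1)] is_chart_rvec[OF d])
    qed
  qed
  from openin_chart_preimage[OF c(1) this]
  have "openin T {p \<in> chart_dom c. chart_map c p \<in> {y \<in> chart_map c ` W. local_rep c d f y \<in> ?V}}" .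
  moreover have "{p \<in> chart_dom c. chart_map c p \<in> {y \<in> chart_map c ` W. local_rep c d f y \<in> ?V}} = {p \<in> W. f p \<in> S}"
    (is "?L = ?R") unfolding set_eq_iff
  proof
    fix p
    have inW: "p \<in> W" if "p \<in> chart_dom c" "chart_map c p \<in> chart_map c ` W"
      using that is_chart_inj[OF c(1)] c(3) by (auto dest: inj_onD)
    show "p \<in> ?L \<longleftrightarrow> p \<in> ?R"
    proof (cases "p \<in> W")
      case True
      then have p: "p \<in> chart_dom c" "f p \<in> chart_dom d" using c(3) f(1) by blast+
      have "chart_map d (f p) \<in> ?V \<longleftrightarrow> f p \<in> S"
        using p(2) is_chart_inj[OF d] by (auto dest: inj_onD)
      then show ?thesis using True p by (auto simp: local_rep_chart_map[OF c(1)])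
    next
      case False
      then show ?thesis using inW by auto
    qed
  qed
  ultimately show ?thesis by simp
qed

section \<open>Smooth maps tested in charts\<close>

definition charted_space :: "'a manifold \<Rightarrow> bool" where
  "charted_space M \<longleftrightarrow> (\<forall>c\<in>atlas M. is_chart (mtop M) c) \<and> (\<forall>c\<in>atlas M. \<forall>d\<in>atlas M. compatible c d)"

lemma smooth_manifold_charted_space: "smooth_manifold M \<Longrightarrow> charted_space M"
  by (simp add: smooth_manifold_def charted_space_def)

lemma charted_space_is_chart: "charted_space M \<Longrightarrow> c \<in> atlas M \<Longrightarrow> is_chart (mtop M) c"
  by (simp add: charted_space_def)

lemma charted_space_smooth:
  "charted_space M \<Longrightarrow> c \<in> atlas M \<Longrightarrow> d \<in> atlas M \<Longrightarrow> chart_smooth c d (\<lambda>p. p) (chart_dom c \<inter> chart_dom d)"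
  by (auto simp: charted_space_def compatible_iff)

lemma smooth_manifold_chart_at:
  assumes "smooth_manifold M" "p \<in> mpoints M"
  obtains c where "c \<in> atlas M" "p \<in> chart_dom c"
  using assms unfolding smooth_manifold_def by blast

lemma smooth_map_continuous: "smooth_map M N f \<Longrightarrow> continuous_map (mtop M) (mtop N) f"
  by (simp add: smooth_map_def)

lemma smooth_map_points: "smooth_map M N f \<Longrightarrow> p \<in> mpoints M \<Longrightarrow> f p \<in> mpoints N"
  by (auto simp: smooth_map_def continuous_map_def)

lemma smooth_map_chart_smooth:
  "smooth_map M N f \<Longrightarrow> c \<in> atlas M \<Longrightarrow> d \<in> atlas N \<Longrightarrow> chart_smooth c d f (chart_dom c \<inter> f -` chart_dom d)"
  by (simp add: smooth_map_def chart_smooth_def)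

lemma openin_vimage_chart:
  assumes "continuous_map T T' f" "openin T W" "openin T' S"
  shows "openin T (W \<inter> f -` S)"
proof -
  have "openin T {x \<in> topspace T. f x \<in> S}" using assms openin_continuous_map_preimage by blast
  moreover have "W \<inter> f -` S = W \<inter> {x \<in> topspace T. f x \<in> S}" using openin_subset[OF assms(2)] by auto
  ultimately show ?thesis using assms(2) by auto
qed

text \<open>The definition of a smooth map asks for continuity and for all pairs of charts. One good
  pair near each point gives both: continuity through \<open>chart_smooth_openin_preimage\<close>,
  and any other pair by composing with changes of charts on either side.\<close>

lemma smooth_mapI:
  assumes M: "charted_space M" and N: "charted_space N"
    and loc: "\<And>p. p \<in> mpoints M \<Longrightarrow> \<exists>c\<in>atlas M. \<exists>d\<in>atlas N. \<exists>W. openin (mtop M) W \<and> p \<in> W \<and> W \<subseteq> chart_dom c \<and>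
        f ` W \<subseteq> chart_dom d \<and> chart_smooth c d f W"
  shows "smooth_map M N f"
proof -
  have cont: "continuous_map (mtop M) (mtop N) f"
    unfolding continuous_map_def
  proof (intro conjI allI impI)
    show "f \<in> mpoints M \<rightarrow> mpoints N"
    proof
      fix p assume "p \<in> mpoints M"
      with loc obtain d W where "d \<in> atlas N" "p \<in> W" "f ` W \<subseteq> chart_dom d" by meson
      then show "f p \<in> mpoints N" using charted_space_is_chart[OF N] is_chart_dom openin_subset by blast
    qed
    fix S assume S: "openin (mtop N) S"
    show "openin (mtop M) {p \<in> mpoints M. f p \<in> S}"
    proof (subst openin_subopen, intro ballI)
      fix p assume p: "p \<in> {p \<in> mpoints M. f p \<in> S}"
      with loc obtain c d W where W: "c \<in> atlas M" "d \<in> atlas N" "openin (mtop M) W" "p \<in> W" "W \<subseteq> chart_dom c"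
          "f ` W \<subseteq> chart_dom d" "chart_smooth c d f W" by (metis (no_types, lifting) mem_Collect_eq)
      then have "openin (mtop M) {p \<in> W. f p \<in> S}"
        using chart_smooth_openin_preimage[OF charted_space_is_chart[OF M] _ _ charted_space_is_chart[OF N]] S by blast
      then show "\<exists>T. openin (mtop M) T \<and> p \<in> T \<and> T \<subseteq> {p \<in> mpoints M. f p \<in> S}"
        using p W(4) openin_subset[OF W(3)] by (intro exI[of _ "{p \<in> W. f p \<in> S}"]) auto
    qed
  qed
  have "chart_smooth c d f (chart_dom c \<inter> f -` chart_dom d)" if c: "c \<in> atlas M" and d: "d \<in> atlas N" for c d
  proof -
    note ch = charted_space_is_chart[OF M] charted_space_is_chart[OF N]
    have op: "openin (mtop M) (chart_dom c \<inter> f -` chart_dom d)"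
      by (rule openin_vimage_chart[OF cont is_chart_dom[OF ch(1)[OF c]] is_chart_dom[OF ch(2)[OF d]]])
    show ?thesis
    proof (rule chart_smooth_local[OF ch(1)[OF c] op])
      fix p assume p: "p \<in> chart_dom c \<inter> f -` chart_dom d"
      then have "p \<in> mpoints M" using openin_subset[OF op] by blast
      with loc obtain c' d' W where W: "c' \<in> atlas M" "d' \<in> atlas N" "openin (mtop M) W" "p \<in> W" "W \<subseteq> chart_dom c'"
          "f ` W \<subseteq> chart_dom d'" "chart_smooth c' d' f W" by (metis (no_types, lifting))
      let ?W = "chart_dom c \<inter> f -` chart_dom d \<inter> W"
      have opW: "openin (mtop M) ?W" using op W(3) by blast
      have 1: "chart_smooth c c' (\<lambda>p. p) ?W"
        by (rule chart_smooth_subset[OF ch(1)[OF c] _ _ _ charted_space_smooth[OF M c W(1)]])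
           (use is_chart_dom ch c W in auto)
      have 2: "chart_smooth c' d' f ?W"
        by (rule chart_smooth_subset[OF ch(1)[OF W(1)] W(3) W(5) _ W(7)]) auto
      have 3: "chart_smooth d' d (\<lambda>p. p) (chart_dom d' \<inter> chart_dom d)" by (rule charted_space_smooth[OF N W(2) d])
      have 4: "chart_smooth c d' (\<lambda>p. f p) ?W"
        by (rule chart_smooth_compose[OF ch(1)[OF c] opW _ ch(1)[OF W(1)] opW _ _ 1 2]) (use W in auto)
      have "chart_smooth c d (\<lambda>p. f p) ?W"
        by (rule chart_smooth_compose[OF ch(1)[OF c] opW _ ch(2)[OF W(2)] _ _ _ 4 3])
           (use W is_chart_dom[OF ch(2)[OF W(2)]] is_chart_dom[OF ch(2)[OF d]] in auto)
      then show "\<exists>W'. openin (mtop M) W' \<and> p \<in> W' \<and> W' \<subseteq> chart_dom c \<and> chart_smooth c d f W'"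
        using opW p W(4) by (intro exI[of _ ?W]) auto
    qed auto
  qed
  then show ?thesis using cont by (simp add: smooth_map_def chart_smooth_def)
qed

lemma smooth_map_cong:
  assumes M: "charted_space M" and "smooth_map M N f" "\<And>p. p \<in> mpoints M \<Longrightarrow> f p = g p" and N: "charted_space N"
  shows "smooth_map M N g"
proof -
  have cont: "continuous_map (mtop M) (mtop N) g"
    using assms(2,3) continuous_map_eq smooth_map_continuous by metis
  have "chart_smooth c d g (chart_dom c \<inter> g -` chart_dom d)" if c: "c \<in> atlas M" and d: "d \<in> atlas N" for c d
  proof -
    note ch = charted_space_is_chart[OF M c] charted_space_is_chart[OF N d]
    have sub: "chart_dom c \<subseteq> mpoints M" using is_chart_dom[OF ch(1)] openin_subset by blast
    then have eq: "chart_dom c \<inter> g -` chart_dom d = chart_dom c \<inter> f -` chart_dom d" using assms(3) by auto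
    show ?thesis unfolding eq
      by (rule chart_smooth_cong[OF ch(1) _ _ _ smooth_map_chart_smooth[OF assms(2) c d]])
        (use sub assms(3) openin_vimage_chart[OF smooth_map_continuous[OF assms(2)] is_chart_dom[OF ch(1)] is_chart_dom[OF ch(2)]] in auto)
  qed
  then show ?thesis using cont by (simp add: smooth_map_def chart_smooth_def)
qed

lemma smooth_map_id:
  assumes "smooth_manifold M"
  shows "smooth_map M M (\<lambda>p. p)"
proof -
  note M = smooth_manifold_charted_space[OF assms]
  show ?thesis
  proof (rule smooth_mapI[OF M M])
    fix p assume "p \<in> mpoints M"
    then obtain c where c: "c \<in> atlas M" "p \<in> chart_dom c" using smooth_manifold_chart_at[OF assms] by blast
    have "chart_smooth c c (\<lambda>p. p) (chart_dom c)" "openin (mtop M) (chart_dom c)"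
      using charted_space_smooth[OF M c(1) c(1)] is_chart_dom[OF charted_space_is_chart[OF M c(1)]] by auto
    then show "\<exists>c\<in>atlas M. \<exists>d\<in>atlas M. \<exists>W. openin (mtop M) W \<and> p \<in> W \<and> W \<subseteq> chart_dom c \<and>
        (\<lambda>p. p) ` W \<subseteq> chart_dom d \<and> chart_smooth c d (\<lambda>p. p) W"
      using c by (intro bexI[of _ c] exI[of _ "chart_dom c"]) auto
  qed
qed

lemma smooth_map_compose:
  assumes "smooth_manifold M" "smooth_manifold N" "smooth_manifold P" "smooth_map M N f" "smooth_map N P g"
  shows "smooth_map M P (\<lambda>p. g (f p))"
proof -
  note M = smooth_manifold_charted_space[OF assms(1)] and N = smooth_manifold_charted_space[OF assms(2)]
    and P = smooth_manifold_charted_space[OF assms(3)]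
  show ?thesis
  proof (rule smooth_mapI[OF M P])
    fix p assume p: "p \<in> mpoints M"
    then obtain c where c: "c \<in> atlas M" "p \<in> chart_dom c" using smooth_manifold_chart_at[OF assms(1)] by blast
    have fp: "f p \<in> mpoints N" using smooth_map_points[OF assms(4) p] .
    then obtain d where d: "d \<in> atlas N" "f p \<in> chart_dom d" using smooth_manifold_chart_at[OF assms(2)] by blast
    obtain e where e: "e \<in> atlas P" "g (f p) \<in> chart_dom e"
      using smooth_manifold_chart_at[OF assms(3) smooth_map_points[OF assms(5) fp]] by blast
    note ch = charted_space_is_chart[OF M c(1)] charted_space_is_chart[OF N d(1)] charted_space_is_chart[OF P e(1)]
    note op = ch[THEN is_chart_dom]
    let ?V = "chart_dom d \<inter> g -` chart_dom e" let ?W = "chart_dom c \<inter> f -` ?V"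
    have opV: "openin (mtop N) ?V" by (rule openin_vimage_chart[OF smooth_map_continuous[OF assms(5)] op(2,3)])
    have opW: "openin (mtop M) ?W" by (rule openin_vimage_chart[OF smooth_map_continuous[OF assms(4)] op(1) opV])
    have opW0: "openin (mtop M) (chart_dom c \<inter> f -` chart_dom d)"
      by (rule openin_vimage_chart[OF smooth_map_continuous[OF assms(4)] op(1,2)])
    have 1: "chart_smooth c d f ?W"
      by (rule chart_smooth_subset[OF ch(1) opW0 _ _ smooth_map_chart_smooth[OF assms(4) c(1) d(1)]]) auto
    have "chart_smooth c e (\<lambda>p. g (f p)) ?W"
      by (rule chart_smooth_compose[OF ch(1) opW _ ch(2) opV _ _ 1 smooth_map_chart_smooth[OF assms(5) d(1) e(1)]]) auto
    then show "\<exists>c\<in>atlas M. \<exists>d\<in>atlas P. \<exists>W. openin (mtop M) W \<and> p \<in> W \<and> W \<subseteq> chart_dom c \<and>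
        (\<lambda>p. g (f p)) ` W \<subseteq> chart_dom d \<and> chart_smooth c d (\<lambda>p. g (f p)) W"
      using c(1,2) e(1,2) d(2) opW by (intro bexI[of _ c] bexI[of _ e] exI[of _ ?W]) auto
  qed
qed

section \<open>Maximal atlases and changes of charts\<close>

lemma maximal_atlas_compatible:
  assumes A: "\<And>a. a \<in> A \<Longrightarrow> is_chart T a" and cov: "(\<Union>a\<in>A. chart_dom a) = topspace T"
    and c: "c \<in> maximal_atlas T A" and d: "d \<in> maximal_atlas T A"
  shows "compatible c d"
proof -
  have *: "chart_smooth c d (\<lambda>p. p) (chart_dom c \<inter> chart_dom d)"
    if c: "c \<in> maximal_atlas T A" and d: "d \<in> maximal_atlas T A" for c d
  proof -
    have ch: "is_chart T c" "is_chart T d" using c d by (auto simp: maximal_atlas_def)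
    note op = ch[THEN is_chart_dom]
    show ?thesis
    proof (rule chart_smooth_local[OF ch(1)])
      show "openin T (chart_dom c \<inter> chart_dom d)" using op by blast
      fix p assume p: "p \<in> chart_dom c \<inter> chart_dom d"
      then obtain a where a: "a \<in> A" "p \<in> chart_dom a" using cov openin_subset[OF op(1)] by blast
      note cha = A[OF a(1)] note opa = is_chart_dom[OF cha]
      \<comment> \<open>Near p the change from c to d factors through the chart a of A, with which
        both are compatible.\<close>
      let ?W = "chart_dom c \<inter> chart_dom d \<inter> chart_dom a"
      have opW: "openin T ?W" using op opa by blast
      have 1: "chart_smooth c a (\<lambda>p. p) (chart_dom c \<inter> chart_dom a)" "chart_smooth a d (\<lambda>p. p) (chart_dom a \<inter> chart_dom d)"
        using c d a(1) by (auto simp: maximal_atlas_def compatible_iff Int_commute)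
      have 2: "chart_smooth c a (\<lambda>p. p) ?W" by (rule chart_smooth_subset[OF ch(1) _ _ _ 1(1)]) (use op opa in auto)
      have 3: "chart_smooth a d (\<lambda>p. p) ?W" by (rule chart_smooth_subset[OF cha _ _ _ 1(2)]) (use op opa in auto)
      have "chart_smooth c d (\<lambda>p. p) ?W"
        by (rule chart_smooth_compose[OF ch(1) opW _ cha opW _ _ 2 3]) auto
      then show "\<exists>W'. openin T W' \<and> p \<in> W' \<and> W' \<subseteq> chart_dom c \<and> chart_smooth c d (\<lambda>p. p) W'"
        using opW p a(2) by (intro exI[of _ ?W]) auto
    qed auto
  qed
  show ?thesis unfolding compatible_iff using *[OF c d] *[OF d c] by (simp add: Int_commute)
qed

lemma subset_maximal_atlas:
  "(\<And>a. a \<in> A \<Longrightarrow> is_chart T a) \<Longrightarrow> (\<And>a b. a \<in> A \<Longrightarrow> b \<in> A \<Longrightarrow> compatible a b) \<Longrightarrow> A \<subseteq> maximal_atlas T A"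
  by (auto simp: maximal_atlas_def)

lemma smooth_manifold_maximal_atlas:
  assumes A: "\<And>a. a \<in> A \<Longrightarrow> is_chart T a" and comp: "\<And>a b. a \<in> A \<Longrightarrow> b \<in> A \<Longrightarrow> compatible a b"
    and cov: "(\<Union>a\<in>A. chart_dom a) = topspace T"
    and "Hausdorff_space T" "second_countable T"
  shows "smooth_manifold \<lparr>mtop = T, atlas = maximal_atlas T A\<rparr>"
proof -
  have sub: "A \<subseteq> maximal_atlas T A" using subset_maximal_atlas[of A T] A comp by blast
  have "chart_dom c \<subseteq> topspace T" if "c \<in> maximal_atlas T A" for c
    using that is_chart_dom openin_subset by (fastforce simp: maximal_atlas_def)
  then have "(\<Union>c\<in>maximal_atlas T A. chart_dom c) = topspace T" using cov sub by blast
  moreover have "maximal_atlas T (maximal_atlas T A) \<subseteq> maximal_atlas T A"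
    using sub unfolding maximal_atlas_def by blast
  moreover have "\<forall>c\<in>maximal_atlas T A. is_chart T c" by (simp add: maximal_atlas_def)
  moreover have "\<forall>c\<in>maximal_atlas T A. \<forall>d\<in>maximal_atlas T A. compatible c d"
    using maximal_atlas_compatible[of A T] A cov by blast
  ultimately show ?thesis using assms(4,5) by (simp add: smooth_manifold_def)
qed

text \<open>Comparison with a single chart c around the domain is enough: the change to any other
  chart factors through c. Maximality of the atlas then admits the new chart.\<close>

lemma atlas_memI:
  assumes M: "smooth_manifold M" and c: "c \<in> atlas M" and c': "is_chart (mtop M) c'" "chart_dom c' \<subseteq> chart_dom c"
    and s: "chart_smooth c c' (\<lambda>p. p) (chart_dom c')" "chart_smooth c' c (\<lambda>p. p) (chart_dom c')"
  shows "c' \<in> atlas M"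
proof -
  note MC = smooth_manifold_charted_space[OF M]
  note ch = charted_space_is_chart[OF MC]
  have "compatible c' a" if a: "a \<in> atlas M" for a
  proof -
    let ?W = "chart_dom c' \<inter> chart_dom a"
    have op: "openin (mtop M) ?W" using is_chart_dom c' ch[OF a] by blast
    have ca: "chart_smooth c a (\<lambda>p. p) ?W"
      by (rule chart_smooth_subset[OF ch[OF c] _ _ _ charted_space_smooth[OF MC c a]])
         (use is_chart_dom ch c a c' in auto)
    have ac: "chart_smooth a c (\<lambda>p. p) ?W"
      by (rule chart_smooth_subset[OF ch[OF a] _ _ _ charted_space_smooth[OF MC a c]])
         (use is_chart_dom ch c a c' in auto)
    have s': "chart_smooth c c' (\<lambda>p. p) ?W"
      by (rule chart_smooth_subset[OF ch[OF c] is_chart_dom[OF c'(1)] c'(2) _ s(1)]) auto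
    have s'': "chart_smooth c' c (\<lambda>p. p) ?W"
      by (rule chart_smooth_subset[OF c'(1) is_chart_dom[OF c'(1)] _ _ s(2)]) auto
    have 1: "chart_smooth c' a (\<lambda>p. p) ?W"
      by (rule chart_smooth_compose[OF c'(1) op _ ch[OF c] op _ _ s'' ca]) (use c' in auto)
    have 2: "chart_smooth a c' (\<lambda>p. p) ?W"
      by (rule chart_smooth_compose[OF ch[OF a] op _ ch[OF c] op _ _ ac s']) (use c' in auto)
    show ?thesis using 1 2 by (simp add: compatible_iff)
  qed
  then have "c' \<in> maximal_atlas (mtop M) (atlas M)" using c' by (simp add: maximal_atlas_def)
  then show ?thesis using M by (auto simp: smooth_manifold_def)
qed

definition change_chart :: "'a chart \<Rightarrow> nat \<Rightarrow> 'a set \<Rightarrow> ((nat \<Rightarrow> real) \<Rightarrow> nat \<Rightarrow> real) \<Rightarrow> 'a chart" where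
  "change_chart c n W \<Phi> = \<lparr>chart_dim = n, chart_dom = W, chart_map = (\<lambda>p\<in>W. \<Phi> (chart_map c p))\<rparr>"

text \<open>Used for shrinking the domain of a chart and for the fibrewise linear changes that
  straighten a subbundle. The left inverse \<Psi> is two-sided because \<Phi> is onto V.\<close>

lemma change_chart_atlas:
  assumes M: "smooth_manifold M" and c: "c \<in> atlas M" and W: "openin (mtop M) W" "W \<subseteq> chart_dom c"
    and V: "openin (Euclidean_space n) V" "\<Phi> ` (chart_map c ` W) = V"
    and \<Phi>: "C_inf (chart_dim c) (chart_map c ` W) \<Phi>" and \<Psi>: "C_inf n V \<Psi>"
    and inv: "\<And>y. y \<in> chart_map c ` W \<Longrightarrow> \<Psi> (\<Phi> y) = y"
  shows "change_chart c n W \<Phi> \<in> atlas M"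
proof -
  let ?c = "change_chart c n W \<Phi>"
  have sel: "chart_dim ?c = n" "chart_dom ?c = W" "\<And>p. p \<in> W \<Longrightarrow> chart_map ?c p = \<Phi> (chart_map c p)"
    by (auto simp: change_chart_def)
  note ch = charted_space_is_chart[OF smooth_manifold_charted_space[OF M] c]
  have U: "openin (Euclidean_space (chart_dim c)) (chart_map c ` W)" using openin_chart_image[OF ch W] .
  have inj: "inj_on (chart_map ?c) W"
  proof (rule inj_onI)
    fix p q assume p: "p \<in> W" "q \<in> W" "chart_map ?c p = chart_map ?c q"
    then have "\<Psi> (\<Phi> (chart_map c p)) = \<Psi> (\<Phi> (chart_map c q))" by (simp only: sel(3))
    then have "chart_map c p = chart_map c q" using p(1,2) by (simp only: inv[OF imageI])
    then show "p = q" using p W(2) is_chart_inj[OF ch] by (auto dest: inj_onD)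
  qed
  have \<Psi>V: "\<Psi> z \<in> chart_map c ` W" if "z \<in> V" for z using that inv V(2) by auto
  \<comment> \<open>Images under the new chart are preimages under \<Psi>, so their openness follows
    from continuity of \<Psi>.\<close>
  have img: "chart_map ?c ` W' = {z \<in> V. \<Psi> z \<in> chart_map c ` W'}" if "W' \<subseteq> W" for W'
    unfolding set_eq_iff
  proof
    fix z
    show "z \<in> chart_map ?c ` W' \<longleftrightarrow> z \<in> {z \<in> V. \<Psi> z \<in> chart_map c ` W'}"
    proof
      assume "z \<in> chart_map ?c ` W'"
      then obtain p where p: "p \<in> W'" "z = chart_map ?c p" by blast
      then have "p \<in> W" "z = \<Phi> (chart_map c p)" using \<open>W' \<subseteq> W\<close> sel(3) by auto
      then show "z \<in> {z \<in> V. \<Psi> z \<in> chart_map c ` W'}" using V(2) inv p(1) by auto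
    next
      assume "z \<in> {z \<in> V. \<Psi> z \<in> chart_map c ` W'}"
      then obtain p where p: "p \<in> W'" "\<Psi> z = chart_map c p" "z \<in> V" by blast
      then obtain q where q: "q \<in> W" "z = \<Phi> (chart_map c q)" using V(2) by blast
      then have "chart_map c q = chart_map c p" using p(2) inv by simp
      then have "z = chart_map ?c p" using q p(1) \<open>W' \<subseteq> W\<close> sel(3) by (metis in_mono)
      then show "z \<in> chart_map ?c ` W'" using p(1) by blast
    qed
  qed
  have opimg: "openin (Euclidean_space n) (chart_map ?c ` W')" if W': "openin (mtop M) W'" "W' \<subseteq> W" for W'
    unfolding img[OF W'(2)]
  proof (rule openin_preimage_rvec[OF V(1)])
    show "openin (Euclidean_space (chart_dim c)) (chart_map c ` W')" using openin_chart_image[OF ch W'(1)] W'(2) W(2) by blast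
    show "continuous_on V (\<lambda>x. \<Psi> x i)" for i using \<Psi> smooth_on_continuous_on[OF _ V(1)] by (simp add: C_inf_iff)
    show "\<Psi> x \<in> rvec (chart_dim c)" if "x \<in> V" for x using \<Psi>V[OF that] openin_Euclidean_space_subset[OF U] by blast
  qed
  have "is_chart (mtop M) ?c"
  proof (rule is_chartI, unfold sel)
    show "openin (mtop M) W" by fact
    show "chart_map ?c \<in> extensional W" by (simp add: change_chart_def)
    show "openin (Euclidean_space n) (chart_map ?c ` W)" using opimg W(1) by blast
    show "inj_on (chart_map ?c) W" by fact
    show "openin (Euclidean_space n) (chart_map ?c ` W')" if "openin (mtop M) W'" "W' \<subseteq> W" for W' using opimg that by blast
    fix V' assume V': "openin (Euclidean_space n) V'"
    have "openin (Euclidean_space (chart_dim c)) {y \<in> chart_map c ` W. \<Phi> y \<in> V'}"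
    proof (rule openin_preimage_rvec[OF U V'])
      show "continuous_on (chart_map c ` W) (\<lambda>x. \<Phi> x i)" for i using \<Phi> smooth_on_continuous_on[OF _ U] by (simp add: C_inf_iff)
      show "\<Phi> x \<in> rvec n" if "x \<in> chart_map c ` W" for x using that V openin_Euclidean_space_subset by blast
    qed
    from openin_chart_preimage[OF ch this] W(1)
    have "openin (mtop M) (W \<inter> {p \<in> chart_dom c. chart_map c p \<in> {y \<in> chart_map c ` W. \<Phi> y \<in> V'}})" by blast
    moreover have "W \<inter> {p \<in> chart_dom c. chart_map c p \<in> {y \<in> chart_map c ` W. \<Phi> y \<in> V'}} = {p \<in> W. chart_map ?c p \<in> V'}"
      using W(2) sel(3) by auto
    ultimately show "openin (mtop M) {p \<in> W. chart_map ?c p \<in> V'}" by simp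
  qed
  moreover have "chart_smooth c ?c (\<lambda>p. p) W"
  proof -
    have "\<Phi> y = local_rep c ?c (\<lambda>p. p) y" if "y \<in> chart_map c ` W" for y
      using that W(2) by (auto simp: local_rep_chart_map[OF ch] subset_iff sel)
    then show ?thesis unfolding chart_smooth_def C_inf_iff
      using smooth_on_cong[OF U, of "\<lambda>y. \<Phi> y _" "\<lambda>y. local_rep c ?c (\<lambda>p. p) y _"] \<Phi> by (simp add: C_inf_iff)
  qed
  moreover have "chart_smooth ?c c (\<lambda>p. p) W"
  proof -
    have imW: "chart_map ?c ` W = V" using V(2) sel(3) by auto
    have "\<Psi> z = local_rep ?c c (\<lambda>p. p) z" if z: "z \<in> V" for z
    proof -
      obtain p where p: "p \<in> W" "z = chart_map ?c p" using z imW by auto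
      have "local_rep ?c c (\<lambda>p. p) z = chart_map c p"
        using p inv_into_f_f[OF inj p(1)] by (simp add: local_rep_def sel)
      then show ?thesis using p sel(3) inv by auto
    qed
    then show ?thesis unfolding chart_smooth_def C_inf_iff sel(1) imW
      using smooth_on_cong[OF V(1), of "\<lambda>y. \<Psi> y _" "\<lambda>y. local_rep ?c c (\<lambda>p. p) y _"] \<Psi> by (simp add: C_inf_iff)
  qed
  ultimately show ?thesis using atlas_memI[OF M c] W(2) sel(2) by metis
qed

lemma restrict_chart_atlas:
  assumes M: "smooth_manifold M" and c: "c \<in> atlas M" and W: "openin (mtop M) W" "W \<subseteq> chart_dom c"
  shows "change_chart c (chart_dim c) W (\<lambda>y. y) \<in> atlas M"
proof -
  have "openin (Euclidean_space (chart_dim c)) (chart_map c ` W)"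
    using openin_chart_image[OF charted_space_is_chart[OF smooth_manifold_charted_space[OF M] c] W] .
  then show ?thesis
    by (intro change_chart_atlas[OF M c W, where \<Psi> = "\<lambda>y. y"]) (auto simp: C_inf_iff smooth_on_coord)
qed

section \<open>Embedded submanifolds\<close>

lemma induced_chart_sel:
  "chart_dim (induced_chart S k c) = k" "chart_dom (induced_chart S k c) = chart_dom c \<inter> S"
  "p \<in> chart_dom c \<Longrightarrow> p \<in> S \<Longrightarrow> chart_map (induced_chart S k c) p = chart_map c p"
  by (auto simp: induced_chart_def)

text \<open>\<open>slice_chart\<close> speaks of the whole domain of c; injectivity of the chart
  lets the condition pass to every subset W.\<close>

lemma slice_chart_image:
  assumes c: "is_chart T c" and s: "slice_chart M S k c" and W: "W \<subseteq> chart_dom c"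
  shows "chart_map c ` (W \<inter> S) = chart_map c ` W \<inter> rvec k"
proof -
  have im: "chart_map c ` (chart_dom c \<inter> S) = chart_map c ` chart_dom c \<inter> rvec k"
    using s by (simp add: slice_chart_def)
  show ?thesis
  proof (intro equalityI subsetI)
    fix y assume "y \<in> chart_map c ` (W \<inter> S)"
    then show "y \<in> chart_map c ` W \<inter> rvec k" using im W by blast
  next
    fix y assume y: "y \<in> chart_map c ` W \<inter> rvec k"
    then obtain q where q: "q \<in> W" "y = chart_map c q" by blast
    then have "y \<in> chart_map c ` (chart_dom c \<inter> S)" using im y W by blast
    then obtain p where p: "p \<in> chart_dom c" "p \<in> S" "y = chart_map c p" by blast
    have "chart_map c q = chart_map c p" using p q by simp
    then have "q = p" using inj_onD[OF is_chart_inj[OF c]] W q(1) p(1) by blast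
    then show "y \<in> chart_map c ` (W \<inter> S)" using p q by blast
  qed
qed

lemma induced_chart_image: "W \<subseteq> chart_dom c \<Longrightarrow> chart_map (induced_chart S k c) ` (W \<inter> S) = chart_map c ` (W \<inter> S)"
  by (rule image_cong) (auto simp: induced_chart_sel)

lemma openin_slice_image:
  assumes c: "is_chart T c" and s: "slice_chart M S k c" and W: "openin T W" "W \<subseteq> chart_dom c"
  shows "openin (Euclidean_space k) (chart_map c ` (W \<inter> S))"
proof -
  have "k \<le> chart_dim c" using s by (simp add: slice_chart_def)
  from openin_Int_rvec[OF openin_chart_image[OF c W] this] show ?thesis
    by (simp only: slice_chart_image[OF c s W(2)])
qed

lemma is_chart_induced_chart:
  assumes c: "is_chart T c" and s: "slice_chart M S k c" and S: "S \<subseteq> topspace T"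
  shows "is_chart (subtopology T S) (induced_chart S k c)"
proof (rule is_chartI, unfold induced_chart_sel)
  note im = induced_chart_image[OF subset_refl]
  have k: "k \<le> chart_dim c" using s by (simp add: slice_chart_def)
  have dom: "openin T (chart_dom c)" by (rule is_chart_dom[OF c])
  show "openin (subtopology T S) (chart_dom c \<inter> S)" by (rule openin_subtopology_Int[OF dom])
  show "chart_map (induced_chart S k c) \<in> extensional (chart_dom c \<inter> S)" by (simp add: induced_chart_def)
  show "openin (Euclidean_space k) (chart_map (induced_chart S k c) ` (chart_dom c \<inter> S))"
    unfolding im by (rule openin_slice_image[OF c s dom subset_refl])
  have "inj_on (chart_map c) (chart_dom c \<inter> S)" using is_chart_inj[OF c] inj_on_subset by blast
  then show "inj_on (chart_map (induced_chart S k c)) (chart_dom c \<inter> S)"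
    by (subst inj_on_cong[where g = "chart_map c"]) (auto simp: induced_chart_sel)
  show "openin (Euclidean_space k) (chart_map (induced_chart S k c) ` W)"
    if W: "openin (subtopology T S) W" "W \<subseteq> chart_dom c \<inter> S" for W
  proof -
    obtain B where B: "openin T B" "W = B \<inter> S" using W(1) unfolding openin_subtopology by blast
    let ?B = "B \<inter> chart_dom c"
    have WB: "W = ?B \<inter> S" using B W(2) by blast
    show ?thesis unfolding WB induced_chart_image[OF Int_lower2]
      by (rule openin_slice_image[OF c s]) (use B dom in auto)
  qed
  fix V assume "openin (Euclidean_space k) V"
  \<comment> \<open>An open set of R^k is the trace of an open set Z of the ambient sequence space,
    so it extends to an open set of the larger R^n in which c takes its values.\<close>
  then obtain Z where Z: "open Z" "V = Z \<inter> rvec k" unfolding openin_Euclidean_space_iff by blast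
  have "openin (Euclidean_space (chart_dim c)) (Z \<inter> rvec (chart_dim c))" unfolding openin_Euclidean_space_iff using Z(1) by blast
  from openin_chart_preimage[OF c this]
  have 1: "openin T {p \<in> chart_dom c. chart_map c p \<in> Z \<inter> rvec (chart_dim c)}" .
  have kk: "chart_map c p \<in> rvec k" if "p \<in> chart_dom c" "p \<in> S" for p
    using s that unfolding slice_chart_def by blast
  have "{p \<in> chart_dom c \<inter> S. chart_map (induced_chart S k c) p \<in> V} = {p \<in> chart_dom c. chart_map c p \<in> Z \<inter> rvec (chart_dim c)} \<inter> S"
  proof (intro equalityI subsetI)
    fix p assume "p \<in> {p \<in> chart_dom c \<inter> S. chart_map (induced_chart S k c) p \<in> V}"
    then show "p \<in> {p \<in> chart_dom c. chart_map c p \<in> Z \<inter> rvec (chart_dim c)} \<inter> S"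
      using Z(2) is_chart_rvec[OF c, of p] induced_chart_sel(3)[of p c S k] by simp
  next
    fix p assume "p \<in> {p \<in> chart_dom c. chart_map c p \<in> Z \<inter> rvec (chart_dim c)} \<inter> S"
    then show "p \<in> {p \<in> chart_dom c \<inter> S. chart_map (induced_chart S k c) p \<in> V}"
      using Z(2) kk[of p] induced_chart_sel(3)[of p c S k] by simp
  qed
  then show "openin (subtopology T S) {p \<in> chart_dom c \<inter> S. chart_map (induced_chart S k c) p \<in> V}"
    using openin_subtopology_Int[OF 1] by simp
qed

text \<open>On the slice the local representative is the restriction of the ambient one, so
  \<open>smooth_on_Int_rvec\<close> applies.\<close>

lemma chart_smooth_from_induced:
  assumes c: "is_chart T c" and s: "slice_chart M S k c" and W: "openin T W" "W \<subseteq> chart_dom c"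
    and f: "chart_smooth c d f W"
  shows "chart_smooth (induced_chart S k c) d f (W \<inter> S)"
  unfolding chart_smooth_def C_inf_iff induced_chart_sel(1) induced_chart_image[OF W(2)]
proof
  fix i
  have k: "k \<le> chart_dim c" using s by (simp add: slice_chart_def)
  have "smooth_on k (chart_map c ` W \<inter> rvec k) (\<lambda>y. local_rep c d f y i)"
    by (rule smooth_on_Int_rvec[OF openin_chart_image[OF c W] _ k]) (use f in \<open>simp add: chart_smooth_def C_inf_iff\<close>)
  then have "smooth_on k (chart_map c ` (W \<inter> S)) (\<lambda>y. local_rep c d f y i)"
    by (simp only: slice_chart_image[OF c s W(2)])
  moreover have "local_rep c d f y i = local_rep (induced_chart S k c) d f y i" if y: "y \<in> chart_map c ` (W \<inter> S)" for y
  proof -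
    obtain p where p: "p \<in> W" "p \<in> S" "y = chart_map c p" using y by blast
    then have pd: "p \<in> chart_dom c" using W by blast
    have "inj_on (chart_map (induced_chart S k c)) (chart_dom c \<inter> S)"
      by (subst inj_on_cong[where g = "chart_map c"])
        (use is_chart_inj[OF c] in \<open>auto simp: induced_chart_sel intro: inj_on_subset\<close>)
    from inv_into_f_f[OF this, of p] have "inv_into (chart_dom c \<inter> S) (chart_map (induced_chart S k c)) y = p"
      using p pd induced_chart_sel(3)[OF pd p(2), of k] by simp
    moreover have "inv_into (chart_dom c) (chart_map c) y = p"
      using p(3) inv_into_f_f[OF is_chart_inj[OF c] pd] by simp
    ultimately show ?thesis by (simp add: local_rep_def induced_chart_sel(2))
  qed
  ultimately show "smooth_on k (chart_map c ` (W \<inter> S)) (\<lambda>y. local_rep (induced_chart S k c) d f y i)"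
    using smooth_on_cong[OF openin_slice_image[OF c s W], of "\<lambda>y. local_rep c d f y i" "\<lambda>y. local_rep (induced_chart S k c) d f y i"] by blast
qed

text \<open>An induced chart restricts the domain but does not truncate coordinates: a map with
  values in S has the same local representative in d and in the chart induced by d.\<close>

lemma chart_smooth_to_induced:
  assumes c: "is_chart T c" "openin T W" "W \<subseteq> chart_dom c"
    and f: "f ` W \<subseteq> chart_dom d \<inter> S" "chart_smooth c d f W"
  shows "chart_smooth c (induced_chart S k d) f W"
proof -
  have eq: "local_rep c d f y = local_rep c (induced_chart S k d) f y" if y: "y \<in> chart_map c ` W" for y
  proof -
    obtain p where p: "p \<in> W" "y = chart_map c p" using y by blast
    then have "p \<in> chart_dom c" "f p \<in> chart_dom d" "f p \<in> S" using c(3) f(1) by blast+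
    then show ?thesis unfolding p(2) local_rep_chart_map[OF c(1) \<open>p \<in> chart_dom c\<close>] by (simp add: induced_chart_sel)
  qed
  show ?thesis unfolding chart_smooth_def C_inf_iff
  proof
    fix i
    have "smooth_on (chart_dim c) (chart_map c ` W) (\<lambda>y. local_rep c d f y i)"
      using f(2) by (simp add: chart_smooth_def C_inf_iff)
    then show "smooth_on (chart_dim c) (chart_map c ` W) (\<lambda>y. local_rep c (induced_chart S k d) f y i)"
      by (rule smooth_on_cong[OF openin_chart_image[OF c], rotated]) (simp add: eq)
  qed
qed

text \<open>A change between induced charts is a change between ambient charts, cut down to a slice
  in the source and unaltered in the target. The dimension of the slice may differ from chart to
  chart.\<close>

lemma embedded_submanifold_charts:
  assumes M: "smooth_manifold M" and S: "embedded_submanifold M S"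
  defines "A \<equiv> {induced_chart S k c |k c. slice_chart M S k c}"
  shows "a \<in> A \<Longrightarrow> is_chart (subtopology (mtop M) S) a"
    and "a \<in> A \<Longrightarrow> b \<in> A \<Longrightarrow> compatible a b"
    and "(\<Union>a\<in>A. chart_dom a) = topspace (subtopology (mtop M) S)"
proof -
  note MC = smooth_manifold_charted_space[OF M]
  note ch = charted_space_is_chart[OF MC]
  have Ssub: "S \<subseteq> mpoints M" using S by (simp add: embedded_submanifold_def)
  have sl: "c \<in> atlas M" if "slice_chart M S k c" for k c using that by (simp add: slice_chart_def)
  show "is_chart (subtopology (mtop M) S) a" if a: "a \<in> A" for a
  proof -
    obtain k c where "slice_chart M S k c" "a = induced_chart S k c" using a by (auto simp: A_def)
    then show ?thesis using is_chart_induced_chart[OF ch _ Ssub] sl by blast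
  qed
  have *: "chart_smooth (induced_chart S k c) (induced_chart S l d) (\<lambda>p. p) (chart_dom c \<inter> chart_dom d \<inter> S)"
    if c: "slice_chart M S k c" and d: "slice_chart M S l d" for k c l d
  proof (rule chart_smooth_to_induced)
    show "is_chart (subtopology (mtop M) S) (induced_chart S k c)" by (rule is_chart_induced_chart[OF ch[OF sl[OF c]] c Ssub])
    have op: "openin (mtop M) (chart_dom c \<inter> chart_dom d)" using is_chart_dom ch sl c d by blast
    then show "openin (subtopology (mtop M) S) (chart_dom c \<inter> chart_dom d \<inter> S)" by (rule openin_subtopology_Int)
    show "chart_smooth (induced_chart S k c) d (\<lambda>p. p) (chart_dom c \<inter> chart_dom d \<inter> S)"
      by (rule chart_smooth_from_induced[OF ch[OF sl[OF c]] c op Int_lower1 charted_space_smooth[OF MC sl[OF c] sl[OF d]]])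
  qed (auto simp: induced_chart_sel)
  show "compatible a b" if ab: "a \<in> A" "b \<in> A" for a b
  proof -
    obtain k c l d where c: "slice_chart M S k c" "a = induced_chart S k c" and d: "slice_chart M S l d" "b = induced_chart S l d"
      using ab by (auto simp: A_def)
    have eq: "chart_dom a \<inter> chart_dom b = chart_dom c \<inter> chart_dom d \<inter> S"
      "chart_dom c \<inter> chart_dom d \<inter> S = chart_dom d \<inter> chart_dom c \<inter> S"
      unfolding c(2) d(2) induced_chart_sel by blast+
    show ?thesis unfolding compatible_iff eq(1) using *[OF c(1) d(1)] *[OF d(1) c(1)] eq(2) c(2) d(2) by simp
  qed
  have "\<exists>a\<in>A. p \<in> chart_dom a" if p: "p \<in> S" for p
  proof -
    obtain k c where c: "slice_chart M S k c" "p \<in> chart_dom c" using S p unfolding embedded_submanifold_def by blast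
    then show ?thesis using p by (intro bexI[of _ "induced_chart S k c"]) (auto simp: A_def induced_chart_sel)
  qed
  moreover have "chart_dom a \<subseteq> S" if "a \<in> A" for a using that by (auto simp: A_def induced_chart_sel)
  ultimately show "(\<Union>a\<in>A. chart_dom a) = topspace (subtopology (mtop M) S)" using Ssub by auto
qed

lemma submanifold_sel: "mtop (submanifold M S) = subtopology (mtop M) S"
  by (simp add: submanifold_def)

lemma embedded_submanifold_points: "embedded_submanifold M S \<Longrightarrow> mpoints (submanifold M S) = S"
  by (auto simp: embedded_submanifold_def submanifold_sel)

lemma smooth_manifold_submanifold:
  assumes M: "smooth_manifold M" and S: "embedded_submanifold M S"
  shows "smooth_manifold (submanifold M S)"
  unfolding submanifold_def
  by (rule smooth_manifold_maximal_atlas)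
    (use M embedded_submanifold_charts[OF M S] Hausdorff_space_subtopology second_countable_subtopology
     in \<open>auto simp: smooth_manifold_def\<close>)

lemma induced_chart_atlas:
  assumes M: "smooth_manifold M" and S: "embedded_submanifold M S" and c: "slice_chart M S k c"
  shows "induced_chart S k c \<in> atlas (submanifold M S)"
proof -
  have "{induced_chart S k c |k c. slice_chart M S k c} \<subseteq> atlas (submanifold M S)"
    unfolding submanifold_def manifold.simps
    by (rule subset_maximal_atlas) (rule embedded_submanifold_charts[OF M S]; blast)+
  then show ?thesis using c by blast
qed

lemma smooth_map_submanifold:
  assumes M: "smooth_manifold M" and N: "smooth_manifold N" and f: "smooth_map M N f"
    and S: "embedded_submanifold M S" and S': "embedded_submanifold N S'" and im: "f ` S \<subseteq> S'"
  shows "smooth_map (submanifold M S) (submanifold N S') f"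
proof (rule smooth_mapI)
  show MS: "charted_space (submanifold M S)" and NS: "charted_space (submanifold N S')"
    using smooth_manifold_charted_space smooth_manifold_submanifold M N S S' by blast+
  fix p assume "p \<in> mpoints (submanifold M S)"
  then have p: "p \<in> S" using embedded_submanifold_points[OF S] by simp
  then obtain k c where c: "slice_chart M S k c" "p \<in> chart_dom c" using S unfolding embedded_submanifold_def by blast
  have fp: "f p \<in> S'" using p im by blast
  then obtain l d where d: "slice_chart N S' l d" "f p \<in> chart_dom d" using S' unfolding embedded_submanifold_def by blast
  have cd: "c \<in> atlas M" "d \<in> atlas N" using c d by (auto simp: slice_chart_def)
  note ch = charted_space_is_chart[OF smooth_manifold_charted_space[OF M] cd(1)]
    charted_space_is_chart[OF smooth_manifold_charted_space[OF N] cd(2)]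
  let ?W = "chart_dom c \<inter> f -` chart_dom d"
  let ?c = "induced_chart S k c" let ?d = "induced_chart S' l d"
  have opW: "openin (mtop M) ?W" by (rule openin_vimage_chart[OF smooth_map_continuous[OF f] ch[THEN is_chart_dom]])
  have opWS: "openin (mtop (submanifold M S)) (?W \<inter> S)" unfolding submanifold_sel by (rule openin_subtopology_Int[OF opW])
  have 1: "chart_smooth ?c d f (?W \<inter> S)"
    by (rule chart_smooth_from_induced[OF ch(1) c(1) opW Int_lower1 smooth_map_chart_smooth[OF f cd]])
  have "chart_smooth ?c ?d f (?W \<inter> S)"
    by (rule chart_smooth_to_induced[OF charted_space_is_chart[OF MS induced_chart_atlas[OF M S c(1)]] opWS _ _ 1])
      (use im in \<open>auto simp: induced_chart_sel\<close>)
  then show "\<exists>c\<in>atlas (submanifold M S). \<exists>d\<in>atlas (submanifold N S'). \<exists>W. openin (mtop (submanifold M S)) W \<and> p \<in> W \<and>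
      W \<subseteq> chart_dom c \<and> f ` W \<subseteq> chart_dom d \<and> chart_smooth c d f W"
    using opWS p c d im induced_chart_atlas[OF M S c(1)] induced_chart_atlas[OF N S' d(1)]
    by (intro bexI[of _ ?c] bexI[of _ ?d] exI[of _ "?W \<inter> S"]) (auto simp: induced_chart_sel)
qed


section \<open>Manifolds defined by charts\<close>

lemma second_countable_Euclidean_space: "second_countable (Euclidean_space k)"
proof -
  obtain B :: "(nat \<Rightarrow> real) set set" where B: "countable B" "\<And>C. C \<in> B \<Longrightarrow> open C" "\<And>S. open S \<Longrightarrow> \<exists>U. U \<subseteq> B \<and> S = \<Union>U"
    using univ_second_countable by blast
  have "second_countable (euclidean :: (nat \<Rightarrow> real) topology)"
    unfolding second_countable_def
  proof (intro exI[of _ B] conjI ballI allI impI)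
    show "countable B" by (rule B)
    show "openin euclidean V" if "V \<in> B" for V using B(2)[OF that] by simp
    fix U and x :: "nat \<Rightarrow> real" assume U: "openin euclidean U \<and> x \<in> U"
    then obtain C where "C \<subseteq> B" "U = \<Union>C" using B(3)[of U] by auto
    then show "\<exists>V\<in>B. x \<in> V \<and> V \<subseteq> U" using U by blast
  qed
  then show ?thesis by (subst Euclidean_space_eq_top_of_set) (rule second_countable_subtopology)
qed

lemma second_countable_chart_dom:
  assumes "is_chart T c"
  shows "second_countable (subtopology T (chart_dom c))"
proof -
  let ?Y = "subtopology (Euclidean_space (chart_dim c)) (chart_map c ` chart_dom c)"
  have "homeomorphic_map (subtopology T (chart_dom c)) ?Y (chart_map c)" using assms by (simp add: is_chart_def)
  then have "subtopology T (chart_dom c) homeomorphic_space ?Y" using homeomorphic_map_imp_homeomorphic_space by blast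
  moreover have "second_countable ?Y" by (rule second_countable_subtopology[OF second_countable_Euclidean_space])
  ultimately show ?thesis using homeomorphic_space_second_countability by blast
qed

text \<open>Open sets have open traces on the pieces of the cover, so the countable bases of the
  pieces together form a base.\<close>

lemma second_countable_countable_cover:
  assumes "countable \<U>" and U: "\<And>U. U \<in> \<U> \<Longrightarrow> openin T U \<and> second_countable (subtopology T U)" and cov: "topspace T \<subseteq> \<Union>\<U>"
  shows "second_countable T"
proof -
  have "\<exists>B. countable B \<and> (\<forall>V\<in>B. openin T V) \<and> (\<forall>S x. openin T S \<and> x \<in> S \<inter> U \<longrightarrow> (\<exists>V\<in>B. x \<in> V \<and> V \<subseteq> S))"
    if "U \<in> \<U>" for U
  proof -
    have op: "openin T U" and "second_countable (subtopology T U)" using U[OF that] by auto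
    then obtain B where B: "countable B" "\<And>V. V \<in> B \<Longrightarrow> openin (subtopology T U) V"
      "\<And>S x. openin (subtopology T U) S \<Longrightarrow> x \<in> S \<Longrightarrow> \<exists>V\<in>B. x \<in> V \<and> V \<subseteq> S"
      unfolding second_countable_def by metis
    have "openin T V" if "V \<in> B" for V using B(2)[OF that] op openin_trans_full by blast
    moreover have "\<exists>V\<in>B. x \<in> V \<and> V \<subseteq> S" if S: "openin T S" "x \<in> S \<inter> U" for S x
    proof -
      have "openin (subtopology T U) (S \<inter> U)" by (rule openin_subtopology_Int[OF S(1)])
      then show ?thesis using B(3) S(2) by (meson le_inf_iff)
    qed
    ultimately show ?thesis using B(1) by blast
  qed
  then obtain B where B: "\<And>U. U \<in> \<U> \<Longrightarrow> countable (B U)" "\<And>U V. U \<in> \<U> \<Longrightarrow> V \<in> B U \<Longrightarrow> openin T V"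
     "\<And>U S x. U \<in> \<U> \<Longrightarrow> openin T S \<Longrightarrow> x \<in> S \<inter> U \<Longrightarrow> \<exists>V\<in>B U. x \<in> V \<and> V \<subseteq> S"
    by metis
  show ?thesis
    unfolding second_countable_def
  proof (intro exI[of _ "\<Union>U\<in>\<U>. B U"] conjI ballI allI impI)
    show "countable (\<Union>U\<in>\<U>. B U)" using B(1) assms(1) by blast
    show "openin T V" if "V \<in> (\<Union>U\<in>\<U>. B U)" for V using that B(2) by blast
    fix S x assume S: "openin T S \<and> x \<in> S"
    then obtain U where "U \<in> \<U>" "x \<in> U" using cov openin_subset by blast
    then show "\<exists>V\<in>(\<Union>U\<in>\<U>. B U). x \<in> V \<and> V \<subseteq> S" using B(3)[of U S x] S by blast
  qed
qed

text \<open>Second countability implies the Lindelof property, which thins out the atlas. Pairs from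
  two such covers later give a countable family of bundle charts covering a pulled back tangent
  bundle.\<close>

lemma countable_chart_cover:
  assumes "smooth_manifold M"
  obtains C where "C \<subseteq> atlas M" "countable C" "mpoints M = (\<Union>c\<in>C. chart_dom c)"
proof -
  have "Lindelof_space (mtop M)" using assms second_countable_imp_Lindelof_space by (auto simp: smooth_manifold_def)
  moreover have "\<forall>U\<in>chart_dom ` atlas M. openin (mtop M) U"
    using charted_space_is_chart[OF smooth_manifold_charted_space[OF assms]] is_chart_dom by blast
  moreover have cov: "\<Union>(chart_dom ` atlas M) = mpoints M" using assms by (simp add: smooth_manifold_def)
  ultimately obtain \<V> where V: "countable \<V>" "\<V> \<subseteq> chart_dom ` atlas M" "\<Union>\<V> = mpoints M"
    unfolding Lindelof_space_def by metis
  obtain C where "C \<subseteq> atlas M" "countable C" "\<V> = chart_dom ` C" using V countable_subset_image[of \<V> chart_dom "atlas M"] by auto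
  then show ?thesis using that V(3) by blast
qed

text \<open>The hypotheses of the manifold chart lemma: a bare set with charts, from which the
  topology is to be built. Separation and countability are added in
  \<open>smooth_charted_manifold\<close>.\<close>

locale chart_family =
  fixes S :: "'a set" and A :: "'a chart set"
  assumes dom_subset: "a \<in> A \<Longrightarrow> chart_dom a \<subseteq> S"
    and extensional: "a \<in> A \<Longrightarrow> chart_map a \<in> extensional (chart_dom a)"
    and inj: "a \<in> A \<Longrightarrow> inj_on (chart_map a) (chart_dom a)"
    and open_overlap: "a \<in> A \<Longrightarrow> b \<in> A \<Longrightarrow> openin (Euclidean_space (chart_dim a)) (chart_map a ` (chart_dom a \<inter> chart_dom b))"
    and compat: "a \<in> A \<Longrightarrow> b \<in> A \<Longrightarrow> compatible a b"
    and cover: "S \<subseteq> (\<Union>a\<in>A. chart_dom a)"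
begin

text \<open>\<open>topology\<close> has the expected open sets only after its predicate is shown to
  define a topology. For intersections this uses injectivity of the charts, by which images commute
  with intersections.\<close>

lemma openin_charted_topology:
  "openin (charted_topology S A) U \<longleftrightarrow> U \<subseteq> S \<and> (\<forall>a\<in>A. openin (Euclidean_space (chart_dim a)) (chart_map a ` (U \<inter> chart_dom a)))"
proof -
  let ?P = "\<lambda>U. U \<subseteq> S \<and> (\<forall>a\<in>A. openin (Euclidean_space (chart_dim a)) (chart_map a ` (U \<inter> chart_dom a)))"
  have "istopology ?P"
    unfolding istopology_def
  proof (intro conjI allI impI)
    fix U V assume UV: "?P U" "?P V"
    show "U \<inter> V \<subseteq> S" using UV by blast
    show "\<forall>a\<in>A. openin (Euclidean_space (chart_dim a)) (chart_map a ` (U \<inter> V \<inter> chart_dom a))"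
    proof
      fix a assume a: "a \<in> A"
      have "chart_map a ` ((U \<inter> chart_dom a) \<inter> (V \<inter> chart_dom a)) = chart_map a ` (U \<inter> chart_dom a) \<inter> chart_map a ` (V \<inter> chart_dom a)"
        by (rule inj_on_image_Int[OF inj[OF a]]) auto
      moreover have "(U \<inter> chart_dom a) \<inter> (V \<inter> chart_dom a) = U \<inter> V \<inter> chart_dom a" by blast
      ultimately show "openin (Euclidean_space (chart_dim a)) (chart_map a ` (U \<inter> V \<inter> chart_dom a))"
        using UV a by (metis openin_Int)
    qed
  next
    fix \<K> assume K: "\<forall>K\<in>\<K>. ?P K"
    then show "\<Union>\<K> \<subseteq> S" by blast
    show "\<forall>a\<in>A. openin (Euclidean_space (chart_dim a)) (chart_map a ` (\<Union>\<K> \<inter> chart_dom a))"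
    proof
      fix a assume a: "a \<in> A"
      have "chart_map a ` (\<Union>\<K> \<inter> chart_dom a) = (\<Union>K\<in>\<K>. chart_map a ` (K \<inter> chart_dom a))" by blast
      then show "openin (Euclidean_space (chart_dim a)) (chart_map a ` (\<Union>\<K> \<inter> chart_dom a))"
        using K a by auto
    qed
  qed
  then show ?thesis unfolding charted_topology_def by (simp add: topology_inverse')
qed

lemma topspace_charted_topology: "topspace (charted_topology S A) = S"
proof -
  have "chart_map a ` (S \<inter> chart_dom a) = chart_map a ` (chart_dom a \<inter> chart_dom a)" if "a \<in> A" for a
    using dom_subset[OF that] by blast
  then have "openin (charted_topology S A) S"
    using open_overlap[of a a for a] unfolding openin_charted_topology by simp
  from openin_subset[OF this] show ?thesis
    using openin_topspace[of "charted_topology S A"] openin_charted_topology[of "topspace (charted_topology S A)"] by blast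
qed

text \<open>Openness in the new topology is tested in every chart b, so continuity of the chart a
  amounts to continuity of the change from b to a.\<close>

lemma is_chart_charted_topology:
  assumes a: "a \<in> A"
  shows "is_chart (charted_topology S A) a"
proof (rule is_chartI)
  show "openin (charted_topology S A) (chart_dom a)"
    using open_overlap[OF _ a] dom_subset[OF a] by (simp add: openin_charted_topology Int_commute)
  show "chart_map a \<in> extensional (chart_dom a)" "inj_on (chart_map a) (chart_dom a)" by (rule extensional[OF a] inj[OF a])+
  show "openin (Euclidean_space (chart_dim a)) (chart_map a ` chart_dom a)" using open_overlap[OF a a] by simp
  show "openin (Euclidean_space (chart_dim a)) (chart_map a ` W)" if "openin (charted_topology S A) W" "W \<subseteq> chart_dom a" for W
  proof -
    have "W \<inter> chart_dom a = W" using that by blast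
    then show ?thesis using that a by (metis openin_charted_topology)
  qed
  fix V assume V: "openin (Euclidean_space (chart_dim a)) V"
  let ?P = "{p \<in> chart_dom a. chart_map a p \<in> V}"
  show "openin (charted_topology S A) ?P"
    unfolding openin_charted_topology
  proof (intro conjI ballI)
    show "?P \<subseteq> S" using dom_subset[OF a] by blast
    fix b assume b: "b \<in> A"
    let ?U = "chart_map b ` (chart_dom b \<inter> chart_dom a)"
    have U: "openin (Euclidean_space (chart_dim b)) ?U" by (rule open_overlap[OF b a])
    have rep: "local_rep b a (\<lambda>p. p) (chart_map b p) = chart_map a p" if "p \<in> chart_dom b" for p
      using inv_into_f_f[OF inj[OF b] that] by (simp add: local_rep_def)
    have "openin (Euclidean_space (chart_dim b)) {y \<in> ?U. local_rep b a (\<lambda>p. p) y \<in> V}"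
    proof (rule openin_preimage_rvec[OF U V])
      have "C_inf (chart_dim b) ?U (local_rep b a (\<lambda>p. p))" using compat[OF b a] by (simp add: compatible_def)
      then show "continuous_on ?U (\<lambda>x. local_rep b a (\<lambda>p. p) x i)" for i
        using smooth_on_continuous_on[OF _ U] by (simp add: C_inf_iff)
      show "local_rep b a (\<lambda>p. p) y \<in> rvec (chart_dim a)" if "y \<in> ?U" for y
        using that rep openin_Euclidean_space_subset[OF open_overlap[OF a a]] by auto
    qed
    moreover have "{y \<in> ?U. local_rep b a (\<lambda>p. p) y \<in> V} = chart_map b ` (?P \<inter> chart_dom b)"
      using rep by auto
    ultimately show "openin (Euclidean_space (chart_dim b)) (chart_map b ` (?P \<inter> chart_dom b))" by simp
  qed
qed

lemma charted_manifold_atlas: "A \<subseteq> atlas (charted_manifold S A)"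
  unfolding charted_manifold_def manifold.simps
  by (rule subset_maximal_atlas[OF is_chart_charted_topology compat])

lemma charted_manifold_points: "mpoints (charted_manifold S A) = S"
  by (simp add: charted_manifold_def topspace_charted_topology)

text \<open>Two points of a common chart are separated inside it because R^k is Hausdorff;
  \<open>sep\<close> asks for separating open sets only for the remaining pairs. The countable
  subfamily C gives second countability.\<close>

lemma smooth_charted_manifold:
  assumes C: "C \<subseteq> A" "countable C" "S \<subseteq> (\<Union>a\<in>C. chart_dom a)"
    and sep: "\<And>p q. p \<in> S \<Longrightarrow> q \<in> S \<Longrightarrow> p \<noteq> q \<Longrightarrow> (\<exists>a\<in>A. p \<in> chart_dom a \<and> q \<in> chart_dom a) \<or>
       (\<exists>U V. openin (charted_topology S A) U \<and> openin (charted_topology S A) V \<and> p \<in> U \<and> q \<in> V \<and> U \<inter> V = {})"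
  shows "smooth_manifold (charted_manifold S A)"
proof -
  let ?T = "charted_topology S A"
  note ch = is_chart_charted_topology
  have "second_countable ?T"
  proof (rule second_countable_countable_cover[of "chart_dom ` C"])
    show "openin ?T U \<and> second_countable (subtopology ?T U)" if "U \<in> chart_dom ` C" for U
      using that ch is_chart_dom second_countable_chart_dom C(1) by blast
  qed (use C topspace_charted_topology in auto)
  moreover have "Hausdorff_space ?T"
    unfolding Hausdorff_space_def topspace_charted_topology
  proof (intro allI impI)
    fix p q assume pq: "p \<in> S \<and> q \<in> S \<and> p \<noteq> q"
    have "\<exists>U V. openin ?T U \<and> openin ?T V \<and> p \<in> U \<and> q \<in> V \<and> U \<inter> V = {}" if "\<exists>a\<in>A. p \<in> chart_dom a \<and> q \<in> chart_dom a"
    proof -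
      obtain a where a: "a \<in> A" "p \<in> chart_dom a" "q \<in> chart_dom a" using \<open>\<exists>a\<in>A. _ a\<close> by blast
      have "chart_map a p \<noteq> chart_map a q" using inj[OF a(1)] a pq by (auto dest: inj_onD)
      moreover have "chart_map a p \<in> rvec (chart_dim a)" "chart_map a q \<in> rvec (chart_dim a)"
        using is_chart_rvec[OF ch[OF a(1)]] a by blast+
      ultimately obtain U V where UV: "openin (Euclidean_space (chart_dim a)) U" "openin (Euclidean_space (chart_dim a)) V"
        "chart_map a p \<in> U" "chart_map a q \<in> V" "U \<inter> V = {}"
        using Hausdorff_Euclidean_space[of "chart_dim a"] unfolding Hausdorff_space_def disjnt_def by metis
      define P Q where "P = {p \<in> chart_dom a. chart_map a p \<in> U}" and "Q = {p \<in> chart_dom a. chart_map a p \<in> V}"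
      have "openin ?T P" "openin ?T Q" unfolding P_def Q_def using openin_chart_preimage[OF ch[OF a(1)]] UV(1,2) by auto
      moreover have "p \<in> P" "q \<in> Q" "P \<inter> Q = {}" unfolding P_def Q_def using a UV(3-5) by auto
      ultimately show ?thesis by blast
    qed
    then show "\<exists>U V. openin ?T U \<and> openin ?T V \<and> p \<in> U \<and> q \<in> V \<and> disjnt U V"
      using sep pq unfolding disjnt_def by blast
  qed
  moreover have "(\<Union>a\<in>A. chart_dom a) = topspace ?T" using dom_subset cover topspace_charted_topology by blast
  ultimately show ?thesis
    unfolding charted_manifold_def by (intro smooth_manifold_maximal_atlas) (auto intro: ch compat)
qed

end

section \<open>Tangent spaces and tangent maps\<close>

lemma charts_at_iff: "c \<in> charts_at M p \<longleftrightarrow> c \<in> atlas M \<and> p \<in> chart_dom c"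
  by (simp add: charts_at_def)

lemma charts_at_nonempty: "smooth_manifold M \<Longrightarrow> p \<in> mpoints M \<Longrightarrow> \<exists>c. c \<in> charts_at M p"
  using smooth_manifold_chart_at[of M p] charts_at_iff by metis

text \<open>The chain rule in charts. With an identity in place of f or g it yields the
  transformation law of tangent vectors and independence of the charts; in general it is the
  functoriality of the tangent map.\<close>

lemma differential_local_rep_compose:
  assumes M: "charted_space M" and N: "charted_space N" and P: "charted_space P"
    and f: "smooth_map M N f" and g: "smooth_map N P g"
    and c: "c \<in> charts_at M p" and d: "d \<in> charts_at N (f p)" and e: "e \<in> charts_at P (g (f p))"
  shows "differential (chart_dim c) (local_rep c e (\<lambda>q. g (f q))) (chart_map c p) w =
    differential (chart_dim d) (local_rep d e g) (chart_map d (f p)) (differential (chart_dim c) (local_rep c d f) (chart_map c p) w)"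
proof -
  have cat: "c \<in> atlas M" "d \<in> atlas N" "e \<in> atlas P" and pt: "p \<in> chart_dom c" "f p \<in> chart_dom d" "g (f p) \<in> chart_dom e"
    using c d e by (auto simp: charts_at_iff)
  note ch = charted_space_is_chart[OF M cat(1)] charted_space_is_chart[OF N cat(2)] charted_space_is_chart[OF P cat(3)]
  note op = ch[THEN is_chart_dom]
  define V where "V = chart_dom d \<inter> g -` chart_dom e"
  define W where "W = chart_dom c \<inter> f -` V"
  have opV: "openin (mtop N) V" unfolding V_def by (rule openin_vimage_chart[OF smooth_map_continuous[OF g] op(2,3)])
  have opW: "openin (mtop M) W" unfolding W_def by (rule openin_vimage_chart[OF smooth_map_continuous[OF f] op(1) opV])
  have sub: "V \<subseteq> chart_dom d" "W \<subseteq> chart_dom c" by (auto simp: V_def W_def)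
  have oU: "openin (Euclidean_space (chart_dim c)) (chart_map c ` W)" by (rule openin_chart_image[OF ch(1) opW sub(2)])
  have oV: "openin (Euclidean_space (chart_dim d)) (chart_map d ` V)" by (rule openin_chart_image[OF ch(2) opV sub(1)])
  have sf: "C_inf (chart_dim c) (chart_map c ` W) (local_rep c d f)"
    using chart_smooth_subset[OF ch(1) openin_vimage_chart[OF smooth_map_continuous[OF f] op(1,2)] Int_lower1 _ smooth_map_chart_smooth[OF f cat(1,2)]]
    by (auto simp: chart_smooth_def W_def V_def)
  have sg: "C_inf (chart_dim d) (chart_map d ` V) (local_rep d e g)"
    using smooth_map_chart_smooth[OF g cat(2,3)] by (simp add: chart_smooth_def V_def)
  have pW: "p \<in> W" using pt by (simp add: W_def V_def)
  have rep: "local_rep c d f (chart_map c q) = chart_map d (f q)" if "q \<in> chart_dom c" for q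
    by (rule local_rep_chart_map[OF ch(1) that])
  have "differential (chart_dim c) (\<lambda>y. local_rep d e g (local_rep c d f y)) (chart_map c p) w =
    differential (chart_dim d) (local_rep d e g) (local_rep c d f (chart_map c p)) (differential (chart_dim c) (local_rep c d f) (chart_map c p) w)"
    by (rule differential_compose[OF oU oV sg sf]) (use pW sub in \<open>auto simp: rep subset_iff W_def\<close>)
  moreover have "differential (chart_dim c) (\<lambda>y. local_rep d e g (local_rep c d f y)) (chart_map c p) w =
      differential (chart_dim c) (local_rep c e (\<lambda>q. g (f q))) (chart_map c p) w"
  proof (rule differential_cong[OF oU])
    fix y assume "y \<in> chart_map c ` W"
    then obtain q where q: "q \<in> W" "y = chart_map c q" by blast
    have "q \<in> chart_dom c" "f q \<in> chart_dom d" using q by (auto simp: W_def V_def)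
    then show "local_rep d e g (local_rep c d f y) = local_rep c e (\<lambda>q. g (f q)) y"
      unfolding q(2) by (simp add: rep local_rep_chart_map[OF ch(1)] local_rep_chart_map[OF ch(2)])
  qed (use pW in auto)
  ultimately show ?thesis using rep[OF pt(1)] by simp
qed

lemma differential_local_rep_rvec:
  assumes M: "charted_space M" and N: "charted_space N" and f: "smooth_map M N f"
    and c: "c \<in> charts_at M p" and d: "d \<in> charts_at N (f p)"
  shows "differential (chart_dim c) (local_rep c d f) (chart_map c p) w \<in> rvec (chart_dim d)"
proof -
  have cat: "c \<in> atlas M" "d \<in> atlas N" and pt: "p \<in> chart_dom c" "f p \<in> chart_dom d"
    using c d by (auto simp: charts_at_iff)
  note ch = charted_space_is_chart[OF M cat(1)] charted_space_is_chart[OF N cat(2)]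
  note op = openin_vimage_chart[OF smooth_map_continuous[OF f] ch[THEN is_chart_dom]]
  show ?thesis
  proof (rule differential_rvec[OF openin_chart_image[OF ch(1) op Int_lower1]])
    fix y assume "y \<in> chart_map c ` (chart_dom c \<inter> f -` chart_dom d)"
    then obtain q where q: "q \<in> chart_dom c" "f q \<in> chart_dom d" "y = chart_map c q" by blast
    show "local_rep c d f y \<in> rvec (chart_dim d)"
      unfolding q(3) local_rep_chart_map[OF ch(1) q(1)] by (rule is_chart_rvec[OF ch(2) q(2)])
  qed (use pt in auto)
qed

lemma differential_local_rep_cong:
  assumes M: "charted_space M" and c: "c \<in> charts_at M p" and eq: "\<And>q. q \<in> chart_dom c \<Longrightarrow> f q = g q"
  shows "differential (chart_dim c) (local_rep c d f) (chart_map c p) w = differential (chart_dim c) (local_rep c d g) (chart_map c p) w"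
proof -
  note c' = c[unfolded charts_at_iff]
  note ch = charted_space_is_chart[OF M conjunct1[OF c']]
  show ?thesis
  proof (rule differential_cong[OF openin_chart_image[OF ch is_chart_dom[OF ch] subset_refl]])
    fix y assume "y \<in> chart_map c ` chart_dom c"
    then obtain q where q: "q \<in> chart_dom c" "y = chart_map c q" by blast
    show "local_rep c d f y = local_rep c d g y"
      unfolding q(2) local_rep_chart_map[OF ch q(1)] using eq[OF q(1)] by simp
  qed (use c' in auto)
qed

lemma differential_local_rep_id:
  assumes M: "charted_space M" and c: "c \<in> charts_at M p" and w: "w \<in> rvec (chart_dim c)"
  shows "differential (chart_dim c) (local_rep c c (\<lambda>q. q)) (chart_map c p) w = w"
proof -
  note c' = c[unfolded charts_at_iff]
  note ch = charted_space_is_chart[OF M conjunct1[OF c']]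
  have "differential (chart_dim c) (local_rep c c (\<lambda>q. q)) (chart_map c p) w = differential (chart_dim c) (\<lambda>y. y) (chart_map c p) w"
  proof (rule differential_cong[OF openin_chart_image[OF ch is_chart_dom[OF ch] subset_refl]])
    fix y assume "y \<in> chart_map c ` chart_dom c"
    then obtain q where q: "q \<in> chart_dom c" "y = chart_map c q" by blast
    show "local_rep c c (\<lambda>q. q) y = y" unfolding q(2) local_rep_chart_map[OF ch q(1)] ..
  qed (use c' in auto)
  then show ?thesis using differential_id[OF w] by simp
qed

lemma tangent_space_rvec: "v \<in> tangent_space M p \<Longrightarrow> c \<in> charts_at M p \<Longrightarrow> v c \<in> rvec (chart_dim c)"
  unfolding tangent_space_def by blast

lemma tangent_space_change:
  "v \<in> tangent_space M p \<Longrightarrow> c \<in> charts_at M p \<Longrightarrow> d \<in> charts_at M p \<Longrightarrow>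
    v d = differential (chart_dim c) (local_rep c d (\<lambda>q. q)) (chart_map c p) (v c)"
  unfolding tangent_space_def by blast

lemma tangent_space_outside: "v \<in> tangent_space M p \<Longrightarrow> c \<notin> charts_at M p \<Longrightarrow> v c = (\<lambda>i. 0)"
  unfolding tangent_space_def by blast

lemma tangent_space_eqI:
  assumes "v \<in> tangent_space M p" "w \<in> tangent_space M p" "c \<in> charts_at M p" "v c = w c"
  shows "v = w"
proof
  fix d
  show "v d = w d"
  proof (cases "d \<in> charts_at M p")
    case True
    then show ?thesis using tangent_space_change[OF assms(1,3) True] tangent_space_change[OF assms(2,3) True] assms(4) by simp
  next
    case False
    then show ?thesis using tangent_space_outside[OF assms(1)] tangent_space_outside[OF assms(2)] by simp
  qed
qed

definition tangent_vec :: "'a manifold \<Rightarrow> 'a \<Rightarrow> 'a chart \<Rightarrow> (nat \<Rightarrow> real) \<Rightarrow> 'a tvec" where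
  "tangent_vec M p c w = (\<lambda>d. if d \<in> charts_at M p
     then differential (chart_dim c) (local_rep c d (\<lambda>q. q)) (chart_map c p) w else (\<lambda>i. 0))"

text \<open>The family generated by the coordinates w in one chart obeys the transformation law, by
  the chain rule for changes of charts. So the coordinates of tangent vectors in a given chart fill
  the whole Euclidean space.\<close>

lemma tangent_vec:
  assumes M: "smooth_manifold M" and c: "c \<in> charts_at M p" and w: "w \<in> rvec (chart_dim c)"
  shows "tangent_vec M p c w \<in> tangent_space M p" "tangent_vec M p c w c = w"
proof -
  note MC = smooth_manifold_charted_space[OF M] and I = smooth_map_id[OF M]
  show "tangent_vec M p c w c = w"
    using c differential_local_rep_id[OF MC c w] by (simp add: tangent_vec_def)
  show "tangent_vec M p c w \<in> tangent_space M p"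
    unfolding tangent_space_def
  proof (intro CollectI conjI ballI allI impI)
    fix d assume d: "d \<in> charts_at M p"
    show "tangent_vec M p c w d \<in> rvec (chart_dim d)"
      using d differential_local_rep_rvec[OF MC MC I c d, of w] by (simp add: tangent_vec_def)
    fix e assume e: "e \<in> charts_at M p"
    show "tangent_vec M p c w e = differential (chart_dim d) (local_rep d e (\<lambda>q. q)) (chart_map d p) (tangent_vec M p c w d)"
      using d e by (simp only: tangent_vec_def if_True differential_local_rep_compose[OF MC MC MC I I c d e])
  next
    fix d assume "d \<notin> charts_at M p"
    then show "tangent_vec M p c w d = (\<lambda>i. 0)" by (simp add: tangent_vec_def)
  qed
qed

lemma tangent_space_tzero: "tzero \<in> tangent_space M p"
  by (simp add: tangent_space_def tzero_def differential_def mem_rvec)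

lemma tangent_space_tadd:
  assumes v: "v \<in> tangent_space M p" and w: "w \<in> tangent_space M p"
  shows "tadd v w \<in> tangent_space M p"
  unfolding tangent_space_def
proof (intro CollectI conjI ballI allI impI)
  fix c assume c: "c \<in> charts_at M p"
  show "tadd v w c \<in> rvec (chart_dim c)"
    using tangent_space_rvec[OF v c] tangent_space_rvec[OF w c] by (simp add: tadd_def mem_rvec)
  fix d assume d: "d \<in> charts_at M p"
  show "tadd v w d = differential (chart_dim c) (local_rep c d (\<lambda>q. q)) (chart_map c p) (tadd v w c)"
    unfolding tadd_def differential_add tangent_space_change[OF v c d] tangent_space_change[OF w c d] ..
next
  fix c assume "c \<notin> charts_at M p"
  then show "tadd v w c = (\<lambda>i. 0)"
    using tangent_space_outside[OF v] tangent_space_outside[OF w] by (simp add: tadd_def)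
qed

lemma tangent_space_tscale:
  assumes v: "v \<in> tangent_space M p"
  shows "tscale r v \<in> tangent_space M p"
  unfolding tangent_space_def
proof (intro CollectI conjI ballI allI impI)
  fix c assume c: "c \<in> charts_at M p"
  show "tscale r v c \<in> rvec (chart_dim c)"
    using tangent_space_rvec[OF v c] by (simp add: tscale_def mem_rvec)
  fix d assume d: "d \<in> charts_at M p"
  show "tscale r v d = differential (chart_dim c) (local_rep c d (\<lambda>q. q)) (chart_map c p) (tscale r v c)"
    unfolding tscale_def differential_scale tangent_space_change[OF v c d] ..
next
  fix c assume "c \<notin> charts_at M p"
  then show "tscale r v c = (\<lambda>i. 0)"
    using tangent_space_outside[OF v] by (simp add: tscale_def)
qed

text \<open>\<open>tangent_map\<close> picks a chart at p by choice. The transformation law of v and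
  the chain rule show that every other chart gives the same value; tangent maps are computed through
  this from here on.\<close>

lemma tangent_map_eq:
  assumes M: "smooth_manifold M" and N: "smooth_manifold N" and f: "smooth_map M N f" and p: "p \<in> mpoints M"
    and v: "v \<in> tangent_space M p" and c: "c \<in> charts_at M p" and d: "d \<in> charts_at N (f p)"
  shows "tangent_map M N f p v d = differential (chart_dim c) (local_rep c d f) (chart_map c p) (v c)"
proof -
  note MC = smooth_manifold_charted_space[OF M] and NC = smooth_manifold_charted_space[OF N]
  define e where "e = (SOME c. c \<in> charts_at M p)"
  have e: "e \<in> charts_at M p" unfolding e_def using c by (rule someI)
  have "tangent_map M N f p v d = differential (chart_dim e) (local_rep e d f) (chart_map e p) (v e)"
    using d by (simp add: tangent_map_def e_def Let_def)
  also have "\<dots> = differential (chart_dim c) (local_rep c d f) (chart_map c p) (v c)"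
    using differential_local_rep_compose[OF MC MC NC smooth_map_id[OF M] f e c d, of "v e"] tangent_space_change[OF v e c] by simp
  finally show ?thesis .
qed

lemma tangent_map_outside: "d \<notin> charts_at N (f p) \<Longrightarrow> tangent_map M N f p v d = (\<lambda>i. 0)"
  by (simp add: tangent_map_def)

lemma tangent_map_mem:
  assumes M: "smooth_manifold M" and N: "smooth_manifold N" and f: "smooth_map M N f" and p: "p \<in> mpoints M"
    and v: "v \<in> tangent_space M p"
  shows "tangent_map M N f p v \<in> tangent_space N (f p)"
proof -
  note MC = smooth_manifold_charted_space[OF M] and NC = smooth_manifold_charted_space[OF N]
  obtain c where c: "c \<in> charts_at M p" using charts_at_nonempty[OF M p] by blast
  note eq = tangent_map_eq[OF M N f p v c]
  show ?thesis
    unfolding tangent_space_def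
  proof (intro CollectI conjI ballI allI impI)
    fix d assume d: "d \<in> charts_at N (f p)"
    show "tangent_map M N f p v d \<in> rvec (chart_dim d)"
      unfolding eq[OF d] by (rule differential_local_rep_rvec[OF MC NC f c d])
    fix e assume e: "e \<in> charts_at N (f p)"
    show "tangent_map M N f p v e = differential (chart_dim d) (local_rep d e (\<lambda>q. q)) (chart_map d (f p)) (tangent_map M N f p v d)"
      unfolding eq[OF d] eq[OF e] by (rule differential_local_rep_compose[OF MC NC NC f smooth_map_id[OF N] c d e])
  next
    fix d assume "d \<notin> charts_at N (f p)"
    then show "tangent_map M N f p v d = (\<lambda>i. 0)" by (rule tangent_map_outside)
  qed
qed

lemma tangent_map_compose:
  assumes M: "smooth_manifold M" and N: "smooth_manifold N" and P: "smooth_manifold P"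
    and f: "smooth_map M N f" and g: "smooth_map N P g" and p: "p \<in> mpoints M"
    and v: "v \<in> tangent_space M p"
  shows "tangent_map M P (\<lambda>q. g (f q)) p v = tangent_map N P g (f p) (tangent_map M N f p v)"
proof
  fix e
  note MC = smooth_manifold_charted_space[OF M] and NC = smooth_manifold_charted_space[OF N] and PC = smooth_manifold_charted_space[OF P]
  have fp: "f p \<in> mpoints N" by (rule smooth_map_points[OF f p])
  obtain c where c: "c \<in> charts_at M p" using charts_at_nonempty[OF M p] by blast
  obtain d where d: "d \<in> charts_at N (f p)" using charts_at_nonempty[OF N fp] by blast
  show "tangent_map M P (\<lambda>q. g (f q)) p v e = tangent_map N P g (f p) (tangent_map M N f p v) e"
  proof (cases "e \<in> charts_at P (g (f p))")
    case True
    have "tangent_map M P (\<lambda>q. g (f q)) p v e = differential (chart_dim c) (local_rep c e (\<lambda>q. g (f q))) (chart_map c p) (v c)"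
      by (rule tangent_map_eq[OF M P smooth_map_compose[OF M N P f g] p v c True])
    also have "\<dots> = differential (chart_dim d) (local_rep d e g) (chart_map d (f p)) (tangent_map M N f p v d)"
      unfolding tangent_map_eq[OF M N f p v c d] by (rule differential_local_rep_compose[OF MC NC PC f g c d True])
    also have "\<dots> = tangent_map N P g (f p) (tangent_map M N f p v) e"
      by (rule tangent_map_eq[OF N P g fp tangent_map_mem[OF M N f p v] d True, symmetric])
    finally show ?thesis .
  next
    case False
    have "tangent_map M P (\<lambda>q. g (f q)) p v e = (\<lambda>i. 0)" by (rule tangent_map_outside) (rule False)
    moreover have "tangent_map N P g (f p) (tangent_map M N f p v) e = (\<lambda>i. 0)" by (rule tangent_map_outside) (rule False)
    ultimately show ?thesis by (rule trans[OF _ sym])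
  qed
qed

text \<open>Functions are total, and f and g may differ off the points of M. A local representative
  inverts a chart of M, so only values on M enter. Simplicial identities and normalised composites
  are applied through this.\<close>

lemma tangent_map_cong:
  assumes M: "smooth_manifold M" and p: "p \<in> mpoints M" and eq: "\<And>q. q \<in> mpoints M \<Longrightarrow> f q = g q"
  shows "tangent_map M N f p v = tangent_map M N g p v"
proof -
  note MC = smooth_manifold_charted_space[OF M]
  define e where "e = (SOME c. c \<in> charts_at M p)"
  have e: "e \<in> charts_at M p" unfolding e_def using charts_at_nonempty[OF M p] by (rule someI_ex)
  then have "is_chart (mtop M) e" using charted_space_is_chart[OF MC] charts_at_iff by metis
  then have "chart_dom e \<subseteq> mpoints M" using is_chart_dom openin_subset by metis
  then have "f q = g q" if "q \<in> chart_dom e" for q using eq that by blast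
  note dd = differential_local_rep_cong[OF MC e this]
  show ?thesis
    by (simp only: tangent_map_def Let_def eq[OF p] e_def[symmetric] dd)
qed

lemma tangent_map_id:
  assumes M: "smooth_manifold M" and p: "p \<in> mpoints M" and v: "v \<in> tangent_space M p"
  shows "tangent_map M M (\<lambda>q. q) p v = v"
proof
  fix d
  obtain c where c: "c \<in> charts_at M p" using charts_at_nonempty[OF M p] by blast
  show "tangent_map M M (\<lambda>q. q) p v d = v d"
  proof (cases "d \<in> charts_at M p")
    case True
    show ?thesis unfolding tangent_space_change[OF v c True] by (rule tangent_map_eq[OF M M smooth_map_id[OF M] p v c True])
  next
    case False
    have "tangent_map M M (\<lambda>q. q) p v d = (\<lambda>i. 0)" by (rule tangent_map_outside) (rule False)
    then show ?thesis unfolding tangent_space_outside[OF v False] .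
  qed
qed

lemma tangent_map_tadd: "tangent_map M N f p (tadd v w) = tadd (tangent_map M N f p v) (tangent_map M N f p w)"
  by (auto simp: tangent_map_def tadd_def Let_def differential_add fun_eq_iff)

lemma tangent_map_tscale: "tangent_map M N f p (tscale r v) = tscale r (tangent_map M N f p v)"
  by (auto simp: tangent_map_def tscale_def Let_def differential_scale fun_eq_iff)

lemma tangent_map_tzero: "tangent_map M N f p tzero = tzero"
  by (auto simp: tangent_map_def tzero_def Let_def differential_def fun_eq_iff)


section \<open>The pullback of a tangent bundle along a smooth map\<close>

definition first_coords :: "nat \<Rightarrow> (nat \<Rightarrow> real) \<Rightarrow> nat \<Rightarrow> real" where
  "first_coords n z = (\<lambda>i. if i < n then z i else 0)"

definition last_coords :: "nat \<Rightarrow> (nat \<Rightarrow> real) \<Rightarrow> nat \<Rightarrow> real" where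
  "last_coords n z = (\<lambda>i. z (n + i))"

text \<open>Corresponds to U x R^m under the splitting of R^(n+m) into the first n and the last m
  coordinates.\<close>

definition cylinder :: "nat \<Rightarrow> nat \<Rightarrow> (nat \<Rightarrow> real) set \<Rightarrow> (nat \<Rightarrow> real) set" where
  "cylinder n m U = {z \<in> rvec (n + m). first_coords n z \<in> U}"

lemma first_coords_append: "x \<in> rvec n \<Longrightarrow> first_coords n (append_coords n x y) = x"
  by (auto simp: first_coords_def append_coords_def mem_rvec fun_eq_iff)

lemma last_coords_append: "last_coords n (append_coords n x y) = y"
  by (auto simp: last_coords_def append_coords_def)

lemma append_first_last: "append_coords n (first_coords n z) (last_coords n z) = z"
  by (auto simp: first_coords_def last_coords_def append_coords_def fun_eq_iff)

lemma append_coords_rvec: "y \<in> rvec m \<Longrightarrow> append_coords n x y \<in> rvec (n + m)"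
  by (auto simp: append_coords_def mem_rvec)

lemma last_coords_rvec: "z \<in> rvec (n + m) \<Longrightarrow> last_coords n z \<in> rvec m"
  by (auto simp: last_coords_def mem_rvec)

lemma first_coords_rvec: "first_coords n z \<in> rvec n"
  by (auto simp: first_coords_def mem_rvec)

lemma append_coords_eq_iff:
  "x \<in> rvec n \<Longrightarrow> x' \<in> rvec n \<Longrightarrow> append_coords n x y = append_coords n x' y' \<longleftrightarrow> x = x' \<and> y = y'"
  by (metis first_coords_append last_coords_append)

lemma openin_rvec: "openin (Euclidean_space k) (rvec k)"
  by (rule openin_topspace)

lemma openin_cylinder:
  assumes "openin (Euclidean_space n) U"
  shows "openin (Euclidean_space (n + m)) (cylinder n m U)"
  unfolding cylinder_def
proof (rule openin_preimage_rvec[OF openin_rvec assms])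
  show "continuous_on (rvec (n + m)) (\<lambda>x. first_coords n x i)" if "i < n" for i
    using that continuous_on_product_then_coordinatewise[OF continuous_on_id] by (simp add: first_coords_def)
qed (rule first_coords_rvec)

lemma smooth_on_first_coords:
  assumes U: "openin (Euclidean_space n) U" and g: "smooth_on n U g"
  shows "smooth_on (n + m) (cylinder n m U) (\<lambda>z. g (first_coords n z))"
proof (rule smooth_on_compose[OF openin_cylinder[OF U] U g])
  show "smooth_on (n + m) (cylinder n m U) (\<lambda>z. first_coords n z i)" if "i < n" for i
    using that smooth_on_coord[OF openin_cylinder[OF U], of m i] by (simp add: first_coords_def)
qed (simp add: cylinder_def)

lemma tangent_along_chart_sel:
  "chart_dim (tangent_along_chart M N f c d) = chart_dim c + chart_dim d"
  "chart_dom (tangent_along_chart M N f c d) = {e \<in> tangent_along_points M N f. fst e \<in> chart_dom c \<inter> f -` chart_dom d}"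
  by (auto simp: tangent_along_chart_def Let_def)

lemma tangent_along_chart_map:
  "e \<in> chart_dom (tangent_along_chart M N f c d) \<Longrightarrow>
    chart_map (tangent_along_chart M N f c d) e = append_coords (chart_dim c) (chart_map c (fst e)) (snd e d)"
  by (auto simp: tangent_along_chart_def Let_def)

lemma tangent_along_points_iff:
  "e \<in> tangent_along_points M N f \<longleftrightarrow> fst e \<in> mpoints M \<and> snd e \<in> tangent_space N (f (fst e))"
  by (cases e) (simp add: tangent_along_points_def)

locale tangent_along_map =
  fixes M :: "'a manifold" and N :: "'b manifold" and f :: "'a \<Rightarrow> 'b"
  assumes M: "smooth_manifold M" and N: "smooth_manifold N" and f: "smooth_map M N f"
begin

abbreviation "P \<equiv> tangent_along_points M N f"
abbreviation "tchart \<equiv> tangent_along_chart M N f"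

lemma MC: "charted_space M" and NC: "charted_space N"
  using smooth_manifold_charted_space M N by blast+

lemma openin_chart_pair:
  assumes "c \<in> atlas M" "d \<in> atlas N"
  shows "openin (mtop M) (chart_dom c \<inter> f -` chart_dom d)"
  by (rule openin_vimage_chart[OF smooth_map_continuous[OF f] is_chart_dom[OF charted_space_is_chart[OF MC assms(1)]]
    is_chart_dom[OF charted_space_is_chart[OF NC assms(2)]]])

text \<open>Every point of the cylinder is hit because \<open>tangent_vec\<close> realises each
  coordinate vector by a tangent vector. Openness of overlaps and the bundle chart property both
  follow from this image.\<close>

lemma tchart_image:
  assumes c: "c \<in> atlas M" and d: "d \<in> atlas N" and W: "W \<subseteq> chart_dom c \<inter> f -` chart_dom d"
  shows "chart_map (tchart c d) ` {e \<in> P. fst e \<in> W} = cylinder (chart_dim c) (chart_dim d) (chart_map c ` W)"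
proof (intro equalityI subsetI)
  note chc = charted_space_is_chart[OF MC c] and chd = charted_space_is_chart[OF NC d]
  fix z assume "z \<in> chart_map (tchart c d) ` {e \<in> P. fst e \<in> W}"
  then obtain e where e: "e \<in> P" "fst e \<in> W" "z = chart_map (tchart c d) e" by blast
  then have x: "fst e \<in> chart_dom c" "f (fst e) \<in> chart_dom d" using W by auto
  have z: "z = append_coords (chart_dim c) (chart_map c (fst e)) (snd e d)"
    using e x by (simp add: tangent_along_chart_map tangent_along_chart_sel)
  have "snd e d \<in> rvec (chart_dim d)"
    by (rule tangent_space_rvec[of _ N "f (fst e)"]) (use e(1) d x(2) in \<open>auto simp: tangent_along_points_iff charts_at_iff\<close>)
  then show "z \<in> cylinder (chart_dim c) (chart_dim d) (chart_map c ` W)"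
    unfolding cylinder_def z using append_coords_rvec first_coords_append[OF is_chart_rvec[OF chc x(1)]] e(2) by auto
next
  note chc = charted_space_is_chart[OF MC c] and chd = charted_space_is_chart[OF NC d]
  fix z assume z: "z \<in> cylinder (chart_dim c) (chart_dim d) (chart_map c ` W)"
  then obtain x where x: "x \<in> W" "first_coords (chart_dim c) z = chart_map c x" by (auto simp: cylinder_def)
  then have xd: "x \<in> chart_dom c" "f x \<in> chart_dom d" using W by auto
  then have xM: "x \<in> mpoints M" using openin_subset[OF is_chart_dom[OF chc]] by blast
  define w where "w = last_coords (chart_dim c) z"
  have w: "w \<in> rvec (chart_dim d)" using z last_coords_rvec by (auto simp: w_def cylinder_def)
  have dat: "d \<in> charts_at N (f x)" using d xd by (simp add: charts_at_iff)
  let ?e = "(x, tangent_vec N (f x) d w)"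
  have eP: "?e \<in> P" using xM tangent_vec(1)[OF N dat w] by (simp add: tangent_along_points_def)
  have "chart_map (tchart c d) ?e = z"
    using eP xd tangent_vec(2)[OF N dat w] append_first_last[of "chart_dim c" z] x(2)
    by (simp add: tangent_along_chart_map tangent_along_chart_sel w_def)
  then show "z \<in> chart_map (tchart c d) ` {e \<in> P. fst e \<in> W}" using eP x(1) by force
qed

lemma tchart_inj:
  assumes c: "c \<in> atlas M" and d: "d \<in> atlas N"
  shows "inj_on (chart_map (tchart c d)) (chart_dom (tchart c d))"
proof (rule inj_onI)
  note chc = charted_space_is_chart[OF MC c]
  fix e e' assume e: "e \<in> chart_dom (tchart c d)" "e' \<in> chart_dom (tchart c d)" "chart_map (tchart c d) e = chart_map (tchart c d) e'"
  then have x: "fst e \<in> chart_dom c" "fst e' \<in> chart_dom c" "f (fst e) \<in> chart_dom d" "f (fst e') \<in> chart_dom d" "e \<in> P" "e' \<in> P"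
    by (auto simp: tangent_along_chart_sel)
  have "chart_map c (fst e) = chart_map c (fst e')" "snd e d = snd e' d"
    using e append_coords_eq_iff[OF is_chart_rvec[OF chc x(1)] is_chart_rvec[OF chc x(2)]] by (auto simp: tangent_along_chart_map)
  then have "fst e = fst e'" using inj_onD[OF is_chart_inj[OF chc]] x by blast
  moreover have "snd e = snd e'"
    by (rule tangent_space_eqI[of _ N "f (fst e)" _ d])
      (use x d \<open>fst e = fst e'\<close> \<open>snd e d = snd e' d\<close> in \<open>auto simp: tangent_along_points_iff charts_at_iff\<close>)
  ultimately show "e = e'" by (rule prod_eqI)
qed

lemma local_rep_tchart:
  assumes "c \<in> atlas M" "d \<in> atlas N" "e \<in> chart_dom (tchart c d)"
  shows "local_rep (tchart c d) b G (chart_map (tchart c d) e) = chart_map b (G e)"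
  using inv_into_f_f[OF tchart_inj[OF assms(1,2)] assms(3)] by (simp add: local_rep_def)

end

text \<open>When H after f equals f' after h, the tangent map of H covers h between the pulled back
  tangent bundles. The scalar r admits the sign of a differential. Instances are the identity square
  for changes of bundle charts, a last face over the identity of X_0, and one level of a simplicial
  morphism.\<close>

locale tangent_along_square = S: tangent_along_map M N f + S': tangent_along_map M' N' f'
  for M :: "'a manifold" and N :: "'b manifold" and f and M' :: "'c manifold" and N' :: "'d manifold" and f' +
  fixes h :: "'a \<Rightarrow> 'c" and H :: "'b \<Rightarrow> 'd" and r :: real
  assumes h: "smooth_map M M' h" and H: "smooth_map N N' H" and square: "\<And>x. x \<in> mpoints M \<Longrightarrow> H (f x) = f' (h x)"
begin

definition bmap :: "'a \<times> 'b tvec \<Rightarrow> 'c \<times> 'd tvec" where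
  "bmap e = (h (fst e), tscale r (tangent_map N N' H (f (fst e)) (snd e)))"

lemma bmap_points: "e \<in> S.P \<Longrightarrow> bmap e \<in> S'.P"
  using tangent_map_mem[OF S.N S'.N H smooth_map_points[OF S.f], of "fst e" "snd e"] smooth_map_points[OF h, of "fst e"]
    square[of "fst e"] by (auto simp: tangent_along_points_iff bmap_def tangent_space_tscale)

lemma openin_base_dom:
  assumes "c \<in> atlas M" "d \<in> atlas N" "c' \<in> atlas M'" "d' \<in> atlas N'"
  shows "openin (mtop M) (chart_dom c \<inter> h -` chart_dom c' \<inter> f -` (chart_dom d \<inter> H -` chart_dom d'))"
proof -
  note ch = charted_space_is_chart[OF S.MC assms(1)] charted_space_is_chart[OF S.NC assms(2)]
     charted_space_is_chart[OF S'.MC assms(3)] charted_space_is_chart[OF S'.NC assms(4)]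
  note op = ch[THEN is_chart_dom]
  show ?thesis
    by (intro openin_vimage_chart[OF smooth_map_continuous[OF S.f]] openin_vimage_chart[OF smooth_map_continuous[OF h]]
       openin_vimage_chart[OF smooth_map_continuous[OF H]] op)
qed

lemma bmap_chart_smooth:
  assumes c: "c \<in> atlas M" and d: "d \<in> atlas N" and c': "c' \<in> atlas M'" and d': "d' \<in> atlas N'"
  defines "W \<equiv> chart_dom c \<inter> h -` chart_dom c' \<inter> f -` (chart_dom d \<inter> H -` chart_dom d')"
  shows "chart_smooth (S.tchart c d) (S'.tchart c' d') bmap {e \<in> S.P. fst e \<in> W}"
proof -
  note ch = charted_space_is_chart[OF S.MC c] charted_space_is_chart[OF S.NC d]
     charted_space_is_chart[OF S'.MC c'] charted_space_is_chart[OF S'.NC d']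
  note op = ch[THEN is_chart_dom]
  let ?n = "chart_dim c" and ?m = "chart_dim d" and ?n' = "chart_dim c'" and ?m' = "chart_dim d'"
  have Wsub: "W \<subseteq> chart_dom c \<inter> h -` chart_dom c'" "W \<subseteq> chart_dom c \<inter> f -` chart_dom d" by (auto simp: W_def)
  define U where "U = chart_map c ` W"
  define V where "V = chart_map d ` (chart_dom d \<inter> H -` chart_dom d')"
  have opW: "openin (mtop M) W" unfolding W_def by (rule openin_base_dom[OF c d c' d'])
  have opU: "openin (Euclidean_space ?n) U" unfolding U_def
    by (rule openin_chart_image[OF ch(1) opW]) (auto simp: W_def)
  have opV: "openin (Euclidean_space ?m) V" unfolding V_def
    by (rule openin_chart_image[OF ch(2) openin_vimage_chart[OF smooth_map_continuous[OF H] op(2,4)]]) auto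
  note opC = openin_cylinder[OF opU, of ?m]
  have im: "chart_map (S.tchart c d) ` {e \<in> S.P. fst e \<in> W} = cylinder ?n ?m U"
    unfolding U_def by (rule S.tchart_image[OF c d]) (auto simp: W_def)
  \<comment> \<open>The expected local representative: base coordinates transform by h, and fibre
    coordinates linearly by r times the Jacobian of H at the image under f of the base
    point.\<close>
  define R where "R z = append_coords ?n' (local_rep c c' h (first_coords ?n z))
     (\<lambda>i. r * differential ?m (local_rep d d' H) (local_rep c d f (first_coords ?n z)) (last_coords ?n z) i)" for z
  have "smooth_on (?n + ?m) (cylinder ?n ?m U) (\<lambda>z. R z i)" for i
  proof (cases "i < ?n'")
    case True
    have "smooth_on ?n U (\<lambda>y. local_rep c c' h y i)"
      using chart_smooth_subset[OF ch(1) openin_vimage_chart[OF smooth_map_continuous[OF h] op(1,3)] Int_lower1 Wsub(1) smooth_map_chart_smooth[OF h c c']]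
      by (simp add: chart_smooth_def C_inf_iff U_def)
    from smooth_on_first_coords[OF opU this, of ?m] show ?thesis using True by (simp add: R_def append_coords_def)
  next
    case False
    have sf: "smooth_on ?n U (\<lambda>y. local_rep c d f y l)" for l
      using chart_smooth_subset[OF ch(1) openin_vimage_chart[OF smooth_map_continuous[OF S.f] op(1,2)] Int_lower1 Wsub(2) smooth_map_chart_smooth[OF S.f c d]]
      by (simp add: chart_smooth_def C_inf_iff U_def)
    have fV: "local_rep c d f y \<in> V" if "y \<in> U" for y
      using that by (auto simp: U_def V_def W_def local_rep_chart_map[OF ch(1)])
    have sH: "smooth_on ?m V (partial_deriv j (\<lambda>y. local_rep d d' H y l))" if "j < ?m" for j l
      using smooth_map_chart_smooth[OF H d d'] by (intro smooth_on_partial_deriv[OF _ that]) (simp add: chart_smooth_def C_inf_iff V_def)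
    have "smooth_on ?n U (\<lambda>y. partial_deriv j (\<lambda>y. local_rep d d' H y l) (local_rep c d f y))" if "j < ?m" for j l
      by (rule smooth_on_compose[OF opU opV sH[OF that] sf fV])
    from smooth_on_first_coords[OF opU this, of _ ?m]
    have 1: "smooth_on (?n + ?m) (cylinder ?n ?m U) (\<lambda>z. partial_deriv j (\<lambda>y. local_rep d d' H y l) (local_rep c d f (first_coords ?n z)))"
      if "j < ?m" for j l using that by blast
    have "smooth_on (?n + ?m) (cylinder ?n ?m U) (\<lambda>z. r * (\<Sum>j<?m. partial_deriv j (\<lambda>y. local_rep d d' H y (i - ?n')) (local_rep c d f (first_coords ?n z)) * z (?n + j)))"
      by (intro smooth_on_mult[OF opC] smooth_on_const[OF opC] smooth_on_sum[OF opC] smooth_on_coord[OF opC] 1) simp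
    then show ?thesis using False by (simp add: R_def append_coords_def differential_def last_coords_def)
  qed
  moreover have "R z = local_rep (S.tchart c d) (S'.tchart c' d') bmap z" if z: "z \<in> cylinder ?n ?m U" for z
  proof -
    obtain e where e: "e \<in> S.P" "fst e \<in> W" "z = chart_map (S.tchart c d) e" using z im by blast
    have ed: "e \<in> chart_dom (S.tchart c d)" using e by (auto simp: tangent_along_chart_sel W_def)
    have x: "fst e \<in> chart_dom c" "f (fst e) \<in> chart_dom d" "h (fst e) \<in> chart_dom c'" "H (f (fst e)) \<in> chart_dom d'" using e by (auto simp: W_def)
    have xM: "fst e \<in> mpoints M" "snd e \<in> tangent_space N (f (fst e))" using e by (auto simp: tangent_along_points_iff)
    have ed': "bmap e \<in> chart_dom (S'.tchart c' d')"
      using bmap_points[OF e(1)] x square[OF xM(1)] by (simp add: tangent_along_chart_sel bmap_def)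
    have z': "z = append_coords ?n (chart_map c (fst e)) (snd e d)" using e(3) tangent_along_chart_map[OF ed] by simp
    have fl: "first_coords ?n z = chart_map c (fst e)" "last_coords ?n z = snd e d"
      unfolding z' by (simp_all add: first_coords_append[OF is_chart_rvec[OF ch(1) x(1)]] last_coords_append)
    have T: "tangent_map N N' H (f (fst e)) (snd e) d' = differential ?m (local_rep d d' H) (chart_map d (f (fst e))) (snd e d)"
      by (rule tangent_map_eq[OF S.N S'.N H smooth_map_points[OF S.f xM(1)] xM(2)]) (use d d' x in \<open>auto simp: charts_at_iff\<close>)
    have "local_rep (S.tchart c d) (S'.tchart c' d') bmap z = chart_map (S'.tchart c' d') (bmap e)"
      unfolding e(3) by (rule S.local_rep_tchart[OF c d ed])
    also have "\<dots> = append_coords ?n' (chart_map c' (h (fst e))) (\<lambda>i. r * differential ?m (local_rep d d' H) (chart_map d (f (fst e))) (snd e d) i)"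
      unfolding tangent_along_chart_map[OF ed'] by (simp add: bmap_def tscale_def T)
    also have "\<dots> = R z" by (simp add: R_def fl local_rep_chart_map[OF ch(1) x(1)])
    finally show ?thesis by simp
  qed
  ultimately show ?thesis
    unfolding chart_smooth_def C_inf_iff im tangent_along_chart_sel(1)
    using smooth_on_cong[OF opC, of "\<lambda>z. R z i" "\<lambda>z. local_rep (S.tchart c d) (S'.tchart c' d') bmap z i" for i] by simp
qed

end

section \<open>The total space of a pulled back tangent bundle as a manifold\<close>

context tangent_along_map
begin

abbreviation "tcharts \<equiv> {tangent_along_chart M N f c d |c d. c \<in> atlas M \<and> d \<in> atlas N}"

lemma tchart_overlap:
  "chart_dom (tchart c d) \<inter> chart_dom (tchart c' d') = {e \<in> P. fst e \<in> chart_dom c \<inter> (\<lambda>x. x) -` chart_dom c' \<inter> f -` (chart_dom d \<inter> (\<lambda>x. x) -` chart_dom d')}"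
  by (auto simp: tangent_along_chart_sel)

text \<open>For the identity square with scalar 1, \<open>bmap\<close> is the identity, so
  \<open>bmap_chart_smooth\<close> describes the changes of bundle charts. That lemma speaks of
  charts alone and is available before the total space has a topology.\<close>

lemma tchart_smooth:
  assumes c: "c \<in> atlas M" "d \<in> atlas N" "c' \<in> atlas M" "d' \<in> atlas N"
  shows "chart_smooth (tchart c d) (tchart c' d') (\<lambda>e. e) (chart_dom (tchart c d) \<inter> chart_dom (tchart c' d'))"
    "openin (Euclidean_space (chart_dim (tchart c d))) (chart_map (tchart c d) ` (chart_dom (tchart c d) \<inter> chart_dom (tchart c' d')))"
proof -
  interpret Q: tangent_along_square M N f M N f "\<lambda>x. x" "\<lambda>x. x" 1
    by unfold_locales (simp_all add: smooth_map_id M N)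
  let ?D = "chart_dom (tchart c d) \<inter> chart_dom (tchart c' d')"
  let ?W = "chart_dom c \<inter> (\<lambda>x. x) -` chart_dom c' \<inter> f -` (chart_dom d \<inter> (\<lambda>x. x) -` chart_dom d')"
  have im: "chart_map (tchart c d) ` ?D = cylinder (chart_dim c) (chart_dim d) (chart_map c ` ?W)"
    unfolding tchart_overlap by (rule tchart_image[OF c(1,2)]) auto
  have "openin (Euclidean_space (chart_dim c)) (chart_map c ` ?W)"
    by (rule openin_chart_image[OF charted_space_is_chart[OF MC c(1)] Q.openin_base_dom[OF c]]) auto
  then show op: "openin (Euclidean_space (chart_dim (tchart c d))) (chart_map (tchart c d) ` ?D)"
    unfolding im tangent_along_chart_sel(1) by (rule openin_cylinder)
  have id: "Q.bmap e = e" if "e \<in> P" for e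
    using that tangent_map_id[OF N smooth_map_points[OF f]]
    by (simp add: Q.bmap_def tangent_along_points_iff tscale_def prod_eq_iff)
  have eq: "local_rep (tchart c d) (tchart c' d') Q.bmap z = local_rep (tchart c d) (tchart c' d') (\<lambda>e. e) z"
    if z: "z \<in> chart_map (tchart c d) ` ?D" for z
  proof -
    obtain e where e: "e \<in> ?D" "z = chart_map (tchart c d) e" using z by blast
    then have "e \<in> chart_dom (tchart c d)" "e \<in> P" by (auto simp: tangent_along_chart_sel)
    then show ?thesis unfolding e(2) by (simp add: local_rep_tchart[OF c(1,2)] id)
  qed
  show "chart_smooth (tchart c d) (tchart c' d') (\<lambda>e. e) ?D"
    using Q.bmap_chart_smooth[OF c, folded tchart_overlap]
      smooth_on_cong[OF op, of "\<lambda>z. local_rep (tchart c d) (tchart c' d') Q.bmap z i" "\<lambda>z. local_rep (tchart c d) (tchart c' d') (\<lambda>e. e) z i" for i] eq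
    unfolding chart_smooth_def C_inf_iff by simp
qed

sublocale tc: chart_family P tcharts
proof
  fix a assume "a \<in> tcharts"
  then obtain c d where a: "a = tchart c d" "c \<in> atlas M" "d \<in> atlas N" by blast
  show "chart_dom a \<subseteq> P" by (auto simp: a tangent_along_chart_sel)
  show "chart_map a \<in> extensional (chart_dom a)" by (simp add: a tangent_along_chart_def Let_def)
  show "inj_on (chart_map a) (chart_dom a)" unfolding a(1) by (rule tchart_inj[OF a(2,3)])
next
  fix a b assume "a \<in> tcharts" "b \<in> tcharts"
  then obtain c d c' d' where a: "a = tchart c d" "c \<in> atlas M" "d \<in> atlas N" and b: "b = tchart c' d'" "c' \<in> atlas M" "d' \<in> atlas N" by blast
  show "openin (Euclidean_space (chart_dim a)) (chart_map a ` (chart_dom a \<inter> chart_dom b))"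
    unfolding a(1) b(1) by (rule tchart_smooth[OF a(2,3) b(2,3)])
  show "compatible a b" unfolding compatible_iff a(1) b(1)
    using tchart_smooth(1)[OF a(2,3) b(2,3)] tchart_smooth(1)[OF b(2,3) a(2,3)] by (simp add: Int_commute)
next
  show "P \<subseteq> (\<Union>a\<in>tcharts. chart_dom a)"
  proof
    fix e assume e: "e \<in> P"
    then have x: "fst e \<in> mpoints M" by (simp add: tangent_along_points_iff)
    obtain c where c: "c \<in> atlas M" "fst e \<in> chart_dom c" using smooth_manifold_chart_at[OF M x] by blast
    obtain d where d: "d \<in> atlas N" "f (fst e) \<in> chart_dom d" using smooth_manifold_chart_at[OF N smooth_map_points[OF f x]] by blast
    have "e \<in> chart_dom (tchart c d)" using e c d by (simp add: tangent_along_chart_sel)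
    then show "e \<in> (\<Union>a\<in>tcharts. chart_dom a)" using c d by blast
  qed
qed

abbreviation "E \<equiv> tangent_along M N f"

lemma E_sel: "total E = charted_manifold P tcharts" "base E = M" "proj E = fst"
  "vadd E = (\<lambda>(x, v) (y, w). (x, tadd v w))" "vzero E = (\<lambda>x. (x, tzero))" "vscale E = (\<lambda>r (x, v). (x, tscale r v))"
  by (simp_all add: tangent_along_def)

lemma E_points: "mpoints (total E) = P"
  by (simp add: E_sel tc.charted_manifold_points)

lemma openin_E_preimage:
  assumes W: "openin (mtop M) W"
  shows "openin (mtop (total E)) {e \<in> P. fst e \<in> W}"
  unfolding E_sel charted_manifold_def manifold.simps tc.openin_charted_topology
proof (intro conjI ballI)
  fix a assume "a \<in> tcharts"
  then obtain c d where a: "a = tchart c d" "c \<in> atlas M" "d \<in> atlas N" by blast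
  let ?W = "W \<inter> (chart_dom c \<inter> f -` chart_dom d)"
  have eq: "{e \<in> P. fst e \<in> W} \<inter> chart_dom (tchart c d) = {e \<in> P. fst e \<in> ?W}"
    by (auto simp: tangent_along_chart_sel)
  have "openin (mtop M) ?W" using W openin_chart_pair[OF a(2,3)] by blast
  then have "openin (Euclidean_space (chart_dim c)) (chart_map c ` ?W)"
    by (rule openin_chart_image[OF charted_space_is_chart[OF MC a(2)]]) auto
  then show "openin (Euclidean_space (chart_dim a)) (chart_map a ` ({e \<in> P. fst e \<in> W} \<inter> chart_dom a))"
    unfolding a(1) eq tchart_image[OF a(2,3) Int_lower2] tangent_along_chart_sel(1) by (rule openin_cylinder)
qed auto

text \<open>Separation: distinct vectors over one point share a bundle chart, and over different
  points the parts of the bundle over disjoint open sets of M separate them. Countability: countable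
  chart covers of M and N provide countably many pairs of charts.\<close>

lemma smooth_manifold_E: "smooth_manifold (total E)"
proof -
  obtain C where C: "C \<subseteq> atlas M" "countable C" "mpoints M = (\<Union>c\<in>C. chart_dom c)" using countable_chart_cover[OF M] .
  obtain D where D: "D \<subseteq> atlas N" "countable D" "mpoints N = (\<Union>d\<in>D. chart_dom d)" using countable_chart_cover[OF N] .
  let ?B = "(\<lambda>(c, d). tchart c d) ` (C \<times> D)"
  show ?thesis
    unfolding E_sel
  proof (rule tc.smooth_charted_manifold[of ?B])
    show "?B \<subseteq> tcharts" using C(1) D(1) by auto
    show "countable ?B" using C(2) D(2) by auto
    show "P \<subseteq> (\<Union>a\<in>?B. chart_dom a)"
    proof
      fix e assume e: "e \<in> P"
      then have "fst e \<in> mpoints M" by (simp add: tangent_along_points_iff)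
      then obtain c d where "c \<in> C" "fst e \<in> chart_dom c" "d \<in> D" "f (fst e) \<in> chart_dom d" using C(3) D(3) smooth_map_points[OF f] by blast
      then show "e \<in> (\<Union>a\<in>?B. chart_dom a)" using e by (auto simp: tangent_along_chart_sel)
    qed
    fix p q assume pq: "p \<in> P" "q \<in> P" "p \<noteq> q"
    have x: "fst p \<in> mpoints M" "fst q \<in> mpoints M" using pq by (simp_all add: tangent_along_points_iff)
    show "(\<exists>a\<in>tcharts. p \<in> chart_dom a \<and> q \<in> chart_dom a) \<or>
       (\<exists>U V. openin (charted_topology P tcharts) U \<and> openin (charted_topology P tcharts) V \<and> p \<in> U \<and> q \<in> V \<and> U \<inter> V = {})"
    proof (cases "fst p = fst q")
      case True
      obtain a where a: "a \<in> tcharts" "p \<in> chart_dom a" using tc.cover pq(1) by blast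
      then have "q \<in> chart_dom a" using True pq by (auto simp: tangent_along_chart_sel)
      then show ?thesis using a by blast
    next
      case False
      then obtain U V where UV: "openin (mtop M) U" "openin (mtop M) V" "fst p \<in> U" "fst q \<in> V" "disjnt U V"
        using M x unfolding smooth_manifold_def Hausdorff_space_def by metis
      define U' V' where "U' = {e \<in> P. fst e \<in> U}" and "V' = {e \<in> P. fst e \<in> V}"
      have "openin (charted_topology P tcharts) U'" "openin (charted_topology P tcharts) V'"
        using openin_E_preimage[OF UV(1)] openin_E_preimage[OF UV(2)] by (simp_all add: E_sel charted_manifold_def U'_def V'_def)
      moreover have "p \<in> U'" "q \<in> V'" "U' \<inter> V' = {}" using pq UV by (auto simp: U'_def V'_def disjnt_def)
      ultimately show ?thesis by blast
    qed
  qed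
qed

lemma tchart_atlas: "c \<in> atlas M \<Longrightarrow> d \<in> atlas N \<Longrightarrow> tchart c d \<in> atlas (total E)"
  using tc.charted_manifold_atlas unfolding E_sel by blast

end

lemma (in tangent_along_square) smooth_map_bmap: "smooth_map (total S.E) (total S'.E) bmap"
proof (rule smooth_mapI)
  show "charted_space (total S.E)" "charted_space (total S'.E)"
    using smooth_manifold_charted_space S.smooth_manifold_E S'.smooth_manifold_E by blast+
  fix e assume "e \<in> mpoints (total S.E)"
  then have e: "e \<in> S.P" using S.E_points by simp
  then have x: "fst e \<in> mpoints M" by (simp add: tangent_along_points_iff)
  obtain c where c: "c \<in> atlas M" "fst e \<in> chart_dom c" using smooth_manifold_chart_at[OF S.M x] by blast
  obtain d where d: "d \<in> atlas N" "f (fst e) \<in> chart_dom d" using smooth_manifold_chart_at[OF S.N smooth_map_points[OF S.f x]] by blast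
  obtain c' where c': "c' \<in> atlas M'" "h (fst e) \<in> chart_dom c'" using smooth_manifold_chart_at[OF S'.M smooth_map_points[OF h x]] by blast
  obtain d' where d': "d' \<in> atlas N'" "H (f (fst e)) \<in> chart_dom d'"
    using smooth_manifold_chart_at[OF S'.N smooth_map_points[OF H smooth_map_points[OF S.f x]]] by blast
  let ?W = "chart_dom c \<inter> h -` chart_dom c' \<inter> f -` (chart_dom d \<inter> H -` chart_dom d')"
  have "openin (mtop (total S.E)) {e \<in> S.P. fst e \<in> ?W}"
    by (rule S.openin_E_preimage[OF openin_base_dom[OF c(1) d(1) c'(1) d'(1)]])
  moreover have "bmap ` {e \<in> S.P. fst e \<in> ?W} \<subseteq> chart_dom (S'.tchart c' d')"
  proof
    fix b assume "b \<in> bmap ` {e \<in> S.P. fst e \<in> ?W}"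
    then obtain a where a: "a \<in> S.P" "fst a \<in> ?W" "b = bmap a" by blast
    then show "b \<in> chart_dom (S'.tchart c' d')"
      using bmap_points[OF a(1)] square[of "fst a"] by (simp add: tangent_along_chart_sel tangent_along_points_iff[of a] bmap_def)
  qed
  ultimately show "\<exists>c\<in>atlas (total S.E). \<exists>d\<in>atlas (total S'.E). \<exists>W. openin (mtop (total S.E)) W \<and> e \<in> W \<and> W \<subseteq> chart_dom c \<and>
      bmap ` W \<subseteq> chart_dom d \<and> chart_smooth c d bmap W"
    using bmap_chart_smooth[OF c(1) d(1) c'(1) d'(1)] e c d c' d' S.tchart_atlas[OF c(1) d(1)] S'.tchart_atlas[OF c'(1) d'(1)]
    by (intro bexI[of _ "S.tchart c d"] bexI[of _ "S'.tchart c' d'"] exI[of _ "{e \<in> S.P. fst e \<in> ?W}"])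
      (auto simp: tangent_along_chart_sel(2))
qed

section \<open>Vector bundles from bundle charts\<close>

lemma is_chart_continuous_map:
  assumes "is_chart T c"
  shows "continuous_map (subtopology T (chart_dom c)) (Euclidean_space (chart_dim c)) (chart_map c)"
proof -
  have "continuous_map (subtopology T (chart_dom c))
     (subtopology (Euclidean_space (chart_dim c)) (chart_map c ` chart_dom c)) (chart_map c)"
    using assms by (intro homeomorphic_imp_continuous_map) (simp add: is_chart_def)
  then show ?thesis unfolding continuous_map_in_subtopology by (rule conjunct1)
qed

lemma continuous_map_rvec:
  assumes "\<And>i. i < k \<Longrightarrow> continuous_map X euclideanreal (\<lambda>x. g x i)" "\<And>x. x \<in> topspace X \<Longrightarrow> g x \<in> rvec k"
  shows "continuous_map X (Euclidean_space k) g"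
proof -
  have "continuous_map X (Euclidean_space k) (\<lambda>x i. if i < k then g x i else 0)"
    using assms(1) continuous_map_componentwise_Euclidean_space[of X k g] by blast
  moreover have "(\<lambda>i. if i < k then g x i else 0) = g x" if "x \<in> topspace X" for x
    using assms(2)[OF that] by (auto simp: mem_rvec)
  ultimately show ?thesis by (rule continuous_map_eq)
qed

lemma continuous_map_rvec_coord:
  assumes "continuous_map X (Euclidean_space k) g"
  shows "continuous_map X euclideanreal (\<lambda>x. g x i)"
proof -
  have "continuous_map (subtopology (Euclidean_space k) (rvec k)) euclideanreal (\<lambda>x. x i)"
    unfolding continuous_map_Euclidean_subset[OF subset_refl]
    by (rule continuous_on_product_then_coordinatewise[OF continuous_on_id])
  then have "continuous_map (Euclidean_space k) euclideanreal (\<lambda>x. x i)" by (simp add: subtopology_topspace)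
  from continuous_map_compose[OF assms this] show ?thesis by (simp add: o_def)
qed

text \<open>Openness of images is checked on rectangles, which a product chart sends to the sets
  \<open>Q U V\<close>: the products U x V written in concatenated coordinates.\<close>

lemma is_chart_product_chart:
  assumes c: "is_chart T c" and d: "is_chart T' d"
  shows "is_chart (prod_topology T T') (product_chart c d)"
proof -
  let ?b = "product_chart c d" and ?n = "chart_dim c" and ?m = "chart_dim d"
  have sel: "chart_dim ?b = ?n + ?m" "chart_dom ?b = chart_dom c \<times> chart_dom d"
    "\<And>x y. x \<in> chart_dom c \<Longrightarrow> y \<in> chart_dom d \<Longrightarrow> chart_map ?b (x, y) = append_coords ?n (chart_map c x) (chart_map d y)"
    by (auto simp: product_chart_def)
  define Q where "Q U V = {z \<in> rvec (?n + ?m). first_coords ?n z \<in> U \<and> last_coords ?n z \<in> V}" for U V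
  have opQ: "openin (Euclidean_space (?n + ?m)) (Q U V)"
    if U: "openin (Euclidean_space ?n) U" and V: "openin (Euclidean_space ?m) V" for U V
  proof -
    have "openin (Euclidean_space (?n + ?m)) {z \<in> rvec (?n + ?m). last_coords ?n z \<in> V}"
      by (rule openin_preimage_rvec[OF openin_rvec V _ last_coords_rvec])
        (auto simp: last_coords_def intro: continuous_on_product_then_coordinatewise[OF continuous_on_id])
    moreover have "Q U V = cylinder ?n ?m U \<inter> {z \<in> rvec (?n + ?m). last_coords ?n z \<in> V}"
      by (auto simp: Q_def cylinder_def)
    ultimately show ?thesis using openin_cylinder[OF U, of ?m] by auto
  qed
  have imQ: "chart_map ?b ` (A \<times> B) = Q (chart_map c ` A) (chart_map d ` B)" if "A \<subseteq> chart_dom c" "B \<subseteq> chart_dom d" for A B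
  proof (intro equalityI subsetI)
    fix z assume "z \<in> chart_map ?b ` (A \<times> B)"
    then obtain x y where xy: "x \<in> A" "y \<in> B" "z = chart_map ?b (x, y)" by blast
    then have d': "x \<in> chart_dom c" "y \<in> chart_dom d" using \<open>A \<subseteq> chart_dom c\<close> \<open>B \<subseteq> chart_dom d\<close> by blast+
    show "z \<in> Q (chart_map c ` A) (chart_map d ` B)"
      unfolding xy(3) sel(3)[OF d'] Q_def using xy(1,2)
      by (simp add: first_coords_append[OF is_chart_rvec[OF c d'(1)]] last_coords_append append_coords_rvec[OF is_chart_rvec[OF d d'(2)]])
  next
    fix z assume "z \<in> Q (chart_map c ` A) (chart_map d ` B)"
    then obtain x y where xy: "x \<in> A" "y \<in> B" "first_coords ?n z = chart_map c x" "last_coords ?n z = chart_map d y"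
      by (auto simp: Q_def)
    then have d': "x \<in> chart_dom c" "y \<in> chart_dom d" using \<open>A \<subseteq> chart_dom c\<close> \<open>B \<subseteq> chart_dom d\<close> by blast+
    have "z = chart_map ?b (x, y)" using append_first_last[of ?n z] xy(3,4) sel(3)[OF d'] by simp
    then show "z \<in> chart_map ?b ` (A \<times> B)" using xy by blast
  qed
  show ?thesis
  proof (rule is_chartI, unfold sel(1,2))
    show opd: "openin (prod_topology T T') (chart_dom c \<times> chart_dom d)"
      using is_chart_dom[OF c] is_chart_dom[OF d] by (simp add: openin_prod_Times_iff)
    show "chart_map ?b \<in> extensional (chart_dom c \<times> chart_dom d)" by (simp add: product_chart_def)
    show "openin (Euclidean_space (?n + ?m)) (chart_map ?b ` (chart_dom c \<times> chart_dom d))"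
      unfolding imQ[OF subset_refl subset_refl]
      by (intro opQ openin_chart_image[OF c] openin_chart_image[OF d] is_chart_dom[OF c] is_chart_dom[OF d] subset_refl)
    show "inj_on (chart_map ?b) (chart_dom c \<times> chart_dom d)"
    proof (rule inj_onI)
      fix p q assume p: "p \<in> chart_dom c \<times> chart_dom d" "q \<in> chart_dom c \<times> chart_dom d" "chart_map ?b p = chart_map ?b q"
      obtain x y x' y' where xy: "p = (x, y)" "q = (x', y')" by (cases p, cases q)
      have m: "x \<in> chart_dom c" "y \<in> chart_dom d" "x' \<in> chart_dom c" "y' \<in> chart_dom d" using p xy by auto
      have "chart_map c x = chart_map c x'" "chart_map d y = chart_map d y'"
        using p(3) unfolding xy sel(3)[OF m(1,2)] sel(3)[OF m(3,4)]
          append_coords_eq_iff[OF is_chart_rvec[OF c m(1)] is_chart_rvec[OF c m(3)]] by auto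
      then show "p = q" using inj_onD[OF is_chart_inj[OF c]] inj_onD[OF is_chart_inj[OF d]] m xy by blast
    qed
    show "openin (Euclidean_space (?n + ?m)) (chart_map ?b ` W)"
      if W: "openin (prod_topology T T') W" "W \<subseteq> chart_dom c \<times> chart_dom d" for W
    proof (subst openin_subopen, intro ballI)
      fix z assume "z \<in> chart_map ?b ` W"
      then obtain x y where xy: "(x, y) \<in> W" "z = chart_map ?b (x, y)" by auto
      have "\<exists>A B. openin T A \<and> openin T' B \<and> x \<in> A \<and> y \<in> B \<and> A \<times> B \<subseteq> W"
        using W(1)[unfolded openin_prod_topology_alt] xy(1) by simp
      then obtain A B where AB: "openin T A" "openin T' B" "x \<in> A" "y \<in> B" "A \<times> B \<subseteq> W"
        by (elim exE conjE) (rule that)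
      have sub: "A \<subseteq> chart_dom c" "B \<subseteq> chart_dom d" using AB(3-5) W(2) by blast+
      have "openin (Euclidean_space (?n + ?m)) (chart_map ?b ` (A \<times> B))"
        unfolding imQ[OF sub] by (intro opQ openin_chart_image[OF c] openin_chart_image[OF d] AB sub)
      then show "\<exists>S. openin (Euclidean_space (?n + ?m)) S \<and> z \<in> S \<and> S \<subseteq> chart_map ?b ` W"
        using AB xy by (intro exI[of _ "chart_map ?b ` (A \<times> B)"]) blast
    qed
    fix V assume V: "openin (Euclidean_space (?n + ?m)) V"
    let ?X = "subtopology (prod_topology T T') (chart_dom c \<times> chart_dom d)"
    have X: "?X = prod_topology (subtopology T (chart_dom c)) (subtopology T' (chart_dom d))"
      by (rule subtopology_Times)
    have topX: "topspace ?X = chart_dom c \<times> chart_dom d" using openin_subset[OF opd] by auto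
    let ?g = "\<lambda>z. append_coords ?n (chart_map c (fst z)) (chart_map d (snd z))"
    have "continuous_map ?X (Euclidean_space (?n + ?m)) ?g"
    proof (rule continuous_map_rvec)
      fix z assume "z \<in> topspace ?X"
      then show "?g z \<in> rvec (?n + ?m)" unfolding topX by (intro append_coords_rvec is_chart_rvec[OF d]) auto
    next
      fix i
      have "continuous_map ?X euclideanreal (\<lambda>z. chart_map c (fst z) i)"
        unfolding X using continuous_map_compose[OF continuous_map_fst continuous_map_rvec_coord[OF is_chart_continuous_map[OF c], of i]]
        by (simp add: o_def)
      moreover have "continuous_map ?X euclideanreal (\<lambda>z. chart_map d (snd z) (i - ?n))"
        unfolding X using continuous_map_compose[OF continuous_map_snd continuous_map_rvec_coord[OF is_chart_continuous_map[OF d], of "i - ?n"]]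
        by (simp add: o_def)
      ultimately show "continuous_map ?X euclideanreal (\<lambda>z. ?g z i)"
        by (cases "i < ?n") (simp_all add: append_coords_def)
    qed
    then have "openin ?X {z \<in> topspace ?X. ?g z \<in> V}" using V openin_continuous_map_preimage by blast
    moreover have "{z \<in> topspace ?X. ?g z \<in> V} = {p \<in> chart_dom c \<times> chart_dom d. chart_map ?b p \<in> V}"
      unfolding topX using sel(3) by auto
    ultimately show "openin (prod_topology T T') {p \<in> chart_dom c \<times> chart_dom d. chart_map ?b p \<in> V}"
      using opd openin_trans_full[of "prod_topology T T'" "chart_dom c \<times> chart_dom d"] by simp
  qed
qed

lemma is_chart_subtopology:
  assumes "is_chart T c" "chart_dom c \<subseteq> U"
  shows "is_chart (subtopology T U) c"
proof -
  have "U \<inter> chart_dom c = chart_dom c" using assms(2) by blast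
  then have "subtopology (subtopology T U) (chart_dom c) = subtopology T (chart_dom c)" by (simp add: subtopology_subtopology)
  moreover have "openin (subtopology T U) (chart_dom c)"
    using openin_subtopology_Int[OF is_chart_dom[OF assms(1)], of U] assms(2) by (simp add: Int_absorb2)
  ultimately show ?thesis using assms(1) by (simp add: is_chart_def)
qed

text \<open>The part of a bundle over U and the product of U with R^k, which occur in a local
  trivialization, are each covered by one chart that is compatible with all charts of the atlas.
  Every local representative then factors through the one in these two global charts.\<close>

lemma smooth_map_via_charts:
  assumes M: "\<And>c. c \<in> atlas M \<Longrightarrow> is_chart (mtop M) c \<and> compatible c b" and N: "\<And>d. d \<in> atlas N \<Longrightarrow> is_chart (mtop N) d \<and> compatible d b'"
    and b: "is_chart (mtop M) b" "chart_dom b = mpoints M" and b': "is_chart (mtop N) b'" "chart_dom b' = mpoints N"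
    and F: "F ` mpoints M \<subseteq> mpoints N" "chart_smooth b b' F (mpoints M)"
  shows "smooth_map M N F"
proof -
  have opb: "openin (mtop M) (mpoints M)" by simp
  have cont: "continuous_map (mtop M) (mtop N) F"
    unfolding continuous_map_def
  proof (intro conjI allI impI)
    show "F \<in> mpoints M \<rightarrow> mpoints N" using F(1) by blast
    fix S assume "openin (mtop N) S"
    then show "openin (mtop M) {x \<in> mpoints M. F x \<in> S}"
      using chart_smooth_openin_preimage[OF b(1) opb _ b'(1) _ F(2)] b b' F(1) by simp
  qed
  have "chart_smooth c d F (chart_dom c \<inter> F -` chart_dom d)" if c: "c \<in> atlas M" and d: "d \<in> atlas N" for c d
  proof -
    let ?W = "chart_dom c \<inter> F -` chart_dom d"
    have chc: "is_chart (mtop M) c" and chd: "is_chart (mtop N) d" using M[OF c] N[OF d] by auto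
    note opc = is_chart_dom[OF chc] and opd = is_chart_dom[OF chd]
    have opW: "openin (mtop M) ?W" by (rule openin_vimage_chart[OF cont opc opd])
    have csub: "chart_dom c \<subseteq> mpoints M" "chart_dom d \<subseteq> mpoints N" using openin_subset opc opd by blast+
    have "chart_smooth c b (\<lambda>p. p) (chart_dom c \<inter> chart_dom b)" using M[OF c] by (simp add: compatible_iff)
    then have "chart_smooth c b (\<lambda>p. p) (chart_dom c)" using csub b(2) by (simp add: Int_absorb2)
    from chart_smooth_subset[OF chc opc subset_refl _ this] have 1: "chart_smooth c b (\<lambda>p. p) ?W" by blast
    have 2: "chart_smooth c b' (\<lambda>p. F p) ?W"
      by (rule chart_smooth_compose[OF chc opW _ b(1) opb _ _ 1 F(2)]) (use b csub in auto)
    have "chart_smooth b' d (\<lambda>p. p) (chart_dom d \<inter> chart_dom b')" using N[OF d] by (simp add: compatible_iff)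
    then have 3: "chart_smooth b' d (\<lambda>p. p) (chart_dom d)" using csub b'(2) by (simp add: Int_absorb2)
    show ?thesis
      by (rule chart_smooth_compose[OF chc opW _ b'(1) opd _ _ 2 3]) (use b' csub in auto)
  qed
  then show ?thesis using cont by (simp add: smooth_map_def chart_smooth_def)
qed

text \<open>Read in the global charts, F is the identity of their common image. This gives
  bijectivity and smoothness in both directions.\<close>

lemma diffeomorphism_via_charts:
  assumes M: "\<And>c. c \<in> atlas M \<Longrightarrow> is_chart (mtop M) c \<and> compatible c b" and N: "\<And>d. d \<in> atlas N \<Longrightarrow> is_chart (mtop N) d \<and> compatible d b'"
    and b: "is_chart (mtop M) b" "chart_dom b = mpoints M" and b': "is_chart (mtop N) b'" "chart_dom b' = mpoints N"
    and im: "chart_dim b = chart_dim b'" "chart_map b ` mpoints M = chart_map b' ` mpoints N"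
    and F: "\<And>e. e \<in> mpoints M \<Longrightarrow> F e \<in> mpoints N" "\<And>e. e \<in> mpoints M \<Longrightarrow> chart_map b' (F e) = chart_map b e"
  shows "diffeomorphism M N F"
proof -
  have inj: "inj_on (chart_map b) (mpoints M)" "inj_on (chart_map b') (mpoints N)"
    using is_chart_inj b b' by metis+
  have bij: "bij_betw F (mpoints M) (mpoints N)"
  proof (rule bij_betw_imageI)
    show "inj_on F (mpoints M)"
    proof (rule inj_onI)
      fix p q assume pq: "p \<in> mpoints M" "q \<in> mpoints M" "F p = F q"
      then have "chart_map b p = chart_map b q" using F(2) by metis
      then show "p = q" using inj_onD[OF inj(1)] pq by blast
    qed
    show "F ` mpoints M = mpoints N"
    proof (intro equalityI subsetI)
      fix y assume y: "y \<in> mpoints N"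
      then obtain e where e: "e \<in> mpoints M" "chart_map b' y = chart_map b e" using im(2) by blast
      then have "chart_map b' (F e) = chart_map b' y" using F(2) by simp
      then have "F e = y" using inj_onD[OF inj(2)] F(1)[OF e(1)] y by blast
      then show "y \<in> F ` mpoints M" using e(1) by blast
    qed (use F(1) in blast)
  qed
  define G where "G = inv_into (mpoints M) F"
  have G: "G y \<in> mpoints M" "chart_map b (G y) = chart_map b' y" if "y \<in> mpoints N" for y
  proof -
    have "y \<in> F ` mpoints M" using bij that by (simp add: bij_betw_def)
    then show "G y \<in> mpoints M" unfolding G_def by (rule inv_into_into)
    have "F (G y) = y" unfolding G_def by (rule f_inv_into_f[OF \<open>y \<in> F ` mpoints M\<close>])
    then show "chart_map b (G y) = chart_map b' y" using F(2)[OF \<open>G y \<in> mpoints M\<close>] by simp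
  qed
  \<comment> \<open>Stated for arbitrary manifolds, charts and maps, so that it serves F and its
    inverse alike.\<close>
  have *: "chart_smooth b b' F (mpoints M)"
    if b: "is_chart (mtop M) b" "chart_dom b = mpoints M" and "chart_dim b = chart_dim b'"
      and F: "\<And>e. e \<in> mpoints M \<Longrightarrow> chart_map b' (F e) = chart_map b e"
      for M :: "'x manifold" and b and b' :: "'y chart" and F
  proof -
    have op: "openin (Euclidean_space (chart_dim b)) (chart_map b ` mpoints M)"
      using openin_chart_image[OF b(1) is_chart_dom[OF b(1)] subset_refl] b(2) by simp
    have "y = local_rep b b' F y" if y: "y \<in> chart_map b ` mpoints M" for y
    proof -
      obtain e where e: "e \<in> mpoints M" "y = chart_map b e" using y by blast
      have "e \<in> chart_dom b" using e b(2) by simp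
      then show ?thesis unfolding e(2) by (simp add: local_rep_chart_map[OF b(1)] F[OF e(1)])
    qed
    then show ?thesis unfolding chart_smooth_def C_inf_iff
      using smooth_on_cong[OF op _ smooth_on_coord[OF op], of _ "\<lambda>y. local_rep b b' F y i" for i] by metis
  qed
  have "smooth_map M N F"
    by (rule smooth_map_via_charts[OF M N b b' _ *[OF b im(1) F(2)]]) (use F(1) in auto)
  moreover have "smooth_map N M G"
    by (rule smooth_map_via_charts[OF N M b' b _ *[OF b' im(1)[symmetric] G(2)]]) (use G(1) in auto)
  ultimately show ?thesis using bij by (simp add: diffeomorphism_def G_def)
qed

text \<open>A local trivialization packaged as a single chart of the total space: coordinates of the
  base point in c followed by linear fibre coordinates \<phi>, defined over the whole domain of c
  and onto a full cylinder. Charts of tangent bundles and induced charts of subbundles are produced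
  in this form.\<close>

definition bundle_chart :: "('e, 'b) vbundle \<Rightarrow> 'b chart \<Rightarrow> 'e chart \<Rightarrow> nat \<Rightarrow> ('e \<Rightarrow> nat \<Rightarrow> real) \<Rightarrow> bool" where
  "bundle_chart E c b k \<phi> \<longleftrightarrow> c \<in> atlas (base E) \<and> b \<in> atlas (total E) \<and>
     chart_dim b = chart_dim c + k \<and> chart_dom b = {e \<in> mpoints (total E). proj E e \<in> chart_dom c} \<and>
     (\<forall>e\<in>chart_dom b. \<phi> e \<in> rvec k \<and> chart_map b e = append_coords (chart_dim c) (chart_map c (proj E e)) (\<phi> e)) \<and>
     chart_map b ` chart_dom b = cylinder (chart_dim c) k (chart_map c ` chart_dom c) \<and>
     (\<forall>x\<in>chart_dom c. (\<forall>u\<in>fibre E x. \<forall>v\<in>fibre E x. \<phi> (vadd E u v) = (\<lambda>i. \<phi> u i + \<phi> v i)) \<and>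
            (\<forall>r. \<forall>v\<in>fibre E x. \<phi> (vscale E r v) = (\<lambda>i. r * \<phi> v i)))"

lemma bundle_chart_proj_smooth:
  assumes T: "charted_space (total E)" and B: "charted_space (base E)" and b: "bundle_chart E c b k \<phi>"
  shows "chart_smooth b c (proj E) (chart_dom b)"
proof -
  have cb: "c \<in> atlas (base E)" "b \<in> atlas (total E)" using b by (auto simp: bundle_chart_def)
  note chc = charted_space_is_chart[OF B cb(1)] and chb = charted_space_is_chart[OF T cb(2)]
  have op: "openin (Euclidean_space (chart_dim b)) (chart_map b ` chart_dom b)"
    by (rule openin_chart_image[OF chb is_chart_dom[OF chb] subset_refl])
  have eq: "first_coords (chart_dim c) y = local_rep b c (proj E) y" if y: "y \<in> chart_map b ` chart_dom b" for y
  proof -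
    obtain e where e: "e \<in> chart_dom b" "y = chart_map b e" using y by blast
    have y': "chart_map b e = append_coords (chart_dim c) (chart_map c (proj E e)) (\<phi> e)" "proj E e \<in> chart_dom c"
      using b e(1) by (auto simp: bundle_chart_def)
    show ?thesis unfolding e(2) local_rep_chart_map[OF chb e(1)] unfolding y'(1)
      by (rule first_coords_append[OF is_chart_rvec[OF chc y'(2)]])
  qed
  have "smooth_on (chart_dim b) (chart_map b ` chart_dom b) (\<lambda>y. first_coords (chart_dim c) y i)" for i
    using smooth_on_coord[OF op] smooth_on_const[OF op] by (cases "i < chart_dim c") (simp_all add: first_coords_def)
  then show ?thesis unfolding chart_smooth_def C_inf_iff
    using smooth_on_cong[OF op, of "\<lambda>y. first_coords (chart_dim c) y i" "\<lambda>y. local_rep b c (proj E) y i" for i] eq by metis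
qed

definition std_chart :: "nat \<Rightarrow> (nat \<Rightarrow> real) chart" where
  "std_chart k = \<lparr>chart_dim = k, chart_dom = rvec k, chart_map = (\<lambda>x\<in>rvec k. x)\<rparr>"

lemma std_chart_sel: "chart_dim (std_chart k) = k" "chart_dom (std_chart k) = rvec k"
  "x \<in> rvec k \<Longrightarrow> chart_map (std_chart k) x = x"
  by (simp_all add: std_chart_def)

lemma is_chart_std_chart: "is_chart (Euclidean_space k) (std_chart k)"
proof (rule is_chartI, unfold std_chart_sel)
  have im: "chart_map (std_chart k) ` W = W" if "W \<subseteq> rvec k" for W
    using that by (force simp: std_chart_sel subset_iff image_iff)
  show "openin (Euclidean_space k) (rvec k)" by (rule openin_rvec)
  show "chart_map (std_chart k) \<in> extensional (rvec k)" by (simp add: std_chart_def)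
  show "openin (Euclidean_space k) (chart_map (std_chart k) ` rvec k)" unfolding im[OF subset_refl] by (rule openin_rvec)
  show "inj_on (chart_map (std_chart k)) (rvec k)" by (auto simp: inj_on_def std_chart_sel)
  show "openin (Euclidean_space k) (chart_map (std_chart k) ` W)" if "openin (Euclidean_space k) W" "W \<subseteq> rvec k" for W
    using that im by simp
  fix V assume V: "openin (Euclidean_space k) V"
  have "{p \<in> rvec k. chart_map (std_chart k) p \<in> V} = V"
    using openin_subset[OF V] std_chart_sel(3)[of _ k] by auto
  then show "openin (Euclidean_space k) {p \<in> rvec k. chart_map (std_chart k) p \<in> V}" using V by simp
qed

lemma std_chart_atlas: "std_chart k \<in> atlas (euclidean_manifold k)"
proof -
  have "compatible (std_chart k) (std_chart k)"
    unfolding compatible_iff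
    using chart_smooth_id[OF is_chart_std_chart is_chart_dom[OF is_chart_std_chart] subset_refl] by simp
  then have "std_chart k \<in> maximal_atlas (Euclidean_space k) {std_chart k}"
    using is_chart_std_chart by (simp add: maximal_atlas_def)
  then show ?thesis by (simp add: euclidean_manifold_def std_chart_def)
qed

text \<open>The map to U x R^k becomes the identity when read in b and in the product of c with the
  standard chart of R^k; both images are the cylinder over the image of c.\<close>

lemma bundle_chart_local_trivialization:
  assumes T: "charted_space (total E)" and B: "charted_space (base E)" and b: "bundle_chart E c b k \<phi>"
  shows "local_trivialization E (chart_dom c) k \<phi>"
proof -
  have cb: "c \<in> atlas (base E)" "b \<in> atlas (total E)" using b by (auto simp: bundle_chart_def)
  note chc = charted_space_is_chart[OF B cb(1)] and chb = charted_space_is_chart[OF T cb(2)]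
  note opc = is_chart_dom[OF chc] and opb = is_chart_dom[OF chb]
  let ?M = "open_submanifold (total E) {e \<in> mpoints (total E). proj E e \<in> chart_dom c}"
  let ?U = "open_submanifold (base E) (chart_dom c)"
  let ?N = "product_manifold ?U (euclidean_manifold k)"
  let ?b = "product_chart c (std_chart k)"
  have domb: "{e \<in> mpoints (total E). proj E e \<in> chart_dom c} = chart_dom b" using b by (simp add: bundle_chart_def)
  have M: "mtop ?M = subtopology (mtop (total E)) (chart_dom b)" "atlas ?M = {a \<in> atlas (total E). chart_dom a \<subseteq> chart_dom b}"
    unfolding domb by (simp_all add: open_submanifold_def)
  have N: "mtop ?N = prod_topology (subtopology (mtop (base E)) (chart_dom c)) (Euclidean_space k)"
    by (simp add: product_manifold_def open_submanifold_def euclidean_manifold_def)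
  have cU: "c \<in> atlas ?U" using cb(1) by (simp add: open_submanifold_def)
  have sel: "chart_dim ?b = chart_dim c + k" "chart_dom ?b = chart_dom c \<times> rvec k"
    "\<And>x y. x \<in> chart_dom c \<Longrightarrow> y \<in> rvec k \<Longrightarrow> chart_map ?b (x, y) = append_coords (chart_dim c) (chart_map c x) y"
    by (auto simp: product_chart_def std_chart_sel)
  have pM: "mpoints ?M = chart_dom b" unfolding M using openin_subset[OF opb] by auto
  have pN: "mpoints ?N = chart_dom c \<times> rvec k" unfolding N using openin_subset[OF opc] by auto
  have ph: "\<phi> e \<in> rvec k" "chart_map b e = append_coords (chart_dim c) (chart_map c (proj E e)) (\<phi> e)" "proj E e \<in> chart_dom c"
    if "e \<in> chart_dom b" for e using b that by (auto simp: bundle_chart_def)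
  have "diffeomorphism ?M ?N (\<lambda>e. (proj E e, \<phi> e))"
  proof (rule diffeomorphism_via_charts[where b = b and b' = ?b])
    fix a assume "a \<in> atlas ?M"
    then have a: "a \<in> atlas (total E)" "chart_dom a \<subseteq> chart_dom b" unfolding M by auto
    then show "is_chart (mtop ?M) a \<and> compatible a b"
      unfolding M using is_chart_subtopology[OF charted_space_is_chart[OF T a(1)] a(2)] T cb(2) by (simp add: charted_space_def)
  next
    fix d assume "d \<in> atlas ?N"
    then show "is_chart (mtop ?N) d \<and> compatible d ?b"
      using cU std_chart_atlas[of k] by (auto simp: product_manifold_def maximal_atlas_def)
  next
    show "is_chart (mtop ?M) b" unfolding M by (rule is_chart_subtopology[OF chb subset_refl])
    show "chart_dom b = mpoints ?M" using pM ..
    show "is_chart (mtop ?N) ?b" unfolding N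
      by (intro is_chart_product_chart is_chart_subtopology[OF chc subset_refl] is_chart_std_chart)
    show "chart_dom ?b = mpoints ?N" unfolding pN sel(2) ..
    show "chart_dim b = chart_dim ?b" using b by (simp add: bundle_chart_def sel(1))
    show "chart_map b ` mpoints ?M = chart_map ?b ` mpoints ?N"
    proof -
      have "chart_map ?b ` (chart_dom c \<times> rvec k) = cylinder (chart_dim c) k (chart_map c ` chart_dom c)"
      proof (intro equalityI subsetI)
        fix z assume "z \<in> chart_map ?b ` (chart_dom c \<times> rvec k)"
        then obtain x y where xy: "x \<in> chart_dom c" "y \<in> rvec k" "z = chart_map ?b (x, y)" by blast
        show "z \<in> cylinder (chart_dim c) k (chart_map c ` chart_dom c)"
          unfolding xy(3) sel(3)[OF xy(1,2)] cylinder_def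
          using xy by (simp add: append_coords_rvec first_coords_append[OF is_chart_rvec[OF chc xy(1)]])
      next
        fix z assume z: "z \<in> cylinder (chart_dim c) k (chart_map c ` chart_dom c)"
        then obtain x where x: "x \<in> chart_dom c" "first_coords (chart_dim c) z = chart_map c x" by (auto simp: cylinder_def)
        have l: "last_coords (chart_dim c) z \<in> rvec k" using z last_coords_rvec by (auto simp: cylinder_def)
        have "z = chart_map ?b (x, last_coords (chart_dim c) z)"
          unfolding sel(3)[OF x(1) l] x(2)[symmetric] by (rule append_first_last[symmetric])
        then show "z \<in> chart_map ?b ` (chart_dom c \<times> rvec k)" using x(1) l by blast
      qed
      moreover have "chart_map b ` chart_dom b = cylinder (chart_dim c) k (chart_map c ` chart_dom c)"
        using b unfolding bundle_chart_def by blast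
      ultimately show ?thesis unfolding pM pN by (rule trans[OF _ sym, rotated])
    qed
    show "(proj E e, \<phi> e) \<in> mpoints ?N" if "e \<in> mpoints ?M" for e
      unfolding pN using that ph unfolding pM by blast
    show "chart_map ?b (proj E e, \<phi> e) = chart_map b e" if "e \<in> mpoints ?M" for e
      using ph[of e] that sel(3) unfolding pM by simp
  qed
  moreover have "\<forall>x\<in>chart_dom c. (\<forall>u\<in>fibre E x. \<forall>v\<in>fibre E x. \<phi> (vadd E u v) = (\<lambda>i. \<phi> u i + \<phi> v i)) \<and>
            (\<forall>r. \<forall>v\<in>fibre E x. \<phi> (vscale E r v) = (\<lambda>i. r * \<phi> v i))"
    using b unfolding bundle_chart_def by (elim conjE)
  ultimately show ?thesis unfolding local_trivialization_def using opc by (intro conjI)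
qed

text \<open>Bundle charts around every point account for two clauses of the definition: in such a
  chart the projection is a coordinate projection, hence smooth, and the chart itself yields a local
  trivialization.\<close>

lemma vector_bundleI:
  assumes T: "smooth_manifold (total E)" and B: "smooth_manifold (base E)"
    and pr: "\<And>e. e \<in> mpoints (total E) \<Longrightarrow> proj E e \<in> mpoints (base E)"
    and fib: "\<And>x. x \<in> mpoints (base E) \<Longrightarrow> real_vector_space_on (fibre E x) (vadd E) (vzero E x) (vscale E)"
    and loc: "\<And>x. x \<in> mpoints (base E) \<Longrightarrow> \<exists>c b k \<phi>. x \<in> chart_dom c \<and> bundle_chart E c b k \<phi>"
  shows "vector_bundle E"
proof -
  note TC = smooth_manifold_charted_space[OF T] and BC = smooth_manifold_charted_space[OF B]
  have "smooth_map (total E) (base E) (proj E)"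
  proof (rule smooth_mapI[OF TC BC])
    fix e assume e: "e \<in> mpoints (total E)"
    obtain c b k \<phi> where b: "proj E e \<in> chart_dom c" "bundle_chart E c b k \<phi>" using loc[OF pr[OF e]] by blast
    then have cb: "c \<in> atlas (base E)" "b \<in> atlas (total E)" "chart_dom b = {e \<in> mpoints (total E). proj E e \<in> chart_dom c}"
      by (auto simp: bundle_chart_def)
    show "\<exists>c\<in>atlas (total E). \<exists>d\<in>atlas (base E). \<exists>W. openin (mtop (total E)) W \<and> e \<in> W \<and> W \<subseteq> chart_dom c \<and>
        proj E ` W \<subseteq> chart_dom d \<and> chart_smooth c d (proj E) W"
      using cb e b(1) bundle_chart_proj_smooth[OF TC BC b(2)] is_chart_dom[OF charted_space_is_chart[OF TC cb(2)]]
      by (intro bexI[of _ b] bexI[of _ c] exI[of _ "chart_dom b"]) auto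
  qed
  moreover have "\<exists>U k \<phi>. x \<in> U \<and> local_trivialization E U k \<phi>" if x: "x \<in> mpoints (base E)" for x
    using loc[OF x] bundle_chart_local_trivialization[OF TC BC] by blast
  ultimately show ?thesis using T B fib by (simp add: vector_bundle_def)
qed

lemma real_vector_space_on_tvec:
  assumes "tzero \<in> T" "\<And>v w. v \<in> T \<Longrightarrow> w \<in> T \<Longrightarrow> tadd v w \<in> T" "\<And>r v. v \<in> T \<Longrightarrow> tscale r v \<in> T"
  shows "real_vector_space_on ({x} \<times> T) (\<lambda>(x, v) (y, w). (x, tadd v w)) (x, tzero) (\<lambda>r (x, v). (x, tscale r v))"
proof -
  have "\<exists>w\<in>T. tadd v w = tzero" if "v \<in> T" for v
    using assms(3)[OF that, of "-1"] by (intro bexI[of _ "tscale (-1) v"]) (auto simp: tadd_def tscale_def tzero_def)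
  then show ?thesis unfolding real_vector_space_on_def
    using assms by (auto simp: tadd_def tscale_def tzero_def algebra_simps)
qed

context tangent_along_map
begin

lemma fibre_E: "x \<in> mpoints M \<Longrightarrow> fibre E x = {x} \<times> tangent_space N (f x)"
  unfolding fibre_def E_points by (auto simp: tangent_along_points_def E_sel)

lemma bundle_chart_tchart:
  assumes c: "c \<in> atlas M" "chart_dom c \<subseteq> f -` chart_dom d" and d: "d \<in> atlas N"
  shows "bundle_chart E c (tchart c d) (chart_dim d) (\<lambda>e. snd e d)"
proof -
  have dom: "chart_dom (tchart c d) = {e \<in> mpoints (total E). proj E e \<in> chart_dom c}"
    using c(2) unfolding E_points tangent_along_chart_sel by (auto simp: E_sel)
  have im: "chart_map (tchart c d) ` chart_dom (tchart c d) = cylinder (chart_dim c) (chart_dim d) (chart_map c ` chart_dom c)"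
    using tchart_image[OF c(1) d, of "chart_dom c"] c(2) dom unfolding E_points by (simp add: E_sel)
  have "snd e d \<in> rvec (chart_dim d)" if "e \<in> chart_dom (tchart c d)" for e
    by (rule tangent_space_rvec[of _ N "f (fst e)"]) (use that d in \<open>auto simp: tangent_along_chart_sel tangent_along_points_iff charts_at_iff\<close>)
  moreover have "chart_map (tchart c d) e = append_coords (chart_dim c) (chart_map c (proj E e)) (snd e d)" if "e \<in> chart_dom (tchart c d)" for e
    using tangent_along_chart_map[OF that] by (simp add: E_sel)
  moreover have "snd (vadd E u v) d = (\<lambda>i. snd u d i + snd v d i)" "snd (vscale E r v) d = (\<lambda>i. r * snd v d i)" for u v r
    by (simp_all add: E_sel tadd_def tscale_def split: prod.split)
  moreover have "c \<in> atlas (base E)" using c(1) by (simp add: E_sel)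
  ultimately show ?thesis
    unfolding bundle_chart_def using dom im tchart_atlas[OF c(1) d]
    by (intro conjI ballI allI) (assumption | rule tangent_along_chart_sel(1))+
qed

text \<open>A chart of M is shrunk until f maps it into a single chart of N. The resulting bundle
  chart then covers the entire part of the bundle over its base chart, as
  \<open>bundle_chart\<close> demands.\<close>

lemma bundle_chart_at:
  assumes "x \<in> mpoints M"
  obtains c d where "x \<in> chart_dom c" "c \<in> atlas M" "d \<in> atlas N" "chart_dom c \<subseteq> f -` chart_dom d"
proof -
  obtain c where c: "c \<in> atlas M" "x \<in> chart_dom c" using smooth_manifold_chart_at[OF M assms] by blast
  obtain d where d: "d \<in> atlas N" "f x \<in> chart_dom d" using smooth_manifold_chart_at[OF N smooth_map_points[OF f assms]] by blast
  let ?W = "chart_dom c \<inter> f -` chart_dom d"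
  have "change_chart c (chart_dim c) ?W (\<lambda>y. y) \<in> atlas M"
    by (rule restrict_chart_atlas[OF M c(1) openin_chart_pair[OF c(1) d(1)]]) auto
  moreover have "chart_dom (change_chart c (chart_dim c) ?W (\<lambda>y. y)) = ?W" by (simp add: change_chart_def)
  ultimately show ?thesis
    by (intro that[of "change_chart c (chart_dim c) ?W (\<lambda>y. y)" d]) (use c(2) d in auto)
qed

lemma vector_bundle_E: "vector_bundle E"
proof (rule vector_bundleI)
  show "smooth_manifold (total E)" by (rule smooth_manifold_E)
  show "smooth_manifold (base E)" by (simp add: E_sel M)
  show "proj E e \<in> mpoints (base E)" if "e \<in> mpoints (total E)" for e
    using that unfolding E_points by (simp add: E_sel tangent_along_points_iff)
  show "real_vector_space_on (fibre E x) (vadd E) (vzero E x) (vscale E)" if "x \<in> mpoints (base E)" for x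
  proof -
    have "x \<in> mpoints M" using that by (simp add: E_sel)
    then show ?thesis unfolding fibre_E[OF \<open>x \<in> mpoints M\<close>] E_sel(4,5,6)
      by (intro real_vector_space_on_tvec tangent_space_tzero tangent_space_tadd tangent_space_tscale)
  qed
  show "\<exists>c b k \<phi>. x \<in> chart_dom c \<and> bundle_chart E c b k \<phi>" if "x \<in> mpoints (base E)" for x
  proof -
    have x: "x \<in> mpoints M" using that by (simp add: E_sel)
    show ?thesis by (rule bundle_chart_at[OF x]) (use bundle_chart_tchart in blast)
  qed
qed

end

section \<open>Linear algebra\<close>

text \<open>Matrices are functions of two indices whose entries below m alone matter, since sizes
  vary with the chart. The cutoff puts the value into R^m, so that vectors agree as
  functions.\<close>

definition mv :: "nat \<Rightarrow> (nat \<Rightarrow> nat \<Rightarrow> real) \<Rightarrow> (nat \<Rightarrow> real) \<Rightarrow> nat \<Rightarrow> real" where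
  "mv m a w = (\<lambda>i. if i < m then \<Sum>j<m. a i j * w j else 0)"

definition mm :: "nat \<Rightarrow> (nat \<Rightarrow> nat \<Rightarrow> real) \<Rightarrow> (nat \<Rightarrow> nat \<Rightarrow> real) \<Rightarrow> nat \<Rightarrow> nat \<Rightarrow> real" where
  "mm m a b = (\<lambda>i j. \<Sum>l<m. a i l * b l j)"

definition id_matrix :: "nat \<Rightarrow> nat \<Rightarrow> real" where
  "id_matrix = (\<lambda>i j. if i = j then 1 else 0)"

lemma mv_rvec: "mv m a w \<in> rvec m"
  by (simp add: mv_def mem_rvec)

lemma mv_mm: "mv m (mm m a b) w = mv m a (mv m b w)"
proof
  fix i
  have "(\<Sum>j<m. (\<Sum>l<m. a i l * b l j) * w j) = (\<Sum>j<m. \<Sum>l<m. a i l * b l j * w j)"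
    by (simp add: sum_distrib_right)
  also have "\<dots> = (\<Sum>l<m. \<Sum>j<m. a i l * b l j * w j)" by (rule sum.swap)
  also have "\<dots> = (\<Sum>l<m. a i l * (\<Sum>j<m. b l j * w j))" by (simp add: sum_distrib_left mult.assoc)
  finally show "mv m (mm m a b) w i = mv m a (mv m b w) i" by (simp add: mv_def mm_def)
qed

lemma mv_id: "w \<in> rvec m \<Longrightarrow> mv m id_matrix w = w"
proof
  fix i assume w: "w \<in> rvec m"
  have "(\<Sum>j<m. id_matrix i j * w j) = (\<Sum>j<m. if i = j then w j else 0)" by (rule sum.cong) (auto simp: id_matrix_def)
  then show "mv m id_matrix w i = w i" using w by (simp add: mv_def mem_rvec)
qed

lemma mv_add: "mv m a (\<lambda>i. v i + w i) = (\<lambda>i. mv m a v i + mv m a w i)"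
  by (auto simp: mv_def algebra_simps sum.distrib)

lemma mv_scale: "mv m a (\<lambda>i. r * w i) = (\<lambda>i. r * mv m a w i)"
  by (auto simp: mv_def algebra_simps sum_distrib_left)

lemma mv_unit: "j < m \<Longrightarrow> i < m \<Longrightarrow> mv m a (\<lambda>l. if l = j then 1 else 0) i = a i j"
  by (simp add: mv_def if_distrib[of "\<lambda>x. _ * x"] cong: if_cong)

section \<open>Inverse matrices by cofactors and their smoothness\<close>

definition jnf_mat :: "nat \<Rightarrow> (nat \<Rightarrow> nat \<Rightarrow> real) \<Rightarrow> real Matrix.mat" where
  "jnf_mat m a = Matrix.mat m m (\<lambda>(i, j). a i j)"

text \<open>The adjugate formula, hence the exchanged indices of the cofactor. Its entries are
  quotients of polynomials in the entries of a, so smooth dependence on parameters can be read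
  off.\<close>

definition matrix_inverse :: "nat \<Rightarrow> (nat \<Rightarrow> nat \<Rightarrow> real) \<Rightarrow> nat \<Rightarrow> nat \<Rightarrow> real" where
  "matrix_inverse m a = (\<lambda>i j. inverse (Determinant.det (jnf_mat m a)) * cofactor (jnf_mat m a) j i)"

lemma jnf_mat_carrier: "jnf_mat m a \<in> carrier_mat m m"
  by (simp add: jnf_mat_def)

lemma mm_matrix_inverse:
  assumes "Determinant.det (jnf_mat m a) \<noteq> 0" "i < m" "j < m"
  shows "mm m a (matrix_inverse m a) i j = id_matrix i j" "mm m (matrix_inverse m a) a i j = id_matrix i j"
proof -
  let ?A = "jnf_mat m a" and ?d = "Determinant.det (jnf_mat m a)"
  have adj: "adj_mat ?A $$ (i, j) = cofactor ?A j i" if "i < m" "j < m" for i j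
    using that jnf_mat_carrier[of m a] by (auto simp: adj_mat_def)
  have dim: "dim_row ?A = m" "dim_col ?A = m" "dim_row (adj_mat ?A) = m" "dim_col (adj_mat ?A) = m"
    using jnf_mat_carrier[of m a] by (auto simp: adj_mat_def)
  have A: "?A $$ (i, j) = a i j" if "i < m" "j < m" for i j using that by (simp add: jnf_mat_def)
  have "(?A * adj_mat ?A) $$ (i, j) = (\<Sum>l<m. a i l * cofactor ?A j l)"
    using assms(2,3) by (simp add: dim scalar_prod_def adj A lessThan_atLeast0 Matrix.row_def Matrix.col_def)
  moreover have "(?A * adj_mat ?A) $$ (i, j) = ?d * id_matrix i j"
    unfolding adj_mat(2)[OF jnf_mat_carrier] using assms(2,3) by (simp add: id_matrix_def)
  ultimately have "(\<Sum>l<m. a i l * cofactor ?A j l) = ?d * id_matrix i j" by simp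
  moreover have "mm m a (matrix_inverse m a) i j = inverse ?d * (\<Sum>l<m. a i l * cofactor ?A j l)"
    by (simp add: mm_def matrix_inverse_def sum_distrib_left mult.left_commute)
  ultimately show "mm m a (matrix_inverse m a) i j = id_matrix i j" using assms(1) by simp
  have "(adj_mat ?A * ?A) $$ (i, j) = (\<Sum>l<m. cofactor ?A l i * a l j)"
    using assms(2,3) by (simp add: dim scalar_prod_def adj A lessThan_atLeast0 Matrix.row_def Matrix.col_def)
  moreover have "(adj_mat ?A * ?A) $$ (i, j) = ?d * id_matrix i j"
    unfolding adj_mat(3)[OF jnf_mat_carrier] using assms(2,3) by (simp add: id_matrix_def)
  ultimately have "(\<Sum>l<m. cofactor ?A l i * a l j) = ?d * id_matrix i j" by simp
  moreover have "mm m (matrix_inverse m a) a i j = inverse ?d * (\<Sum>l<m. cofactor ?A l i * a l j)"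
    by (simp add: mm_def matrix_inverse_def sum_distrib_left mult.assoc)
  ultimately show "mm m (matrix_inverse m a) a i j = id_matrix i j" using assms(1) by simp
qed

lemma mv_cong: "(\<And>i j. i < m \<Longrightarrow> j < m \<Longrightarrow> a i j = b i j) \<Longrightarrow> mv m a w = mv m b w"
  by (auto simp: mv_def intro!: sum.cong)

lemma mv_matrix_inverse:
  assumes "Determinant.det (jnf_mat m a) \<noteq> 0" "w \<in> rvec m"
  shows "mv m a (mv m (matrix_inverse m a) w) = w" "mv m (matrix_inverse m a) (mv m a w) = w"
  using mv_cong[of m "mm m a (matrix_inverse m a)" id_matrix w] mv_cong[of m "mm m (matrix_inverse m a) a" id_matrix w]
    mm_matrix_inverse[OF assms(1)] mv_id[OF assms(2)] by (simp_all add: mv_mm)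

text \<open>The Leibniz formula makes the determinant a polynomial in the entries.\<close>

lemma smooth_on_det:
  assumes U: "openin (Euclidean_space k) U" and a: "\<And>i j. i < m \<Longrightarrow> j < m \<Longrightarrow> smooth_on k U (\<lambda>x. a x i j)"
  shows "smooth_on k U (\<lambda>x. Determinant.det (jnf_mat m (a x)))"
proof -
  have "Determinant.det (jnf_mat m (a x)) = (\<Sum>p\<in>{p. p permutes {0..<m}}. signof p * (\<Prod>i=0..<m. a x i (p i)))" for x
    unfolding det_def'[OF jnf_mat_carrier]
  proof (intro sum.cong refl arg_cong2[where f = times] prod.cong)
    fix p i assume "p \<in> {p. p permutes {0..<m}}" "i \<in> {0..<m}"
    then have "i < m" "p i < m" using permutes_in_image[of p "{0..<m}" i] by auto
    then show "jnf_mat m (a x) $$ (i, p i) = a x i (p i)" by (simp add: jnf_mat_def)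
  qed
  moreover have "smooth_on k U (\<lambda>x. \<Sum>p\<in>{p. p permutes {0..<m}}. signof p * (\<Prod>i=0..<m. a x i (p i)))"
  proof (intro smooth_on_sum[OF U] smooth_on_mult[OF U] smooth_on_const[OF U] smooth_on_prod[OF U])
    fix p i assume "p \<in> {p. p permutes {0..<m}}" "i \<in> {0..<m}"
    then have "i < m" "p i < m" using permutes_in_image[of p "{0..<m}" i] by auto
    then show "smooth_on k U (\<lambda>x. a x i (p i))" by (rule a)
  qed
  ultimately show ?thesis by simp
qed

text \<open>A cofactor is up to sign the determinant of the matrix with row j and column i deleted.
  Reindexed as a \<open>jnf_mat\<close> of size m - 1, this minor falls under
  \<open>smooth_on_det\<close>.\<close>

lemma smooth_on_matrix_inverse:
  assumes U: "openin (Euclidean_space k) U" and a: "\<And>i j. i < m \<Longrightarrow> j < m \<Longrightarrow> smooth_on k U (\<lambda>x. a x i j)"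
    and nz: "\<And>x. x \<in> U \<Longrightarrow> Determinant.det (jnf_mat m (a x)) \<noteq> 0" and ij: "i < m" "j < m"
  shows "smooth_on k U (\<lambda>x. matrix_inverse m (a x) i j)"
proof -
  have "mat_delete (jnf_mat m (a x)) j i = jnf_mat (m - 1) (\<lambda>i' j'. a x (if i' < j then i' else Suc i') (if j' < i then j' else Suc j'))" for x
    by (rule eq_matI) (auto simp: mat_delete_def jnf_mat_def)
  then have "cofactor (jnf_mat m (a x)) j i = (- 1) ^ (j + i) * Determinant.det (jnf_mat (m - 1) (\<lambda>i' j'. a x (if i' < j then i' else Suc i') (if j' < i then j' else Suc j')))" for x
    by (simp add: cofactor_def)
  moreover have "smooth_on k U (\<lambda>x. Determinant.det (jnf_mat (m - 1) (\<lambda>i' j'. a x (if i' < j then i' else Suc i') (if j' < i then j' else Suc j'))))"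
    by (rule smooth_on_det[OF U]) (use a in auto)
  ultimately have "smooth_on k U (\<lambda>x. cofactor (jnf_mat m (a x)) j i)"
    using smooth_on_mult[OF U smooth_on_const[OF U]] by simp
  moreover have "smooth_on k U (\<lambda>x. inverse (Determinant.det (jnf_mat m (a x))))"
    by (rule smooth_on_inverse[OF U smooth_on_det[OF U a] nz])
  ultimately show ?thesis unfolding matrix_inverse_def by (intro smooth_on_mult[OF U])
qed

section \<open>Coordinates adapted to a linear subspace\<close>

definition linear_on :: "nat \<Rightarrow> ((nat \<Rightarrow> real) \<Rightarrow> nat \<Rightarrow> real) \<Rightarrow> bool" where
  "linear_on m L \<longleftrightarrow> (\<forall>v\<in>rvec m. L v \<in> rvec m) \<and>
     (\<forall>v\<in>rvec m. \<forall>w\<in>rvec m. L (\<lambda>i. v i + w i) = (\<lambda>i. L v i + L w i)) \<and>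
     (\<forall>r. \<forall>v\<in>rvec m. L (\<lambda>i. r * v i) = (\<lambda>i. r * L v i))"

lemma linear_on_mv:
  assumes L: "linear_on m L" and w: "w \<in> rvec m"
  shows "L w = mv m (\<lambda>i j. L (\<lambda>l. if l = j then 1 else 0) i) w"
proof -
  let ?e = "\<lambda>j l. if l = j then 1 else (0::real)"
  have e: "?e j \<in> rvec m" if "j < m" for j using that by (auto simp: mem_rvec)
  \<comment> \<open>Truncations of w are built up one basis vector at a time, since linearity is
    available only for two summands inside R^m.\<close>
  have "L (\<lambda>i. if i < p then w i else 0) = (\<lambda>i. \<Sum>j<p. L (?e j) i * w j)" if "p \<le> m" for p
    using that
  proof (induction p)
    case 0
    have "(\<lambda>i. 0) \<in> rvec m" by (simp add: mem_rvec)
    then have "\<forall>r. L (\<lambda>i. r * 0) = (\<lambda>i. r * L (\<lambda>i. 0) i)" using L unfolding linear_on_def by meson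
    from this[rule_format, of 0] show ?case by simp
  next
    case (Suc p)
    have tr: "(\<lambda>i. if i < p then w i else 0) \<in> rvec m" using w by (auto simp: mem_rvec)
    have ep: "?e p \<in> rvec m" using e Suc.prems by simp
    have "(\<lambda>i. w p * ?e p i) \<in> rvec m" using Suc.prems by (auto simp: mem_rvec)
    with tr have "L (\<lambda>i. (if i < p then w i else 0) + w p * ?e p i) = (\<lambda>i. L (\<lambda>i. if i < p then w i else 0) i + L (\<lambda>i. w p * ?e p i) i)"
      using L unfolding linear_on_def by meson
    moreover have "L (\<lambda>i. w p * ?e p i) = (\<lambda>i. w p * L (?e p) i)" using L ep unfolding linear_on_def by meson
    moreover have "(\<lambda>i. (if i < p then w i else 0) + w p * ?e p i) = (\<lambda>i. if i < Suc p then w i else 0)"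
      by (auto simp: less_Suc_eq)
    ultimately show ?case using Suc by (simp add: mult.commute)
  qed
  from this[of m] have "L (\<lambda>i. if i < m then w i else 0) = (\<lambda>i. \<Sum>j<m. L (?e j) i * w j)" by simp
  moreover have "(\<lambda>i. if i < m then w i else 0) = w" using w by (auto simp: mem_rvec)
  moreover have "L w \<in> rvec m" using L w by (simp add: linear_on_def)
  ultimately show ?thesis by (auto simp: mv_def mem_rvec fun_eq_iff)
qed

definition linear_subspace :: "nat \<Rightarrow> (nat \<Rightarrow> real) set \<Rightarrow> bool" where
  "linear_subspace m W \<longleftrightarrow> W \<subseteq> rvec m \<and> (\<lambda>i. 0) \<in> W \<and> (\<forall>v\<in>W. \<forall>w\<in>W. (\<lambda>i. v i + w i) \<in> W) \<and> (\<forall>r. \<forall>v\<in>W. (\<lambda>i. r * v i) \<in> W)"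

definition linear_iso :: "nat \<Rightarrow> ((nat \<Rightarrow> real) \<Rightarrow> nat \<Rightarrow> real) \<Rightarrow> ((nat \<Rightarrow> real) \<Rightarrow> nat \<Rightarrow> real) \<Rightarrow> bool" where
  "linear_iso m L L' \<longleftrightarrow> linear_on m L \<and> linear_on m L' \<and> (\<forall>w\<in>rvec m. L' (L w) = w \<and> L (L' w) = w)"

lemma linear_on_compose: "linear_on m L \<Longrightarrow> linear_on m K \<Longrightarrow> linear_on m (\<lambda>w. L (K w))"
  unfolding linear_on_def by (auto simp del: mem_rvec)

lemma linear_iso_compose: "linear_iso m L L' \<Longrightarrow> linear_iso m K K' \<Longrightarrow> linear_iso m (\<lambda>w. L (K w)) (\<lambda>w. K' (L' w))"
  unfolding linear_iso_def using linear_on_compose by (auto simp: linear_on_def)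

lemma linear_iso_swap:
  assumes "p < m" "q < m"
  shows "linear_iso m (\<lambda>w i. w (Transposition.transpose p q i)) (\<lambda>w i. w (Transposition.transpose p q i))"
proof -
  have "i \<ge> m \<Longrightarrow> Transposition.transpose p q i = i" for i using assms by (auto simp: Transposition.transpose_def)
  then have "linear_on m (\<lambda>w i. w (Transposition.transpose p q i))" unfolding linear_on_def by (auto simp: mem_rvec)
  then show ?thesis by (simp add: linear_iso_def)
qed

lemma linear_iso_shear:
  assumes u: "u \<in> rvec (Suc m)"
  shows "linear_iso (Suc m) (\<lambda>w i. if i = m then w m else w i - w m * u i) (\<lambda>w i. if i = m then w m else w i + w m * u i)"
  using u unfolding linear_iso_def linear_on_def by (auto simp: mem_rvec algebra_simps fun_eq_iff)

lemma linear_iso_extend: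
  assumes B: "linear_iso m B B'"
  shows "linear_iso (Suc m) (\<lambda>w i. if i = m then w m else B (first_coords m w) i) (\<lambda>w i. if i = m then w m else B' (first_coords m w) i)"
proof -
  have lin: "linear_on (Suc m) (\<lambda>w i. if i = m then w m else B (first_coords m w) i)" if B: "linear_on m B" for B
  proof -
    have 1: "B (first_coords m w) i = 0" if "i \<ge> m" for w i
      using B first_coords_rvec[of m w] that by (auto simp: linear_on_def mem_rvec)
    have 2: "first_coords m (\<lambda>i. v i + w i) = (\<lambda>i. first_coords m v i + first_coords m w i)"
      "first_coords m (\<lambda>i. r * v i) = (\<lambda>i. r * first_coords m v i)" for v w r
      by (auto simp: first_coords_def)
    have 3: "B (first_coords m (\<lambda>i. v i + w i)) = (\<lambda>i. B (first_coords m v) i + B (first_coords m w) i)"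
       "B (first_coords m (\<lambda>i. r * v i)) = (\<lambda>i. r * B (first_coords m v) i)" for v w r
      unfolding 2 using B first_coords_rvec[of m v] first_coords_rvec[of m w] unfolding linear_on_def by meson+
    show ?thesis unfolding linear_on_def 3 using 1 by (auto simp: mem_rvec)
  qed
  have inv: "(\<lambda>i. if i = m then (\<lambda>i. if i = m then w m else B (first_coords m w) i) m
      else B' (first_coords m (\<lambda>i. if i = m then w m else B (first_coords m w) i)) i) = w"
    if B: "linear_iso m B B'" and w: "w \<in> rvec (Suc m)" for B B' w
  proof -
    have "B (first_coords m w) \<in> rvec m" using B first_coords_rvec by (auto simp: linear_iso_def linear_on_def)
    then have "first_coords m (\<lambda>i. if i = m then w m else B (first_coords m w) i) = B (first_coords m w)"
      by (auto simp: first_coords_def mem_rvec)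
    moreover have "B' (B (first_coords m w)) = first_coords m w" using B first_coords_rvec by (auto simp: linear_iso_def)
    ultimately show ?thesis using w by (auto simp: first_coords_def mem_rvec fun_eq_iff)
  qed
  have B': "linear_iso m B' B" using B by (simp add: linear_iso_def)
  show ?thesis
    unfolding linear_iso_def
  proof (intro conjI ballI)
    show "linear_on (Suc m) (\<lambda>w i. if i = m then w m else B (first_coords m w) i)"
      "linear_on (Suc m) (\<lambda>w i. if i = m then w m else B' (first_coords m w) i)"
      using B lin unfolding linear_iso_def by blast+
  qed (rule inv[OF B], assumption, rule inv[OF B'], assumption)
qed

text \<open>Induction on the dimension, comparing W with the hyperplane R^m of R^(m+1). If W lies in
  the hyperplane, the coordinates found there are extended by the last one. Otherwise W is the sum
  of its part in the hyperplane and a line leaving it; a shear straightens that line to the last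
  axis, and a transposition moves this axis next to the first k.\<close>

lemma adapted_coordinates:
  "linear_subspace m W \<Longrightarrow> \<exists>k B B'. k \<le> m \<and> linear_iso m B B' \<and> (\<forall>w\<in>rvec m. w \<in> W \<longleftrightarrow> B w \<in> rvec k)"
proof (induction m arbitrary: W)
  case 0
  have "w \<in> W" if "w \<in> rvec 0" for w
  proof -
    have "w = (\<lambda>i. 0)" using that by (auto simp: mem_rvec)
    then show ?thesis using 0 by (simp add: linear_subspace_def)
  qed
  moreover have "linear_iso 0 (\<lambda>w. w) (\<lambda>w. w)" by (simp add: linear_iso_def linear_on_def)
  ultimately show ?case by (intro exI[of _ 0] exI[of _ "\<lambda>w. w"]) simp
next
  case (Suc m)
  have W: "W \<subseteq> rvec (Suc m)" "\<And>v w. v \<in> W \<Longrightarrow> w \<in> W \<Longrightarrow> (\<lambda>i. v i + w i) \<in> W" "\<And>r v. v \<in> W \<Longrightarrow> (\<lambda>i. r * v i) \<in> W" "(\<lambda>i. 0) \<in> W"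
    using Suc.prems by (auto simp: linear_subspace_def)
  have "linear_subspace m (W \<inter> rvec m)" using W unfolding linear_subspace_def by (auto simp: mem_rvec)
  from Suc.IH[OF this] obtain k B B' where k: "k \<le> m" and B: "linear_iso m B B'"
    and WB: "\<And>w. w \<in> rvec m \<Longrightarrow> w \<in> W \<longleftrightarrow> B w \<in> rvec k" by blast
  let ?X = "\<lambda>w i. if i = m then w m else B (first_coords m w) i"
  have Brv: "B (first_coords m w) \<in> rvec m" for w using B first_coords_rvec by (auto simp: linear_iso_def linear_on_def)
  note X = linear_iso_extend[OF B]
  show ?case
  proof (cases "W \<subseteq> rvec m")
    case True
    have "w \<in> W \<longleftrightarrow> ?X w \<in> rvec k" if w: "w \<in> rvec (Suc m)" for w
    proof (cases "w m = 0")
      case True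
      then have wm: "w \<in> rvec m" using w unfolding mem_rvec by (metis Suc_leI le_neq_implies_less)
      then have "first_coords m w = w" by (auto simp: first_coords_def mem_rvec)
      moreover have "B w m = 0" using Brv[of w] \<open>first_coords m w = w\<close> by (simp add: mem_rvec)
      ultimately have "?X w = B w" using True by auto
      then show ?thesis using WB[OF wm] by simp
    next
      case F: False
      then have "w \<notin> W" using True by (auto simp: mem_rvec subset_iff)
      moreover have "?X w \<notin> rvec k" using F k by (auto simp: mem_rvec)
      ultimately show ?thesis by simp
    qed
    moreover have "k \<le> Suc m" using k by simp
    ultimately show ?thesis using X by blast
  next
    case False
    then obtain u0 where u0: "u0 \<in> W" "u0 \<notin> rvec m" by blast
    then have "u0 \<in> rvec (Suc m)" using W(1) by blast
    then have u0m: "u0 m \<noteq> 0" using u0(2) unfolding mem_rvec by (metis Suc_leI le_neq_implies_less)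
    \<comment> \<open>Normalised to last coordinate 1, so that subtracting w m times u moves any w
      into the hyperplane. As u lies in W, this does not affect membership in W.\<close>
    define u where "u = (\<lambda>i. inverse (u0 m) * u0 i)"
    have u: "u \<in> W" "u m = 1" using W(3)[OF u0(1)] u0m by (auto simp: u_def)
    then have urv: "u \<in> rvec (Suc m)" using W(1) by blast
    let ?S = "\<lambda>w i. if i = m then w m else w i - w m * u i"
    \<comment> \<open>After the shear the last coordinate is unconstrained on W. Exchanged with
      index k it joins the first k coordinates, whence \<open>Suc k\<close> below.\<close>
    let ?T = "\<lambda>w i. w (Transposition.transpose k m i)"
    let ?C = "\<lambda>w. ?T (?X (?S w))"
    obtain C' where C': "linear_iso (Suc m) ?C C'"
      using linear_iso_compose[OF linear_iso_swap linear_iso_compose[OF X linear_iso_shear[OF urv]], of k m] k by auto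
    have "w \<in> W \<longleftrightarrow> ?C w \<in> rvec (Suc k)" if w: "w \<in> rvec (Suc m)" for w
    proof -
      let ?w = "\<lambda>i. w i - w m * u i"
      have wrv: "?w \<in> rvec m"
        unfolding mem_rvec
      proof (intro allI impI)
        fix i assume "m \<le> i"
        then show "w i - w m * u i = 0"
          using u(2) w urv by (cases "i = m") (auto simp: mem_rvec)
      qed
      have fS: "first_coords m (?S w) = ?w"
      proof
        fix i show "first_coords m (?S w) i = ?w i"
        proof (cases "i < m")
          case True then show ?thesis by (simp add: first_coords_def)
        next
          case False
          then have "w i - w m * u i = 0" using wrv unfolding mem_rvec by (simp only: not_less)
          then show ?thesis using False by (simp only: first_coords_def if_False)
        qed
      qed
      have "w \<in> W \<longleftrightarrow> ?w \<in> W"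
      proof
        assume "w \<in> W"
        from W(2)[OF this W(3)[OF u(1), of "- w m"]] show "?w \<in> W" by simp
      next
        assume "?w \<in> W"
        from W(2)[OF this W(3)[OF u(1), of "w m"]] show "w \<in> W" by simp
      qed
      also have "\<dots> \<longleftrightarrow> B ?w \<in> rvec k" by (rule WB[OF wrv])
      also have "\<dots> \<longleftrightarrow> ?C w \<in> rvec (Suc k)"
      proof -
        have Bw: "B ?w \<in> rvec m" using Brv[of "?S w"] unfolding fS .
        have C: "?C w i = (if Transposition.transpose k m i = m then w m else B ?w (Transposition.transpose k m i))" for i unfolding fS by simp
        have tr: "Transposition.transpose k m i = m \<longleftrightarrow> i = k" for i by (auto simp: Transposition.transpose_def)
        show ?thesis
        proof
          assume B0: "B ?w \<in> rvec k"
          show "?C w \<in> rvec (Suc k)" unfolding mem_rvec C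
          proof (intro allI impI)
            fix i assume "Suc k \<le> i"
            then have "Transposition.transpose k m i \<noteq> m" "Transposition.transpose k m i \<ge> k" using k by (auto simp: Transposition.transpose_def)
            then show "(if Transposition.transpose k m i = m then w m else B ?w (Transposition.transpose k m i)) = 0" using B0 by (simp add: mem_rvec)
          qed
        next
          assume C0: "?C w \<in> rvec (Suc k)"
          show "B ?w \<in> rvec k" unfolding mem_rvec
          proof (intro allI impI)
            fix i assume i: "k \<le> i"
            show "B ?w i = 0"
            proof (cases "i \<ge> m")
              case True then show ?thesis using Bw by (simp add: mem_rvec)
            next
              case False
              have j: "Transposition.transpose k m i \<ge> Suc k" using i False by (auto simp: Transposition.transpose_def)
              have "?C w (Transposition.transpose k m i) = B ?w i" unfolding C using False by simp
              then show ?thesis using C0 j unfolding mem_rvec by metis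
            qed
          qed
        qed
      qed
      finally show ?thesis .
    qed
    moreover have "Suc k \<le> Suc m" using k by simp
    ultimately show ?thesis using C' by blast
  qed
qed

lemma adapted_matrix:
  assumes "linear_subspace m W"
  obtains k b b' where "k \<le> m" "\<And>w. w \<in> rvec m \<Longrightarrow> mv m b (mv m b' w) = w" "\<And>w. w \<in> rvec m \<Longrightarrow> mv m b' (mv m b w) = w"
    "\<And>w. w \<in> rvec m \<Longrightarrow> w \<in> W \<longleftrightarrow> mv m b w \<in> rvec k"
proof -
  obtain k B B' where k: "k \<le> m" and B: "linear_iso m B B'" and WB: "\<forall>w\<in>rvec m. w \<in> W \<longleftrightarrow> B w \<in> rvec k"
    using adapted_coordinates[OF assms] by blast
  let ?b = "\<lambda>i j. B (\<lambda>l. if l = j then 1 else 0) i" and ?b' = "\<lambda>i j. B' (\<lambda>l. if l = j then 1 else 0) i"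
  have l: "linear_on m B" "linear_on m B'" using B by (auto simp: linear_iso_def)
  have e: "mv m ?b w = B w" "mv m ?b' w = B' w" if "w \<in> rvec m" for w
    using linear_on_mv[OF l(1) that] linear_on_mv[OF l(2) that] by simp_all
  show ?thesis
  proof (rule that[of k ?b ?b'])
    fix w assume w: "w \<in> rvec m"
    have "B w \<in> rvec m" "B' w \<in> rvec m" using l w by (auto simp: linear_on_def)
    then show "mv m ?b (mv m ?b' w) = w" "mv m ?b' (mv m ?b w) = w" "w \<in> W \<longleftrightarrow> mv m ?b w \<in> rvec k"
      using w e B WB by (simp_all add: linear_iso_def)
  qed (rule k)
qed

section \<open>Images of smooth idempotents are subbundles\<close>

lemma openin_nonzero:
  assumes U: "openin (Euclidean_space k) U" and g: "continuous_on U (g :: _ \<Rightarrow> real)"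
  shows "openin (Euclidean_space k) {x \<in> U. g x \<noteq> 0}"
proof -
  have "openin (top_of_set U) (U \<inter> g -` (- {0}))"
    by (rule continuous_openin_preimage_gen[OF g]) auto
  moreover have "U \<inter> g -` (- {0}) = {x \<in> U. g x \<noteq> 0}" by auto
  ultimately have "openin (subtopology (Euclidean_space k) U) {x \<in> U. g x \<noteq> 0}"
    by (simp add: subtopology_Euclidean_space[OF openin_Euclidean_space_subset[OF U]])
  then show ?thesis using U openin_trans_full by blast
qed

lemma openin_sublevel_chart:
  assumes c: "is_chart T c" and U: "openin (Euclidean_space (chart_dim c)) U" "U \<subseteq> chart_map c ` chart_dom c"
  shows "openin T {p \<in> chart_dom c. chart_map c p \<in> U}" "chart_map c ` {p \<in> chart_dom c. chart_map c p \<in> U} = U"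
  using openin_chart_preimage[OF c U(1)] U(2) by auto

text \<open>A fibrewise linear change of bundle coordinates over the identity of the base: (y, w)
  goes to (y, Z(y) w).\<close>

definition fibre_map :: "nat \<Rightarrow> nat \<Rightarrow> ((nat \<Rightarrow> real) \<Rightarrow> nat \<Rightarrow> nat \<Rightarrow> real) \<Rightarrow> (nat \<Rightarrow> real) \<Rightarrow> nat \<Rightarrow> real" where
  "fibre_map n m Z z = append_coords n (first_coords n z) (mv m (Z (first_coords n z)) (last_coords n z))"

lemma fibre_map_coords:
  "first_coords n (fibre_map n m Z z) = first_coords n z"
  "last_coords n (fibre_map n m Z z) = mv m (Z (first_coords n z)) (last_coords n z)"
  by (simp_all add: fibre_map_def first_coords_append[OF first_coords_rvec] last_coords_append)

lemma fibre_map_cylinder: "z \<in> cylinder n m U \<Longrightarrow> fibre_map n m Z z \<in> cylinder n m U"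
  unfolding cylinder_def mem_Collect_eq fibre_map_coords by (simp add: fibre_map_def append_coords_rvec[OF mv_rvec])

lemma fibre_map_inverse:
  assumes "z \<in> cylinder n m U" "\<And>y w. y \<in> U \<Longrightarrow> w \<in> rvec m \<Longrightarrow> mv m (Y y) (mv m (Z y) w) = w"
  shows "fibre_map n m Y (fibre_map n m Z z) = z"
proof -
  have "first_coords n z \<in> U" "last_coords n z \<in> rvec m" using assms(1) last_coords_rvec by (auto simp: cylinder_def)
  then have "fibre_map n m Y (fibre_map n m Z z) = append_coords n (first_coords n z) (last_coords n z)"
    unfolding fibre_map_def[of n m Y] fibre_map_coords using assms(2) by simp
  then show ?thesis by (simp add: append_first_last)
qed

lemma C_inf_fibre_map:
  assumes U: "openin (Euclidean_space n) U" and Z: "\<And>i j. i < m \<Longrightarrow> j < m \<Longrightarrow> smooth_on n U (\<lambda>y. Z y i j)"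
  shows "C_inf (n + m) (cylinder n m U) (fibre_map n m Z)"
  unfolding C_inf_iff
proof
  fix i
  note C = openin_cylinder[OF U, of m]
  consider "i < n" | "n \<le> i" "i - n < m" | "n \<le> i" "\<not> i - n < m" by linarith
  then show "smooth_on (n + m) (cylinder n m U) (\<lambda>z. fibre_map n m Z z i)"
  proof cases
    case 1
    then show ?thesis using smooth_on_coord[OF C] by (simp add: fibre_map_def append_coords_def first_coords_def)
  next
    case 2
    have "smooth_on (n + m) (cylinder n m U) (\<lambda>z. \<Sum>j<m. Z (first_coords n z) (i - n) j * z (n + j))"
      by (intro smooth_on_sum[OF C] smooth_on_mult[OF C] smooth_on_coord[OF C] smooth_on_first_coords[OF U, of "\<lambda>y. Z y (i - n) _"] Z)
        (use 2 in auto)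
    then show ?thesis using 2 by (simp add: fibre_map_def append_coords_def mv_def last_coords_def)
  next
    case 3
    then show ?thesis using smooth_on_const[OF C] by (simp add: fibre_map_def append_coords_def mv_def)
  qed
qed

section \<open>Transport between neighbouring idempotents\<close>

lemma mv_combination:
  "mv m (\<lambda>i j. 2 * a i j - b i j - c i j + d i j) w = (\<lambda>i. 2 * mv m a w i - mv m b w i - mv m c w i + mv m d w i)"
  by (auto simp: mv_def algebra_simps sum.distrib sum_subtractf sum_distrib_left)

lemma mv_minus: "mv m a (\<lambda>i. v i - w i) = (\<lambda>i. mv m a v i - mv m a w i)"
  by (auto simp: mv_def algebra_simps sum_subtractf)

text \<open>For idempotents q and q' the map 2 q q' - q - q' + 1 = q q' + (1 - q) (1 - q') intertwines q' and q,
  and it is the identity if q = q'.  It is therefore invertible for q close to q'.\<close>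

definition transporter :: "nat \<Rightarrow> (nat \<Rightarrow> nat \<Rightarrow> real) \<Rightarrow> (nat \<Rightarrow> nat \<Rightarrow> real) \<Rightarrow> nat \<Rightarrow> nat \<Rightarrow> real" where
  "transporter m q q' = (\<lambda>i j. 2 * mm m q q' i j - q i j - q' i j + id_matrix i j)"

lemma mv_transporter:
  "w \<in> rvec m \<Longrightarrow> mv m (transporter m q q') w = (\<lambda>i. 2 * mv m q (mv m q' w) i - mv m q w i - mv m q' w i + w i)"
  unfolding transporter_def mv_combination mv_mm by (simp add: mv_id)

text \<open>Both sides equal q q': on the left 2 q q' - q - q q' + q, on the right 2 q q' - q q' -
  q' + q'.\<close>

lemma transporter_intertwines:
  assumes q: "\<And>w. w \<in> rvec m \<Longrightarrow> mv m q (mv m q w) = mv m q w" and q': "\<And>w. w \<in> rvec m \<Longrightarrow> mv m q' (mv m q' w) = mv m q' w"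
    and w: "w \<in> rvec m"
  shows "mv m q (mv m (transporter m q q') w) = mv m (transporter m q q') (mv m q' w)"
proof -
  have "mv m q (mv m (transporter m q q') w) = mv m q (\<lambda>i. (2 * mv m q (mv m q' w) i - mv m q w i) - (mv m q' w i - w i))"
    unfolding mv_transporter[OF w] by (rule arg_cong[where f = "mv m q"]) auto
  also have "\<dots> = (\<lambda>i. mv m q (mv m q' w) i)"
    unfolding mv_minus mv_scale q[OF w] q[OF mv_rvec] by auto
  also have "\<dots> = mv m (transporter m q q') (mv m q' w)"
    unfolding mv_transporter[OF mv_rvec] q'[OF w] by auto
  finally show ?thesis .
qed

text \<open>2 q - q - q + 1 = 1. Idempotency is assumed on vectors of R^m only, so the entries of
  the matrix are read off from basis vectors.\<close>

lemma transporter_self: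
  assumes "\<And>w. w \<in> rvec m \<Longrightarrow> mv m q (mv m q w) = mv m q w"
  shows "Determinant.det (jnf_mat m (transporter m q q)) = 1"
proof -
  have id: "mv m (transporter m q q) w = w" if "w \<in> rvec m" for w
    unfolding mv_transporter[OF that] assms[OF that] by auto
  have "transporter m q q i j = id_matrix i j" if "i < m" "j < m" for i j
  proof -
    have "(\<lambda>l. if l = j then 1 else 0) \<in> rvec m" using that by (auto simp: mem_rvec)
    from id[OF this] show ?thesis using mv_unit[OF that(2,1), of "transporter m q q"] by (simp add: id_matrix_def)
  qed
  then have "jnf_mat m (transporter m q q) = 1\<^sub>m m"
    by (intro eq_matI) (auto simp: jnf_mat_def id_matrix_def)
  then show ?thesis by simp
qed

section \<open>Smooth endomorphisms of a pulled back tangent bundle\<close>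

context tangent_along_map
begin

text \<open>Smoothness is expressed by matrix entries as functions of the base coordinates, because
  determinants and cofactors of these matrices will be taken. Matrices are asked for over those
  charts c that f maps into the chart d.\<close>

definition smooth_endo :: "('a \<Rightarrow> 'b tvec \<Rightarrow> 'b tvec) \<Rightarrow> bool" where
  "smooth_endo Q \<longleftrightarrow>
    (\<forall>x\<in>mpoints M. (\<forall>v\<in>tangent_space N (f x). Q x v \<in> tangent_space N (f x) \<and> (\<forall>r. Q x (tscale r v) = tscale r (Q x v)) \<and>
       (\<forall>w\<in>tangent_space N (f x). Q x (tadd v w) = tadd (Q x v) (Q x w)))) \<and>
    (\<forall>c\<in>atlas M. \<forall>d\<in>atlas N. chart_dom c \<subseteq> f -` chart_dom d \<longrightarrow>
      (\<exists>a. (\<forall>x\<in>chart_dom c. \<forall>v\<in>tangent_space N (f x). Q x v d = mv (chart_dim d) (a x) (v d)) \<and>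
        (\<forall>i<chart_dim d. \<forall>j<chart_dim d. smooth_on (chart_dim c) (chart_map c ` chart_dom c) (\<lambda>y. a (chart_inv c y) i j))))"

lemma smooth_endo_mem: "smooth_endo Q \<Longrightarrow> x \<in> mpoints M \<Longrightarrow> v \<in> tangent_space N (f x) \<Longrightarrow> Q x v \<in> tangent_space N (f x)"
  and smooth_endo_tscale: "smooth_endo Q \<Longrightarrow> x \<in> mpoints M \<Longrightarrow> v \<in> tangent_space N (f x) \<Longrightarrow> Q x (tscale r v) = tscale r (Q x v)"
  and smooth_endo_tadd: "smooth_endo Q \<Longrightarrow> x \<in> mpoints M \<Longrightarrow> v \<in> tangent_space N (f x) \<Longrightarrow> w \<in> tangent_space N (f x) \<Longrightarrow>
     Q x (tadd v w) = tadd (Q x v) (Q x w)"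
  by (simp_all add: smooth_endo_def)

lemma smooth_endo_matrix:
  assumes "smooth_endo Q" "c \<in> atlas M" "d \<in> atlas N" "chart_dom c \<subseteq> f -` chart_dom d"
  shows "\<exists>a. (\<forall>x\<in>chart_dom c. \<forall>v\<in>tangent_space N (f x). Q x v d = mv (chart_dim d) (a x) (v d)) \<and>
        (\<forall>i<chart_dim d. \<forall>j<chart_dim d. smooth_on (chart_dim c) (chart_map c ` chart_dom c) (\<lambda>y. a (chart_inv c y) i j))"
  using assms by (simp add: smooth_endo_def)

lemma openin_chart_range: "c \<in> atlas M \<Longrightarrow> openin (Euclidean_space (chart_dim c)) (chart_map c ` chart_dom c)"
  by (rule openin_chart_image[OF charted_space_is_chart[OF MC] is_chart_dom[OF charted_space_is_chart[OF MC]] subset_refl])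

lemma chart_dom_points: "c \<in> atlas M \<Longrightarrow> chart_dom c \<subseteq> mpoints M"
  by (rule openin_subset[OF is_chart_dom[OF charted_space_is_chart[OF MC]]])

lemma smooth_endo_id: "smooth_endo (\<lambda>x v. v)"
proof -
  have "\<exists>a. (\<forall>x\<in>chart_dom c. \<forall>v\<in>tangent_space N (f x). v d = mv (chart_dim d) (a x) (v d)) \<and>
        (\<forall>i<chart_dim d. \<forall>j<chart_dim d. smooth_on (chart_dim c) (chart_map c ` chart_dom c) (\<lambda>y. a (chart_inv c y) i j))"
    if c: "c \<in> atlas M" and d: "d \<in> atlas N" and sub: "chart_dom c \<subseteq> f -` chart_dom d" for c d
  proof (intro exI[of _ "\<lambda>x. id_matrix"] conjI ballI allI impI)
    fix x v assume "x \<in> chart_dom c" and v: "v \<in> tangent_space N (f x)"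
    then have "v d \<in> rvec (chart_dim d)" using sub d by (intro tangent_space_rvec[OF v]) (auto simp: charts_at_iff)
    then show "v d = mv (chart_dim d) id_matrix (v d)" by (simp add: mv_id)
  qed (rule smooth_on_const[OF openin_chart_range[OF c]])
  then show ?thesis unfolding smooth_endo_def by auto
qed

lemma smooth_endo_compose:
  assumes Q: "smooth_endo Q" and R: "smooth_endo R"
  shows "smooth_endo (\<lambda>x v. Q x (R x v))"
  unfolding smooth_endo_def
proof (rule conjI)
  show "\<forall>x\<in>mpoints M. (\<forall>v\<in>tangent_space N (f x). Q x (R x v) \<in> tangent_space N (f x) \<and> (\<forall>r. Q x (R x (tscale r v)) = tscale r (Q x (R x v))) \<and>
       (\<forall>w\<in>tangent_space N (f x). Q x (R x (tadd v w)) = tadd (Q x (R x v)) (Q x (R x w))))"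
    by (simp add: smooth_endo_mem[OF Q] smooth_endo_mem[OF R] smooth_endo_tscale[OF Q] smooth_endo_tscale[OF R] smooth_endo_tadd[OF Q] smooth_endo_tadd[OF R])
  show "\<forall>c\<in>atlas M. \<forall>d\<in>atlas N. chart_dom c \<subseteq> f -` chart_dom d \<longrightarrow>
      (\<exists>a. (\<forall>x\<in>chart_dom c. \<forall>v\<in>tangent_space N (f x). Q x (R x v) d = mv (chart_dim d) (a x) (v d)) \<and>
        (\<forall>i<chart_dim d. \<forall>j<chart_dim d. smooth_on (chart_dim c) (chart_map c ` chart_dom c) (\<lambda>y. a (chart_inv c y) i j)))"
  proof (intro ballI impI)
    fix c d assume c: "c \<in> atlas M" and d: "d \<in> atlas N" and sub: "chart_dom c \<subseteq> f -` chart_dom d"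
    let ?m = "chart_dim d"
    obtain a where a': "\<forall>x\<in>chart_dom c. \<forall>v\<in>tangent_space N (f x). Q x v d = mv ?m (a x) (v d)"
      "\<forall>i<?m. \<forall>j<?m. smooth_on (chart_dim c) (chart_map c ` chart_dom c) (\<lambda>y. a (chart_inv c y) i j)"
      using smooth_endo_matrix[OF Q c d sub] by (elim exE conjE) (rule that; assumption)
    note a = a'(1)[rule_format] a'(2)[rule_format]
    obtain b where b': "\<forall>x\<in>chart_dom c. \<forall>v\<in>tangent_space N (f x). R x v d = mv ?m (b x) (v d)"
      "\<forall>i<?m. \<forall>j<?m. smooth_on (chart_dim c) (chart_map c ` chart_dom c) (\<lambda>y. b (chart_inv c y) i j)"
      using smooth_endo_matrix[OF R c d sub] by (elim exE conjE) (rule that; assumption)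
    note b = b'(1)[rule_format] b'(2)[rule_format]
    show "\<exists>a. (\<forall>x\<in>chart_dom c. \<forall>v\<in>tangent_space N (f x). Q x (R x v) d = mv ?m (a x) (v d)) \<and>
        (\<forall>i<?m. \<forall>j<?m. smooth_on (chart_dim c) (chart_map c ` chart_dom c) (\<lambda>y. a (chart_inv c y) i j))"
    proof (intro exI[of _ "\<lambda>x. mm ?m (a x) (b x)"] conjI ballI allI impI)
      fix x v assume x: "x \<in> chart_dom c" and v: "v \<in> tangent_space N (f x)"
      then have "R x v \<in> tangent_space N (f x)" using smooth_endo_mem[OF R] chart_dom_points[OF c] by blast
      then show "Q x (R x v) d = mv ?m (mm ?m (a x) (b x)) (v d)" using a(1)[OF x] b(1)[OF x v] by (simp add: mv_mm)
    next
      fix i j assume "i < ?m" "j < ?m"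
      then show "smooth_on (chart_dim c) (chart_map c ` chart_dom c) (\<lambda>y. mm ?m (a (chart_inv c y)) (b (chart_inv c y)) i j)"
        unfolding mm_def
        by (intro smooth_on_sum[OF openin_chart_range[OF c]] smooth_on_mult[OF openin_chart_range[OF c]] a(2) b(2)) auto
    qed
  qed
qed

text \<open>As \<sigma> fixes the points f x, its tangent maps there are endomorphisms of the
  fibres, with the Jacobian of \<sigma> at f x as matrix. The entries are partial derivatives of a
  smooth map composed with f. It will be applied to \<sigma> = s_j d_j.\<close>

lemma smooth_endo_complement:
  assumes \<sigma>: "smooth_map N N \<sigma>" and fix_f: "\<And>x. x \<in> mpoints M \<Longrightarrow> \<sigma> (f x) = f x"
  shows "smooth_endo (\<lambda>x v. tadd v (tscale (-1) (tangent_map N N \<sigma> (f x) v)))"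
  unfolding smooth_endo_def
proof (rule conjI)
  show "\<forall>x\<in>mpoints M. (\<forall>v\<in>tangent_space N (f x). tadd v (tscale (-1) (tangent_map N N \<sigma> (f x) v)) \<in> tangent_space N (f x) \<and>
     (\<forall>r. tadd (tscale r v) (tscale (-1) (tangent_map N N \<sigma> (f x) (tscale r v))) = tscale r (tadd v (tscale (-1) (tangent_map N N \<sigma> (f x) v)))) \<and>
     (\<forall>w\<in>tangent_space N (f x). tadd (tadd v w) (tscale (-1) (tangent_map N N \<sigma> (f x) (tadd v w))) =
        tadd (tadd v (tscale (-1) (tangent_map N N \<sigma> (f x) v))) (tadd w (tscale (-1) (tangent_map N N \<sigma> (f x) w)))))"
  proof (intro ballI conjI allI)
    fix x v assume x: "x \<in> mpoints M" and v: "v \<in> tangent_space N (f x)"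
    have "tangent_map N N \<sigma> (f x) v \<in> tangent_space N (f x)"
      using tangent_map_mem[OF N N \<sigma> smooth_map_points[OF f x] v] fix_f[OF x] by simp
    then show "tadd v (tscale (-1) (tangent_map N N \<sigma> (f x) v)) \<in> tangent_space N (f x)"
      by (rule tangent_space_tadd[OF v tangent_space_tscale])
  qed (auto simp: tangent_map_tadd tangent_map_tscale, auto simp: tadd_def tscale_def algebra_simps)
  show "\<forall>c\<in>atlas M. \<forall>d\<in>atlas N. chart_dom c \<subseteq> f -` chart_dom d \<longrightarrow>
      (\<exists>a. (\<forall>x\<in>chart_dom c. \<forall>v\<in>tangent_space N (f x). tadd v (tscale (-1) (tangent_map N N \<sigma> (f x) v)) d = mv (chart_dim d) (a x) (v d)) \<and>
        (\<forall>i<chart_dim d. \<forall>j<chart_dim d. smooth_on (chart_dim c) (chart_map c ` chart_dom c) (\<lambda>y. a (chart_inv c y) i j)))"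
  proof (intro ballI impI)
    fix c d assume c: "c \<in> atlas M" and d: "d \<in> atlas N" and sub: "chart_dom c \<subseteq> f -` chart_dom d"
    let ?m = "chart_dim d"
    note chc = charted_space_is_chart[OF MC c] and chd = charted_space_is_chart[OF NC d]
    let ?a = "\<lambda>x i j. id_matrix i j - partial_deriv j (\<lambda>y. local_rep d d \<sigma> y i) (chart_map d (f x))"
    show "\<exists>a. (\<forall>x\<in>chart_dom c. \<forall>v\<in>tangent_space N (f x). tadd v (tscale (-1) (tangent_map N N \<sigma> (f x) v)) d = mv ?m (a x) (v d)) \<and>
        (\<forall>i<?m. \<forall>j<?m. smooth_on (chart_dim c) (chart_map c ` chart_dom c) (\<lambda>y. a (chart_inv c y) i j))"
    proof (intro exI[of _ ?a] conjI ballI allI impI)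
      fix x v assume x: "x \<in> chart_dom c" and v: "v \<in> tangent_space N (f x)"
      have xM: "x \<in> mpoints M" using chart_dom_points[OF c] x by blast
      have dat: "d \<in> charts_at N (f x)" "d \<in> charts_at N (\<sigma> (f x))" using sub x d fix_f[OF xM] by (auto simp: charts_at_iff)
      have T: "tangent_map N N \<sigma> (f x) v d = differential ?m (local_rep d d \<sigma>) (chart_map d (f x)) (v d)"
        by (rule tangent_map_eq[OF N N \<sigma> smooth_map_points[OF f xM] v dat])
      have rv: "v d \<in> rvec ?m" "differential ?m (local_rep d d \<sigma>) (chart_map d (f x)) (v d) \<in> rvec ?m"
        using tangent_space_rvec[OF v dat(1)] differential_local_rep_rvec[OF NC NC \<sigma> dat] by auto
      show "tadd v (tscale (-1) (tangent_map N N \<sigma> (f x) v)) d = mv ?m (?a x) (v d)"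
      proof
        fix i
        have L: "tadd v (tscale (-1) (tangent_map N N \<sigma> (f x) v)) d i = v d i - differential ?m (local_rep d d \<sigma>) (chart_map d (f x)) (v d) i"
          by (simp add: tadd_def tscale_def T)
        show "tadd v (tscale (-1) (tangent_map N N \<sigma> (f x) v)) d i = mv ?m (?a x) (v d) i"
        proof (cases "i < ?m")
          case True
          have "mv ?m (?a x) (v d) i = mv ?m id_matrix (v d) i - differential ?m (local_rep d d \<sigma>) (chart_map d (f x)) (v d) i"
            using True by (simp add: mv_def differential_def left_diff_distrib sum_subtractf)
          then show ?thesis unfolding L mv_id[OF rv(1)] by simp
        next
          case False
          then show ?thesis unfolding L using rv by (simp add: mem_rvec mv_def)
        qed
      qed
    next
      fix i j assume ij: "i < ?m" "j < ?m"
      note U = openin_chart_range[OF c]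
      let ?V = "chart_map d ` (chart_dom d \<inter> \<sigma> -` chart_dom d)"
      have V: "openin (Euclidean_space ?m) ?V"
        by (rule openin_chart_image[OF chd openin_vimage_chart[OF smooth_map_continuous[OF \<sigma>] is_chart_dom[OF chd] is_chart_dom[OF chd]] Int_lower1])
      have "chart_smooth d d \<sigma> (chart_dom d \<inter> \<sigma> -` chart_dom d)" by (rule smooth_map_chart_smooth[OF \<sigma> d d])
      then have "smooth_on ?m ?V (partial_deriv j (\<lambda>y. local_rep d d \<sigma> y i))"
        by (intro smooth_on_partial_deriv ij) (simp add: chart_smooth_def C_inf_iff)
      moreover have "chart_dom c \<inter> f -` chart_dom d = chart_dom c" using sub by blast
      then have "C_inf (chart_dim c) (chart_map c ` chart_dom c) (local_rep c d f)"
        using smooth_map_chart_smooth[OF f c d] by (simp add: chart_smooth_def)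
      moreover have "local_rep c d f y \<in> ?V" if y: "y \<in> chart_map c ` chart_dom c" for y
      proof -
        obtain x where x: "x \<in> chart_dom c" "y = chart_map c x" using y by blast
        have "\<sigma> (f x) = f x" using fix_f chart_dom_points[OF c] x(1) by blast
        then have "f x \<in> chart_dom d \<inter> \<sigma> -` chart_dom d" using sub x(1) by auto
        then show ?thesis unfolding x(2) local_rep_chart_map[OF chc x(1)] by (rule imageI)
      qed
      ultimately have "smooth_on (chart_dim c) (chart_map c ` chart_dom c) (\<lambda>y. partial_deriv j (\<lambda>y. local_rep d d \<sigma> y i) (local_rep c d f y))"
        by (intro smooth_on_compose[OF U V, where g = "partial_deriv j (\<lambda>y. local_rep d d \<sigma> y i)" and h = "local_rep c d f"]) (auto simp: C_inf_iff)
      then show "smooth_on (chart_dim c) (chart_map c ` chart_dom c) (\<lambda>y. ?a (chart_inv c y) i j)"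
        unfolding local_rep_eq[of c d f] by (intro smooth_on_diff[OF U] smooth_on_const[OF U])
    qed
  qed
qed

text \<open>With q(x) the matrix of Q over x, let A(x) be the transporter from q(x0) to q(x), and b
  a linear change of coordinates taking the fixed space of q(x0) to R^k. In the fibre coordinates
  z(x) = b A(x)^(-1) being fixed by q(x) means lying in R^k, for all x near x0. The conclusion
  retains the formula of the chart, since the chart it induces on S must be recognised as a bundle
  chart.\<close>

lemma idempotent_slice:
  assumes Q: "smooth_endo Q" and idem: "\<forall>x\<in>mpoints M. \<forall>v\<in>tangent_space N (f x). Q x (Q x v) = Q x v"
    and x0: "x0 \<in> mpoints M"
  defines "S \<equiv> {e \<in> P. Q (fst e) (snd e) = snd e}"
  shows "\<exists>c d b k z. x0 \<in> chart_dom c \<and> c \<in> atlas M \<and> slice_chart (total E) S (chart_dim c + k) b \<and> chart_dom b = {e \<in> P. fst e \<in> chart_dom c} \<and>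
     (\<forall>e\<in>chart_dom b. chart_map b e = append_coords (chart_dim c) (chart_map c (fst e)) (mv (chart_dim d) (z (fst e)) (snd e d))) \<and>
     (\<forall>e\<in>chart_dom b \<inter> S. mv (chart_dim d) (z (fst e)) (snd e d) \<in> rvec k) \<and>
     chart_map b ` (chart_dom b \<inter> S) = cylinder (chart_dim c) k (chart_map c ` chart_dom c)"
proof -
  obtain c0 d where c0: "x0 \<in> chart_dom c0" "c0 \<in> atlas M" and d: "d \<in> atlas N" and sub: "chart_dom c0 \<subseteq> f -` chart_dom d"
    using bundle_chart_at[OF x0] .
  define n m where "n = chart_dim c0" and "m = chart_dim d"
  note ch = charted_space_is_chart[OF MC c0(2)]
  obtain a where a': "\<forall>x\<in>chart_dom c0. \<forall>v\<in>tangent_space N (f x). Q x v d = mv m (a x) (v d)"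
      "\<forall>i<m. \<forall>j<m. smooth_on n (chart_map c0 ` chart_dom c0) (\<lambda>y. a (chart_inv c0 y) i j)"
      using smooth_endo_matrix[OF Q c0(2) d sub, folded n_def m_def] by (elim exE conjE) (rule that; assumption)
    note a = a'(1)[rule_format] a'(2)[rule_format]
  define A where "A x = transporter m (a x) (a x0)" for x
  have dat: "d \<in> charts_at N (f x)" if "x \<in> chart_dom c0" for x using that sub d by (auto simp: charts_at_iff)
  have xM: "x \<in> mpoints M" if "x \<in> chart_dom c0" for x using that chart_dom_points[OF c0(2)] by blast
  have Qmem: "Q x v \<in> tangent_space N (f x)" if "x \<in> chart_dom c0" "v \<in> tangent_space N (f x)" for x v
    by (rule smooth_endo_mem[OF Q xM[OF that(1)] that(2)])
  \<comment> \<open>Every w in R^m is the coordinate vector of a tangent vector, so idempotency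
    passes from Q to its matrices.\<close>
  have idm: "mv m (a x) (mv m (a x) w) = mv m (a x) w" if x: "x \<in> chart_dom c0" and w: "w \<in> rvec m" for x w
  proof -
    let ?v = "tangent_vec N (f x) d w"
    have v: "?v \<in> tangent_space N (f x)" "?v d = w" using tangent_vec[OF N dat[OF x]] w by (auto simp: m_def)
    have "Q x (Q x ?v) d = mv m (a x) (mv m (a x) w)" using a(1)[OF x Qmem[OF x v(1)]] a(1)[OF x v(1)] v(2) by simp
    moreover have "Q x (Q x ?v) d = mv m (a x) w" using idem[rule_format, OF xM[OF x] v(1)] a(1)[OF x v(1)] v(2) by simp
    ultimately show ?thesis by simp
  qed
  let ?U0 = "chart_map c0 ` chart_dom c0"
  have U0: "openin (Euclidean_space n) ?U0" unfolding n_def by (rule openin_chart_range[OF c0(2)])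
  have A_smooth: "smooth_on n ?U0 (\<lambda>y. A (chart_inv c0 y) i j)" if ij: "i < m" "j < m" for i j
    unfolding A_def transporter_def mm_def
    by (intro smooth_on_add[OF U0] smooth_on_diff[OF U0] smooth_on_mult[OF U0] smooth_on_sum[OF U0] smooth_on_const[OF U0] a(2) ij) auto
  let ?D = "\<lambda>y. Determinant.det (jnf_mat m (A (chart_inv c0 y)))"
  have D: "smooth_on n ?U0 ?D" by (rule smooth_on_det[OF U0 A_smooth])
  \<comment> \<open>Invertibility of the transporter is an open condition, and at x0 its determinant
    is 1.\<close>
  define U where "U = {y \<in> ?U0. ?D y \<noteq> 0}"
  have U: "openin (Euclidean_space n) U" unfolding U_def by (rule openin_nonzero[OF U0 smooth_on_continuous_on[OF D U0]])
  have Usub: "U \<subseteq> ?U0" by (auto simp: U_def)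
  define W where "W = {x \<in> chart_dom c0. chart_map c0 x \<in> U}"
  have W: "openin (mtop M) W" "chart_map c0 ` W = U"
    unfolding W_def using openin_sublevel_chart[OF ch _ Usub] U by (auto simp: n_def)
  have Wsub: "W \<subseteq> chart_dom c0" by (auto simp: W_def)
  have x0W: "x0 \<in> W"
    using c0(1) transporter_self[OF idm[OF c0(1)]] chart_inv_map[OF ch c0(1)] by (simp add: W_def U_def A_def)
  have det: "Determinant.det (jnf_mat m (A x)) \<noteq> 0" if "x \<in> W" for x
  proof -
    have "x \<in> chart_dom c0" "?D (chart_map c0 x) \<noteq> 0" using that unfolding W_def U_def by blast+
    then show ?thesis by (simp only: chart_inv_map[OF ch] not_False_eq_True)
  qed
  let ?c = "change_chart c0 n W (\<lambda>y. y)"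
  have c: "?c \<in> atlas M" unfolding n_def by (rule restrict_chart_atlas[OF M c0(2) W(1) Wsub])
  have csel: "chart_dim ?c = n" "chart_dom ?c = W" "\<And>x. x \<in> W \<Longrightarrow> chart_map ?c x = chart_map c0 x"
    by (auto simp: change_chart_def)
  have cim: "chart_map ?c ` chart_dom ?c = U" unfolding csel(2) using csel(3) W(2) by simp
  have "linear_subspace m {w \<in> rvec m. mv m (a x0) w = w}"
    unfolding linear_subspace_def by (auto simp: mv_add mv_scale mem_rvec) (auto simp: mv_def)
  then obtain k b b' where k: "k \<le> m" and bb': "\<And>w. w \<in> rvec m \<Longrightarrow> mv m b (mv m b' w) = w" "\<And>w. w \<in> rvec m \<Longrightarrow> mv m b' (mv m b w) = w"
    and bk: "\<And>w. w \<in> rvec m \<Longrightarrow> w \<in> {w \<in> rvec m. mv m (a x0) w = w} \<longleftrightarrow> mv m b w \<in> rvec k"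
    using adapted_matrix by blast
  define z where "z x = mm m b (matrix_inverse m (A x))" for x
  \<comment> \<open>\<open>Y\<close> = A b' is the pointwise inverse of \<open>Z\<close> = b A^(-1);
    both are smooth in the base coordinates, as \<open>change_chart_atlas\<close> requires.\<close>
  define Z Y where "Z y = z (chart_inv c0 y)" and "Y y = mm m (A (chart_inv c0 y)) b'" for y
  have detU: "?D y \<noteq> 0" if "y \<in> U" for y using that by (simp add: U_def)
  have ZY: "mv m (Y y) (mv m (Z y) w) = w" "mv m (Z y) (mv m (Y y) w) = w" if y: "y \<in> U" and w: "w \<in> rvec m" for y w
    unfolding Z_def Y_def z_def mv_mm using mv_matrix_inverse[OF detU[OF y]] bb' w mv_rvec by simp_all
  have AU: "smooth_on n U (\<lambda>y. A (chart_inv c0 y) i j)" if "i < m" "j < m" for i j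
    by (rule smooth_on_subset[OF U0 Usub A_smooth[OF that]])
  have Zs: "smooth_on n U (\<lambda>y. Z y i j)" if ij: "i < m" "j < m" for i j
    unfolding Z_def z_def mm_def
    by (intro smooth_on_sum[OF U] smooth_on_mult[OF U] smooth_on_const[OF U] smooth_on_matrix_inverse[OF U AU detU] ij) auto
  have Ys: "smooth_on n U (\<lambda>y. Y y i j)" if ij: "i < m" "j < m" for i j
    unfolding Y_def mm_def
    by (intro smooth_on_sum[OF U] smooth_on_mult[OF U] smooth_on_const[OF U] AU ij) auto
  let ?t = "tchart c0 d" let ?W = "{e \<in> P. fst e \<in> W}" let ?C = "cylinder n m U"
  have tim: "chart_map ?t ` ?W = ?C"
    using tchart_image[OF c0(2) d, of W] Wsub sub W(2) by (auto simp: n_def m_def)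
  have Wt: "?W \<subseteq> chart_dom ?t" using Wsub sub by (auto simp: tangent_along_chart_sel)
  have dimt: "chart_dim ?t = n + m" by (simp add: tangent_along_chart_sel n_def m_def)
  have Zim: "fibre_map n m Z ` ?C = ?C"
  proof (intro equalityI subsetI)
    fix y assume y: "y \<in> ?C"
    have "fibre_map n m Z (fibre_map n m Y y) = y" by (rule fibre_map_inverse[OF y ZY(2)])
    then show "y \<in> fibre_map n m Z ` ?C" using fibre_map_cylinder[OF y, of Y] by (metis imageI)
  qed (auto intro: fibre_map_cylinder)
  let ?b = "change_chart ?t (n + m) ?W (fibre_map n m Z)"
  have bat: "?b \<in> atlas (total E)"
  proof (rule change_chart_atlas[OF smooth_manifold_E tchart_atlas[OF c0(2) d] openin_E_preimage[OF W(1)] Wt openin_cylinder[OF U]])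
    show "fibre_map n m Z ` (chart_map ?t ` ?W) = ?C" unfolding tim by (rule Zim)
    show "C_inf (chart_dim ?t) (chart_map ?t ` ?W) (fibre_map n m Z)" unfolding tim dimt by (rule C_inf_fibre_map[OF U Zs])
    show "C_inf (n + m) ?C (fibre_map n m Y)" by (rule C_inf_fibre_map[OF U Ys])
    show "fibre_map n m Y (fibre_map n m Z y) = y" if "y \<in> chart_map ?t ` ?W" for y
      using that unfolding tim by (rule fibre_map_inverse[OF _ ZY(1)])
  qed
  have bsel: "chart_dim ?b = n + m" "chart_dom ?b = ?W" by (simp_all add: change_chart_def)
  have bmap: "chart_map ?b e = append_coords n (chart_map ?c (fst e)) (mv m (z (fst e)) (snd e d))" if e: "e \<in> ?W" for e
  proof -
    have x: "fst e \<in> W" "fst e \<in> chart_dom c0" using e Wsub by auto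
    have "chart_map ?t e = append_coords n (chart_map c0 (fst e)) (snd e d)"
      using tangent_along_chart_map[of e M N f c0 d] e Wt by (auto simp: n_def)
    moreover have "chart_map c0 (fst e) \<in> rvec n" unfolding n_def by (rule is_chart_rvec[OF ch x(2)])
    ultimately show ?thesis
      using e x by (simp add: change_chart_def fibre_map_def first_coords_append last_coords_append Z_def chart_inv_map[OF ch])
  qed
  have rv: "snd e d \<in> rvec m" if "e \<in> ?W" for e
    unfolding m_def using that Wsub dat by (intro tangent_space_rvec[of _ N "f (fst e)"]) (auto simp: tangent_along_points_iff)
  have inS: "e \<in> S \<longleftrightarrow> mv m (z (fst e)) (snd e d) \<in> rvec k" if e: "e \<in> ?W" for e
  proof -
    let ?x = "fst e" and ?v = "snd e"
    have x: "?x \<in> W" "?x \<in> chart_dom c0" and v: "?v \<in> tangent_space N (f ?x)" using e Wsub by (auto simp: tangent_along_points_iff)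
    \<comment> \<open>The vector transported back to the fibre over x0: by intertwining, being fixed
      by q(x) becomes being fixed by q(x0).\<close>
    define u where "u = mv m (matrix_inverse m (A ?x)) (?v d)"
    have u: "u \<in> rvec m" "mv m (A ?x) u = ?v d" unfolding u_def using mv_rvec mv_matrix_inverse(1)[OF det[OF x(1)] rv[OF e]] by auto
    have "e \<in> S \<longleftrightarrow> Q ?x ?v = ?v" using e by (simp add: S_def)
    also have "\<dots> \<longleftrightarrow> Q ?x ?v d = ?v d"
      using tangent_space_eqI[OF Qmem[OF x(2) v] v dat[OF x(2)]] by auto
    also have "\<dots> \<longleftrightarrow> mv m (a ?x) (mv m (A ?x) u) = mv m (A ?x) u" using a(1)[OF x(2) v] u(2) by simp
    also have "\<dots> \<longleftrightarrow> mv m (A ?x) (mv m (a x0) u) = mv m (A ?x) u"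
      using transporter_intertwines[OF idm[OF x(2)] idm[OF c0(1)] u(1)] by (simp add: A_def)
    also have "\<dots> \<longleftrightarrow> mv m (a x0) u = u"
    proof
      assume "mv m (A ?x) (mv m (a x0) u) = mv m (A ?x) u"
      then have "mv m (matrix_inverse m (A ?x)) (mv m (A ?x) (mv m (a x0) u)) = mv m (matrix_inverse m (A ?x)) (mv m (A ?x) u)" by simp
      then show "mv m (a x0) u = u"
        unfolding mv_matrix_inverse(2)[OF det[OF x(1)] mv_rvec] mv_matrix_inverse(2)[OF det[OF x(1)] u(1)] .
    qed simp
    also have "\<dots> \<longleftrightarrow> mv m b u \<in> rvec k" using bk[OF u(1)] u(1) by simp
    also have "mv m b u = mv m (z ?x) (?v d)" by (simp add: u_def z_def mv_mm)
    finally show ?thesis .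
  qed
  have app: "append_coords n x y \<in> rvec (n + k) \<longleftrightarrow> y \<in> rvec k" for x y
  proof
    assume "append_coords n x y \<in> rvec (n + k)"
    from last_coords_rvec[OF this] show "y \<in> rvec k" by (simp add: last_coords_append)
  qed (rule append_coords_rvec)
  have bim: "chart_map ?b ` ?W = ?C"
  proof -
    have "chart_map ?b ` ?W = fibre_map n m Z ` (chart_map ?t ` ?W)" by (auto simp: change_chart_def)
    also have "\<dots> = ?C" unfolding tim by (rule Zim)
    finally show ?thesis .
  qed
  have slice: "chart_map ?b ` (?W \<inter> S) = chart_map ?b ` ?W \<inter> rvec (n + k)"
  proof -
    have *: "chart_map ?b e \<in> rvec (n + k) \<longleftrightarrow> e \<in> S" if "e \<in> ?W" for e
      unfolding bmap[OF that] app using inS[OF that] by blast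
    show ?thesis
    proof (intro equalityI subsetI)
      fix y assume "y \<in> chart_map ?b ` (?W \<inter> S)"
      then obtain e where "e \<in> ?W" "e \<in> S" "y = chart_map ?b e" by blast
      then show "y \<in> chart_map ?b ` ?W \<inter> rvec (n + k)" using * by blast
    next
      fix y assume y: "y \<in> chart_map ?b ` ?W \<inter> rvec (n + k)"
      then obtain e where "e \<in> ?W" "y = chart_map ?b e" by blast
      then show "y \<in> chart_map ?b ` (?W \<inter> S)" using * y by blast
    qed
  qed
  \<comment> \<open>Cutting the cylinder by R^(n+k) leaves a cylinder with smaller fibre, so the
    induced chart has the image that a bundle chart must have.\<close>
  have "?C \<inter> rvec (n + k) = cylinder n k U"
  proof -
    have "rvec (n + k) \<subseteq> rvec (n + m)" by (rule rvec_mono) (use k in simp)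
    then show ?thesis unfolding cylinder_def by blast
  qed
  then have im: "chart_map ?b ` (chart_dom ?b \<inter> S) = cylinder (chart_dim ?c) k (chart_map ?c ` chart_dom ?c)"
    unfolding cim unfolding bsel(2) slice bim csel(1) .
  have sl: "slice_chart (total E) S (chart_dim ?c + k) ?b"
    unfolding slice_chart_def bsel csel(1) using bat k slice by simp
  show ?thesis
  proof (intro exI conjI)
    show "x0 \<in> chart_dom ?c" unfolding csel by (rule x0W)
    show "chart_dom ?b = {e \<in> P. fst e \<in> chart_dom ?c}" unfolding bsel csel ..
    show "\<forall>e\<in>chart_dom ?b. chart_map ?b e = append_coords (chart_dim ?c) (chart_map ?c (fst e)) (mv (chart_dim d) (z (fst e)) (snd e d))"
      unfolding bsel csel(1) m_def[symmetric] using bmap by blast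
    show "\<forall>e\<in>chart_dom ?b \<inter> S. mv (chart_dim d) (z (fst e)) (snd e d) \<in> rvec k"
      unfolding bsel m_def[symmetric] using inS by blast
  qed (rule c sl im)+
qed

text \<open>Each slice chart serves twice: it shows that S is embedded in the total space, and the
  chart it induces on S is a bundle chart with fibre coordinates z(x) v. The fibre dimension k is
  found separately near each point of the base.\<close>

theorem idempotent_subbundle:
  assumes Q: "smooth_endo Q" and idem: "\<forall>x\<in>mpoints M. \<forall>v\<in>tangent_space N (f x). Q x (Q x v) = Q x v"
  defines "S \<equiv> {e \<in> P. Q (fst e) (snd e) = snd e}"
  shows "smooth_subbundle E S"
proof -
  let ?T = "\<lambda>x. {v \<in> tangent_space N (f x). Q x v = v}"
  have zero: "tzero \<in> ?T x" if "x \<in> mpoints M" for x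
  proof -
    \<comment> \<open>Homogeneity with the factor 0 shows that the zero vector is fixed.\<close>
    have "Q x (tscale 0 tzero) = tscale 0 (Q x tzero)" by (rule smooth_endo_tscale[OF Q that tangent_space_tzero])
    then show ?thesis by (simp add: tangent_space_tzero) (simp add: tscale_def tzero_def)
  qed
  have add: "tadd v w \<in> ?T x" if "x \<in> mpoints M" "v \<in> ?T x" "w \<in> ?T x" for x v w
    using smooth_endo_tadd[OF Q that(1), of v w] that tangent_space_tadd[of v N "f x" w] by auto
  have scale: "tscale r v \<in> ?T x" if "x \<in> mpoints M" "v \<in> ?T x" for x v r
    using smooth_endo_tscale[OF Q that(1), of v r] that tangent_space_tscale[of v N "f x" r] by auto
  have emb: "embedded_submanifold (total E) S"
    unfolding embedded_submanifold_def
  proof (intro conjI ballI)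
    show "S \<subseteq> mpoints (total E)" unfolding E_points S_def by blast
    fix e assume e: "e \<in> S"
    then have x: "fst e \<in> mpoints M" "e \<in> P" by (auto simp: S_def tangent_along_points_iff)
    from idempotent_slice[OF Q idem x(1), folded S_def] obtain c :: "'a chart" and b k where
      "fst e \<in> chart_dom c" "slice_chart (total E) S (chart_dim c + k) b" "chart_dom b = {e \<in> P. fst e \<in> chart_dom c}" by (elim exE conjE) (rule that; assumption)
    then show "\<exists>k c. slice_chart (total E) S k c \<and> e \<in> chart_dom c" using x(2) by blast
  qed
  let ?R = "restrict_bundle E S"
  have Rsel: "total ?R = submanifold (total E) S" "base ?R = M" "proj ?R = fst" "vadd ?R = vadd E" "vzero ?R = vzero E" "vscale ?R = vscale E"
    by (simp_all add: restrict_bundle_def E_sel)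
  have Rpts: "mpoints (total ?R) = S" unfolding Rsel by (rule embedded_submanifold_points[OF emb])
  have fib: "fibre ?R x = {x} \<times> ?T x" if "x \<in> mpoints M" for x
    unfolding fibre_def Rpts Rsel(3) using that by (auto simp: S_def tangent_along_points_iff)
  have fibE: "fibre E x \<inter> S = {x} \<times> ?T x" if "x \<in> mpoints M" for x
    unfolding fibre_E[OF that] using that by (auto simp: S_def tangent_along_points_iff)
  have "vector_bundle ?R"
  proof (rule vector_bundleI)
    show "smooth_manifold (total ?R)" unfolding Rsel by (rule smooth_manifold_submanifold[OF smooth_manifold_E emb])
    show "smooth_manifold (base ?R)" unfolding Rsel by (rule M)
    show "proj ?R e \<in> mpoints (base ?R)" if "e \<in> mpoints (total ?R)" for e
      using that unfolding Rpts unfolding Rsel by (simp add: S_def tangent_along_points_iff)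
    show "real_vector_space_on (fibre ?R x) (vadd ?R) (vzero ?R x) (vscale ?R)" if "x \<in> mpoints (base ?R)" for x
    proof -
      have x: "x \<in> mpoints M" using that unfolding Rsel .
      show ?thesis unfolding fib[OF x] Rsel E_sel
        by (rule real_vector_space_on_tvec[OF zero[OF x] add[OF x] scale[OF x]])
    qed
    fix x0 assume "x0 \<in> mpoints (base ?R)"
    then have x0: "x0 \<in> mpoints M" unfolding Rsel .
    from idempotent_slice[OF Q idem x0, folded S_def] obtain c d b k z where
      c: "x0 \<in> chart_dom c" "c \<in> atlas M" and b: "slice_chart (total E) S (chart_dim c + k) b" "chart_dom b = {e \<in> P. fst e \<in> chart_dom c}" and
      bm: "\<forall>e\<in>chart_dom b. chart_map b e = append_coords (chart_dim c) (chart_map c (fst e)) (mv (chart_dim d) (z (fst e)) (snd e d))" and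
      rv: "\<forall>e\<in>chart_dom b \<inter> S. mv (chart_dim d) (z (fst e)) (snd e d) \<in> rvec k" and
      im: "chart_map b ` (chart_dom b \<inter> S) = cylinder (chart_dim c) k (chart_map c ` chart_dom c)"
      by (elim exE conjE) (rule that; assumption)
    let ?b = "induced_chart S (chart_dim c + k) b" and ?\<phi> = "\<lambda>e. mv (chart_dim d) (z (fst e)) (snd e d)"
    have "bundle_chart ?R c ?b k ?\<phi>"
      unfolding bundle_chart_def
    proof (intro conjI ballI allI)
      show "c \<in> atlas (base ?R)" unfolding Rsel by (rule c)
      show "?b \<in> atlas (total ?R)" unfolding Rsel by (rule induced_chart_atlas[OF smooth_manifold_E emb b(1)])
      show "chart_dim ?b = chart_dim c + k" by (rule induced_chart_sel)
      show "chart_dom ?b = {e \<in> mpoints (total ?R). proj ?R e \<in> chart_dom c}"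
        unfolding Rpts unfolding Rsel induced_chart_sel b(2) by (auto simp: S_def)
      show "?\<phi> e \<in> rvec k" if "e \<in> chart_dom ?b" for e using that rv unfolding induced_chart_sel by blast
      show "chart_map ?b e = append_coords (chart_dim c) (chart_map c (proj ?R e)) (?\<phi> e)" if "e \<in> chart_dom ?b" for e
        using that bm induced_chart_sel(3)[of e b S] unfolding induced_chart_sel(2) Rsel(3) by simp
      show "chart_map ?b ` chart_dom ?b = cylinder (chart_dim c) k (chart_map c ` chart_dom c)"
        unfolding induced_chart_sel(2) induced_chart_image[OF subset_refl] by (rule im)
    next
      fix x u v assume "x \<in> chart_dom c" "u \<in> fibre ?R x" "v \<in> fibre ?R x"
      then have "fst u = x" "fst v = x" by (auto simp: fibre_def Rsel)
      then have "vadd ?R u v = (x, tadd (snd u) (snd v))" unfolding Rsel E_sel by (cases u, cases v) simp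
      then show "?\<phi> (vadd ?R u v) = (\<lambda>i. ?\<phi> u i + ?\<phi> v i)"
        using \<open>fst u = x\<close> \<open>fst v = x\<close> by (simp add: tadd_def mv_add)
    next
      fix x r v assume "x \<in> chart_dom c" "v \<in> fibre ?R x"
      have "vscale ?R r v = (fst v, tscale r (snd v))" unfolding Rsel E_sel by (cases v) simp
      then show "?\<phi> (vscale ?R r v) = (\<lambda>i. r * ?\<phi> v i)" by (simp add: tscale_def mv_scale)
    qed
    then show "\<exists>c b k \<phi>. x0 \<in> chart_dom c \<and> bundle_chart ?R c b k \<phi>" using c(1) by blast
  qed
  moreover have "vzero E x \<in> S \<and> (\<forall>u\<in>fibre E x \<inter> S. \<forall>v\<in>fibre E x \<inter> S. vadd E u v \<in> S) \<and> (\<forall>r. \<forall>v\<in>fibre E x \<inter> S. vscale E r v \<in> S)"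
    if "x \<in> mpoints (base E)" for x
  proof -
    have x: "x \<in> mpoints M" using that by (simp add: E_sel)
    have inS: "(x, v) \<in> S \<longleftrightarrow> v \<in> ?T x" for v using x by (auto simp: S_def tangent_along_points_iff)
    show ?thesis unfolding fibE[OF x] E_sel using inS zero[OF x] add[OF x] scale[OF x] by simp
  qed
  ultimately show ?thesis unfolding smooth_subbundle_def using vector_bundle_E emb by blast
qed

end

section \<open>Morphisms of vector bundles\<close>

text \<open>F is kept apart from \<open>bmap\<close> because the components of a chain morphism are
  normalised outside the subbundle; agreement on A is what matters. Smoothness of
  \<open>bmap\<close> passes from the total spaces to the embedded submanifolds.\<close>

lemma (in tangent_along_square) vbundle_morphism_bmap:
  assumes A: "smooth_subbundle S.E A" and A': "smooth_subbundle S'.E A'" and im: "\<And>e. e \<in> A \<Longrightarrow> bmap e \<in> A'"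
    and F: "\<And>e. e \<in> A \<Longrightarrow> F e = bmap e"
  shows "vbundle_morphism (restrict_bundle S.E A) (restrict_bundle S'.E A') h F"
proof -
  let ?R = "restrict_bundle S.E A" and ?R' = "restrict_bundle S'.E A'"
  have emb: "embedded_submanifold (total S.E) A" "embedded_submanifold (total S'.E) A'"
    using A A' by (simp_all add: smooth_subbundle_def)
  have sel: "total ?R = submanifold (total S.E) A" "base ?R = M" "proj ?R = fst" "vadd ?R = vadd S.E" "vscale ?R = vscale S.E"
    "total ?R' = submanifold (total S'.E) A'" "base ?R' = M'" "proj ?R' = fst" "vadd ?R' = vadd S'.E" "vscale ?R' = vscale S'.E"
    by (simp_all add: restrict_bundle_def S.E_sel S'.E_sel)
  have pts: "mpoints (total ?R) = A" unfolding sel by (rule embedded_submanifold_points[OF emb(1)])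
  have charted: "charted_space (submanifold (total S.E) A)" "charted_space (submanifold (total S'.E) A')"
    by (intro smooth_manifold_charted_space smooth_manifold_submanifold S.smooth_manifold_E S'.smooth_manifold_E emb)+
  have "smooth_map (submanifold (total S.E) A) (submanifold (total S'.E) A') bmap"
    by (rule smooth_map_submanifold[OF S.smooth_manifold_E S'.smooth_manifold_E smooth_map_bmap emb]) (use im in auto)
  then have "smooth_map (total ?R) (total ?R') F"
    unfolding sel by (rule smooth_map_cong[OF charted(1) _ _ charted(2)])
      (simp add: embedded_submanifold_points[OF emb(1)] F)
  moreover have "F (vadd ?R u v) = vadd ?R' (F u) (F v)" "F (vscale ?R r v) = vscale ?R' r (F v)"
    if x: "x \<in> mpoints M" and u: "u \<in> fibre ?R x" and v: "v \<in> fibre ?R x" for x u v r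
  proof -
    have uv: "u \<in> A" "v \<in> A" "fst u = x" "fst v = x" using u v unfolding fibre_def unfolding pts unfolding sel by auto
    then have P: "u \<in> S.P" "v \<in> S.P" using emb(1) S.E_points by (auto simp: embedded_submanifold_def)
    then have "u \<in> fibre S.E x" "v \<in> fibre S.E x" using uv unfolding fibre_def S.E_points S.E_sel(3) by simp_all
    then have cl: "vadd S.E u v \<in> A" "vscale S.E r v \<in> A"
      using A x uv unfolding smooth_subbundle_def S.E_sel(2) by blast+
    have e: "vadd S.E u v = (x, tadd (snd u) (snd v))" "vscale S.E r v = (x, tscale r (snd v))"
      using uv unfolding S.E_sel by (cases u, cases v, simp)+
    show "F (vadd ?R u v) = vadd ?R' (F u) (F v)"
      unfolding sel F[OF cl(1)] F[OF uv(1)] F[OF uv(2)] unfolding e(1) S'.E_sel bmap_def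
      using uv(3,4) by (simp add: tangent_map_tadd) (auto simp: tadd_def tscale_def algebra_simps)
    show "F (vscale ?R r v) = vscale ?R' r (F v)"
      unfolding sel F[OF cl(2)] F[OF uv(2)] unfolding e(2) S'.E_sel bmap_def
      using uv(4) by (simp add: tangent_map_tscale) (auto simp: tscale_def algebra_simps)
  qed
  moreover have "proj ?R' (F e) = h (proj ?R e)" if "e \<in> A" for e
    unfolding sel F[OF that] by (simp add: bmap_def)
  ultimately show ?thesis unfolding vbundle_morphism_def pts using h sel(2,7) by auto
qed

lemma fibre_vadd_mem:
  assumes "vector_bundle E" "x \<in> mpoints (base E)" "u \<in> fibre E x" "v \<in> fibre E x"
  shows "vadd E u v \<in> fibre E x" "vscale E r v \<in> fibre E x"
proof -
  have "real_vector_space_on (fibre E x) (vadd E) (vzero E x) (vscale E)" using assms(1,2) by (simp add: vector_bundle_def)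
  then show "vadd E u v \<in> fibre E x" "vscale E r v \<in> fibre E x" using assms(3,4) by (simp_all add: real_vector_space_on_def)
qed

text \<open>Morphisms in both categories are normalised off the points of their source; this keeps
  identities and composites smooth.\<close>

lemma smooth_map_restrict:
  "smooth_manifold M \<Longrightarrow> smooth_manifold N \<Longrightarrow> smooth_map M N g \<Longrightarrow> smooth_map M N (restrict g (mpoints M))"
  by (rule smooth_map_cong[of M N g]) (auto intro: smooth_manifold_charted_space)

lemma vbundle_morphism_id:
  assumes E: "vector_bundle E"
  shows "vbundle_morphism E E (\<lambda>x\<in>mpoints (base E). x) (\<lambda>e\<in>mpoints (total E). e)"
proof -
  have man: "smooth_manifold (total E)" "smooth_manifold (base E)" and pr: "smooth_map (total E) (base E) (proj E)"
    using E by (simp_all add: vector_bundle_def)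
  have "proj E e \<in> mpoints (base E)" if "e \<in> mpoints (total E)" for e by (rule smooth_map_points[OF pr that])
  moreover have mem: "e \<in> mpoints (total E)" if "e \<in> fibre E x" for e x using that by (simp add: fibre_def)
  ultimately show ?thesis
    unfolding vbundle_morphism_def
    using smooth_map_restrict[OF man(1) man(1) smooth_map_id[OF man(1)]] smooth_map_restrict[OF man(2) man(2) smooth_map_id[OF man(2)]]
      mem[OF fibre_vadd_mem(1)[OF E]] mem[OF fibre_vadd_mem(2)[OF E]] by (simp add: mem)
qed

lemma vbundle_morphism_points:
  assumes "vbundle_morphism E E' f F" "e \<in> mpoints (total E)"
  shows "F e \<in> mpoints (total E')"
proof -
  have "smooth_map (total E) (total E') F" using assms(1) by (simp add: vbundle_morphism_def)
  then show ?thesis using assms(2) by (rule smooth_map_points)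
qed

lemma vbundle_morphism_base_points:
  assumes "vbundle_morphism E E' f F" "x \<in> mpoints (base E)"
  shows "f x \<in> mpoints (base E')"
proof -
  have "smooth_map (base E) (base E') f" using assms(1) by (simp add: vbundle_morphism_def)
  then show ?thesis using assms(2) by (rule smooth_map_points)
qed

lemma vbundle_morphism_compose:
  assumes E: "vector_bundle E" and E': "vector_bundle E'" and E'': "vector_bundle E''"
    and F: "vbundle_morphism E E' f F" and G: "vbundle_morphism E' E'' g G"
  shows "vbundle_morphism E E'' (compose (mpoints (base E)) g f) (compose (mpoints (total E)) G F)"
proof -
  have man: "smooth_manifold (total E)" "smooth_manifold (base E)" "smooth_manifold (total E')" "smooth_manifold (base E')"
     "smooth_manifold (total E'')" "smooth_manifold (base E'')" and pr: "smooth_map (total E) (base E) (proj E)"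
    using E E' E'' by (simp_all add: vector_bundle_def)
  have sF: "smooth_map (base E) (base E') f" "smooth_map (total E) (total E') F" and sG: "smooth_map (base E') (base E'') g" "smooth_map (total E') (total E'') G"
    using F G by (simp_all add: vbundle_morphism_def)
  have 1: "smooth_map (base E) (base E'') (compose (mpoints (base E)) g f)" "smooth_map (total E) (total E'') (compose (mpoints (total E)) G F)"
    unfolding compose_def
    using smooth_map_restrict[OF man(2,6) smooth_map_compose[OF man(2,4,6) sF(1) sG(1)]] smooth_map_restrict[OF man(1,5) smooth_map_compose[OF man(1,3,5) sF(2) sG(2)]] .
  have 2: "proj E'' (G (F e)) = g (f (proj E e))" if e: "e \<in> mpoints (total E)" for e
    using F G e vbundle_morphism_points[OF F e] by (simp add: vbundle_morphism_def)
  have pe: "proj E e \<in> mpoints (base E)" if "e \<in> mpoints (total E)" for e by (rule smooth_map_points[OF pr that])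
  have Ff: "F u \<in> fibre E' (f x)" if "u \<in> fibre E x" for u x
    using that F vbundle_morphism_points[OF F] by (simp add: fibre_def vbundle_morphism_def)
  have mem: "e \<in> mpoints (total E)" if "e \<in> fibre E x" for e x using that by (simp add: fibre_def)
  have 3: "G (F (vadd E u v)) = vadd E'' (G (F u)) (G (F v))" "G (F (vscale E r v)) = vscale E'' r (G (F v))"
    if x: "x \<in> mpoints (base E)" and u: "u \<in> fibre E x" and v: "v \<in> fibre E x" for x u v r
  proof -
    have "F (vadd E u v) = vadd E' (F u) (F v)" "F (vscale E r v) = vscale E' r (F v)"
      using F x u v unfolding vbundle_morphism_def by blast+
    then show "G (F (vadd E u v)) = vadd E'' (G (F u)) (G (F v))" "G (F (vscale E r v)) = vscale E'' r (G (F v))"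
      using G vbundle_morphism_base_points[OF F x] Ff[OF u] Ff[OF v] unfolding vbundle_morphism_def by metis+
  qed
  \<comment> \<open>A normalised composite can be evaluated by its formula only at points of the
    total space, so the fibres must be known to be closed under the operations.\<close>
  have cl: "vadd E u v \<in> mpoints (total E)" "vscale E r v \<in> mpoints (total E)"
    if "x \<in> mpoints (base E)" "u \<in> fibre E x" "v \<in> fibre E x" for x u v r
    using mem fibre_vadd_mem[OF E that] by blast+
  show ?thesis
    unfolding vbundle_morphism_def
  proof (intro conjI ballI allI)
    fix e assume e: "e \<in> mpoints (total E)"
    then show "proj E'' (compose (mpoints (total E)) G F e) = compose (mpoints (base E)) g f (proj E e)"
      using 2[OF e] pe[OF e] by (simp add: compose_def)
  next
    fix x u v assume x: "x \<in> mpoints (base E)" and u: "u \<in> fibre E x" and v: "v \<in> fibre E x"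
    show "compose (mpoints (total E)) G F (vadd E u v) = vadd E'' (compose (mpoints (total E)) G F u) (compose (mpoints (total E)) G F v)"
      using 3(1)[OF x u v] cl(1)[OF x u v] mem[OF u] mem[OF v] by (simp add: compose_def)
  next
    fix x r v assume x: "x \<in> mpoints (base E)" and v: "v \<in> fibre E x"
    show "compose (mpoints (total E)) G F (vscale E r v) = vscale E'' r (compose (mpoints (total E)) G F v)"
      using 3(2)[OF x v v] cl(2)[OF x v v] mem[OF v] by (simp add: compose_def)
  qed (rule 1)+
qed


section \<open>The tangent complex of a simplicial manifold\<close>

locale simplicial_mfd =
  fixes X :: "'a smfd"
  assumes X: "simplicial_manifold X"
begin

abbreviation "L \<equiv> level X"
abbreviation "pt \<equiv> iter_degen X"
abbreviation "V n x \<equiv> tangent_space (L n) (pt n x)"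
abbreviation "Tface n j x \<equiv> tangent_map (L (Suc n)) (L n) (face X (Suc n) j) (pt (Suc n) x)"
abbreviation "Tdegen n j x \<equiv> tangent_map (L n) (L (Suc n)) (degen X n j) (pt n x)"

lemma smooth_level: "smooth_manifold (L n)"
  using X by (simp add: simplicial_manifold_def)

lemma smooth_face: "j \<le> Suc n \<Longrightarrow> smooth_map (L (Suc n)) (L n) (face X (Suc n) j)"
  using X by (simp add: simplicial_manifold_def)

lemma smooth_degen: "j \<le> n \<Longrightarrow> smooth_map (L n) (L (Suc n)) (degen X n j)"
  using X by (simp add: simplicial_manifold_def)

lemma face_face: "i < j \<Longrightarrow> j \<le> Suc (Suc n) \<Longrightarrow> y \<in> mpoints (L (Suc (Suc n))) \<Longrightarrow>
  face X (Suc n) i (face X (Suc (Suc n)) j y) = face X (Suc n) (j - 1) (face X (Suc (Suc n)) i y)"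
  using X by (simp add: simplicial_manifold_def)

lemma degen_degen: "i \<le> j \<Longrightarrow> j \<le> n \<Longrightarrow> y \<in> mpoints (L n) \<Longrightarrow> degen X (Suc n) i (degen X n j y) = degen X (Suc n) (Suc j) (degen X n i y)"
  using X by (simp add: simplicial_manifold_def)

text \<open>The definition mentions level n - 1. Since i < j \<le> n rules out level 0, the identity
  is restated from level \<open>Suc n\<close>, without truncated subtraction of levels;
  \<open>face_degen_greater\<close> is treated likewise.\<close>

lemma face_degen_less: "i < j \<Longrightarrow> j \<le> Suc n \<Longrightarrow> y \<in> mpoints (L (Suc n)) \<Longrightarrow>
  face X (Suc (Suc n)) i (degen X (Suc n) j y) = degen X n (j - 1) (face X (Suc n) i y)"
proof -
  assume a: "i < j" "j \<le> Suc n" "y \<in> mpoints (L (Suc n))"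
  have "\<forall>n i j. i < j \<and> j \<le> n \<longrightarrow> (\<forall>x\<in>mpoints (level X n). face X (n + 1) i (degen X n j x) = degen X (n - 1) (j - 1) (face X n i x))"
    using X by (simp add: simplicial_manifold_def)
  from this[rule_format, of i j "Suc n" y] a show ?thesis by simp
qed

lemma face_degen_id: "i = j \<or> i = Suc j \<Longrightarrow> j \<le> n \<Longrightarrow> y \<in> mpoints (L n) \<Longrightarrow> face X (Suc n) i (degen X n j y) = y"
proof -
  assume a: "i = j \<or> i = Suc j" "j \<le> n" "y \<in> mpoints (L n)"
  have "\<forall>n i j. (i = j \<or> i = j + 1) \<and> j \<le> n \<longrightarrow> (\<forall>x\<in>mpoints (level X n). face X (n + 1) i (degen X n j x) = x)"
    using X by (simp add: simplicial_manifold_def)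
  from this[rule_format, of i j n y] a show ?thesis by simp
qed

lemma face_degen_greater: "Suc j < i \<Longrightarrow> i \<le> Suc (Suc n) \<Longrightarrow> y \<in> mpoints (L (Suc n)) \<Longrightarrow>
  face X (Suc (Suc n)) i (degen X (Suc n) j y) = degen X n j (face X (Suc n) (i - 1) y)"
proof -
  assume a: "Suc j < i" "i \<le> Suc (Suc n)" "y \<in> mpoints (L (Suc n))"
  have "\<forall>n i j. j + 1 < i \<and> i \<le> n + 1 \<longrightarrow> (\<forall>x\<in>mpoints (level X n). face X (n + 1) i (degen X n j x) = degen X (n - 1) j (face X n (i - 1) x))"
    using X by (simp add: simplicial_manifold_def)
  from this[rule_format, of j i "Suc n" y] a show ?thesis by simp
qed

section \<open>Base points and the simplicial identities on tangent spaces\<close>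

lemma smooth_pt: "smooth_map (L 0) (L n) (pt n)"
proof (induction n)
  case 0
  have "pt 0 = (\<lambda>x. x)" by auto
  then show ?case using smooth_map_id[OF smooth_level] by simp
next
  case (Suc n)
  have "pt (Suc n) = (\<lambda>x. degen X n 0 (pt n x))" by auto
  then show ?case using smooth_map_compose[OF smooth_level smooth_level smooth_level Suc smooth_degen] by simp
qed

lemma pt_points: "x \<in> mpoints (L 0) \<Longrightarrow> pt n x \<in> mpoints (L n)"
  by (rule smooth_map_points[OF smooth_pt])

text \<open>Induction by s_0 s_i = s_(i+1) s_0: every degeneracy sends the base point over x to the
  same point of the next level. Degeneracies therefore act between fibres over one point of
  X_0.\<close>

lemma degen_pt: "x \<in> mpoints (L 0) \<Longrightarrow> j \<le> n \<Longrightarrow> degen X n j (pt n x) = pt (Suc n) x"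
proof (induction n arbitrary: j)
  case (Suc n)
  show ?case
  proof (cases j)
    case (Suc i)
    then have i: "i \<le> n" using Suc.prems(2) by simp
    have "degen X (Suc n) 0 (degen X n i (pt n x)) = degen X (Suc n) (Suc i) (degen X n 0 (pt n x))"
      by (rule degen_degen[OF _ i pt_points[OF Suc.prems(1)]]) simp
    then show ?thesis using Suc Suc.IH[OF Suc.prems(1) i] by simp
  qed simp
qed simp

text \<open>d_0 and d_1 cancel s_0, and d_j s_0 = s_0 d_(j-1) for j > 1 reduces the claim to a lower
  level. Faces therefore also act between fibres over one point of X_0.\<close>

lemma face_pt: "x \<in> mpoints (L 0) \<Longrightarrow> j \<le> Suc n \<Longrightarrow> face X (Suc n) j (pt (Suc n) x) = pt n x"
proof (induction n arbitrary: j)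
  case 0
  then have "j = 0 \<or> j = Suc 0" by auto
  then show ?case using face_degen_id[of j 0 0 "pt 0 x"] pt_points[OF 0(1), of 0] by simp
next
  case (Suc n)
  show ?case
  proof (cases "j \<le> 1")
    case True
    then have "j = 0 \<or> j = Suc 0" by auto
    then show ?thesis using face_degen_id[of j 0 "Suc n" "pt (Suc n) x"] pt_points[OF Suc.prems(1), of "Suc n"] by simp
  next
    case False
    then have "face X (Suc (Suc n)) j (degen X (Suc n) 0 (pt (Suc n) x)) = degen X n 0 (face X (Suc n) (j - 1) (pt (Suc n) x))"
      using Suc.prems(2) by (intro face_degen_greater pt_points[OF Suc.prems(1)]) auto
    moreover have "face X (Suc n) (j - 1) (pt (Suc n) x) = pt n x" by (rule Suc.IH) (use Suc.prems in auto)
    ultimately show ?thesis by simp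
  qed
qed

lemma Tface_mem: "x \<in> mpoints (L 0) \<Longrightarrow> j \<le> Suc n \<Longrightarrow> v \<in> V (Suc n) x \<Longrightarrow> Tface n j x v \<in> V n x"
  using tangent_map_mem[OF smooth_level smooth_level smooth_face pt_points, of j n x v] by (simp only: face_pt)

text \<open>The chain rule on both sides of the simplicial identity; the intermediate points match
  because faces preserve base points. The two mixed identities below are obtained in the same
  manner.\<close>

lemma Tface_Tface:
  assumes x: "x \<in> mpoints (L 0)" and ij: "i < j" "j \<le> Suc (Suc n)" and v: "v \<in> V (Suc (Suc n)) x"
  shows "Tface n i x (Tface (Suc n) j x v) = Tface n (j - 1) x (Tface (Suc n) i x v)"
proof -
  note p = pt_points[OF x, of "Suc (Suc n)"] and L = smooth_level[of "Suc (Suc n)"] smooth_level[of "Suc n"] smooth_level[of n]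
  have fp: "face X (Suc (Suc n)) k (pt (Suc (Suc n)) x) = pt (Suc n) x" if "k \<le> Suc (Suc n)" for k by (rule face_pt[OF x that])
  have l: "i \<le> Suc (Suc n)" "i \<le> Suc n" "j - 1 \<le> Suc n" using ij by auto
  have "Tface n i x (Tface (Suc n) j x v) = tangent_map (L (Suc (Suc n))) (L n) (\<lambda>q. face X (Suc n) i (face X (Suc (Suc n)) j q)) (pt (Suc (Suc n)) x) v"
    using tangent_map_compose[OF L smooth_face[OF ij(2)] smooth_face[OF l(2)] p v] unfolding fp[OF ij(2)] by (rule sym)
  also have "\<dots> = tangent_map (L (Suc (Suc n))) (L n) (\<lambda>q. face X (Suc n) (j - 1) (face X (Suc (Suc n)) i q)) (pt (Suc (Suc n)) x) v"
    by (rule tangent_map_cong[OF L(1) p face_face[OF ij]])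
  also have "\<dots> = Tface n (j - 1) x (Tface (Suc n) i x v)"
    using tangent_map_compose[OF L smooth_face[OF l(1)] smooth_face[OF l(3)] p v] unfolding fp[OF l(1)] .
  finally show ?thesis .
qed

lemma Tface_Tdegen_id:
  assumes x: "x \<in> mpoints (L 0)" and j: "j \<le> n" and v: "v \<in> V n x"
  shows "Tface n j x (Tdegen n j x v) = v"
proof -
  note p = pt_points[OF x, of n]
  have "Tface n j x (Tdegen n j x v) = tangent_map (L n) (L n) (\<lambda>q. face X (Suc n) j (degen X n j q)) (pt n x) v"
    using tangent_map_compose[OF smooth_level smooth_level smooth_level smooth_degen[OF j] smooth_face[of j n] p v] j unfolding degen_pt[OF x j] by simp
  also have "\<dots> = tangent_map (L n) (L n) (\<lambda>q. q) (pt n x) v"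
    by (rule tangent_map_cong[OF smooth_level p]) (rule face_degen_id[OF _ j], simp_all)
  also have "\<dots> = v" by (rule tangent_map_id[OF smooth_level p v])
  finally show ?thesis .
qed

lemma Tface_Tdegen_less:
  assumes x: "x \<in> mpoints (L 0)" and ij: "i < j" "j \<le> Suc n" and v: "v \<in> V (Suc n) x"
  shows "Tface (Suc n) i x (Tdegen (Suc n) j x v) = Tdegen n (j - 1) x (Tface n i x v)"
proof -
  note p = pt_points[OF x, of "Suc n"]
  have l: "i \<le> Suc (Suc n)" "i \<le> Suc n" "j - 1 \<le> n" using ij by auto
  have "Tface (Suc n) i x (Tdegen (Suc n) j x v) = tangent_map (L (Suc n)) (L (Suc n)) (\<lambda>q. face X (Suc (Suc n)) i (degen X (Suc n) j q)) (pt (Suc n) x) v"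
    using tangent_map_compose[OF smooth_level smooth_level smooth_level smooth_degen[OF ij(2)] smooth_face[OF l(1)] p v]
    unfolding degen_pt[OF x ij(2)] by (rule sym)
  also have "\<dots> = tangent_map (L (Suc n)) (L (Suc n)) (\<lambda>q. degen X n (j - 1) (face X (Suc n) i q)) (pt (Suc n) x) v"
    by (rule tangent_map_cong[OF smooth_level p face_degen_less[OF ij]])
  also have "\<dots> = Tdegen n (j - 1) x (Tface n i x v)"
    using tangent_map_compose[OF smooth_level smooth_level smooth_level smooth_face[OF l(2)] smooth_degen[OF l(3)] p v]
    unfolding face_pt[OF x l(2)] .
  finally show ?thesis .
qed

section \<open>The projection onto the normalized (Moore) complex\<close>

definition moore_step :: "nat \<Rightarrow> nat \<Rightarrow> 'a \<Rightarrow> 'a tvec \<Rightarrow> 'a tvec" where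
  "moore_step n j x v = tadd v (tscale (-1)
     (tangent_map (L (Suc n)) (L (Suc n)) (\<lambda>y. degen X n j (face X (Suc n) j y)) (pt (Suc n) x) v))"

text \<open>Acts on the fibres of level n + 1 as (1 - s_(j-1) d_(j-1)) ... (1 - s_0 d_0), larger
  indices being applied later. The full projection is reached at j = n + 1, that is, with all faces
  but the last.\<close>

primrec moore_proj :: "nat \<Rightarrow> nat \<Rightarrow> 'a \<Rightarrow> 'a tvec \<Rightarrow> 'a tvec" where
  "moore_proj n 0 = (\<lambda>x v. v)"
| "moore_proj n (Suc j) = (\<lambda>x v. moore_step n j x (moore_proj n j x v))"

text \<open>The step is defined by the tangent map of s_j d_j as one self-map fixing the base
  points, the form that \<open>smooth_endo_complement\<close> takes; the chain rule splits it so
  that the simplicial identities apply.\<close>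

lemma moore_step_eq:
  assumes x: "x \<in> mpoints (L 0)" and j: "j \<le> n" and v: "v \<in> V (Suc n) x"
  shows "moore_step n j x v = tadd v (tscale (-1) (Tdegen n j x (Tface n j x v)))"
proof -
  have j': "j \<le> Suc n" using j by simp
  have "tangent_map (L (Suc n)) (L (Suc n)) (\<lambda>y. degen X n j (face X (Suc n) j y)) (pt (Suc n) x) v = Tdegen n j x (Tface n j x v)"
    using tangent_map_compose[OF smooth_level smooth_level smooth_level smooth_face[OF j'] smooth_degen[OF j] pt_points[OF x] v]
    unfolding face_pt[OF x j'] .
  then show ?thesis by (simp only: moore_step_def)
qed

lemma tangent_along_pt: "tangent_along_map (L 0) (L n) (pt n)"
  by unfold_locales (rule smooth_level smooth_pt)+

lemma smooth_endo_moore_proj: "j \<le> Suc n \<Longrightarrow> tangent_along_map.smooth_endo (L 0) (L (Suc n)) (pt (Suc n)) (moore_proj n j)"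
proof (induction j)
  interpret t: tangent_along_map "L 0" "L (Suc n)" "pt (Suc n)" by (rule tangent_along_pt)
  case 0
  show ?case unfolding moore_proj.simps by (rule t.smooth_endo_id)
next
  interpret t: tangent_along_map "L 0" "L (Suc n)" "pt (Suc n)" by (rule tangent_along_pt)
  case (Suc j)
  then have j: "j \<le> n" "j \<le> Suc n" by auto
  have "t.smooth_endo (moore_step n j)"
    unfolding moore_step_def
  proof (rule t.smooth_endo_complement)
    show "smooth_map (L (Suc n)) (L (Suc n)) (\<lambda>y. degen X n j (face X (Suc n) j y))"
      by (rule smooth_map_compose[OF smooth_level smooth_level smooth_level smooth_face[OF j(2)] smooth_degen[OF j(1)]])
    show "degen X n j (face X (Suc n) j (pt (Suc n) x)) = pt (Suc n) x" if x: "x \<in> mpoints (L 0)" for x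
      by (simp only: face_pt[OF x j(2)] degen_pt[OF x j(1)])
  qed
  from t.smooth_endo_compose[OF this Suc.IH[OF j(2)]] show ?case unfolding moore_proj.simps .
qed

lemma moore_proj_mem:
  assumes "x \<in> mpoints (L 0)" "j \<le> Suc n" "v \<in> V (Suc n) x"
  shows "moore_proj n j x v \<in> V (Suc n) x"
proof -
  interpret t: tangent_along_map "L 0" "L (Suc n)" "pt (Suc n)" by (rule tangent_along_pt)
  show ?thesis by (rule t.smooth_endo_mem[OF smooth_endo_moore_proj[OF assms(2)] assms(1,3)])
qed

lemma tadd_tscale_self: "tadd v (tscale (-1) v) = tzero" and tadd_tzero: "tadd v (tscale (-1) tzero) = v"
  by (auto simp: tadd_def tscale_def tzero_def)

text \<open>For i = j the new factor gives d_j - d_j s_j d_j = 0. For i < j it does no harm: d_i s_j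
  d_j = s_(j-1) d_i d_j = s_(j-1) d_(j-1) d_i, which vanishes on a vector already killed by
  d_i.\<close>

lemma Tface_moore_proj:
  assumes x: "x \<in> mpoints (L 0)" and v: "v \<in> V (Suc n) x"
  shows "i < j \<Longrightarrow> j \<le> Suc n \<Longrightarrow> Tface n i x (moore_proj n j x v) = tzero"
proof (induction j)
  case (Suc j)
  then have j: "j \<le> n" "j \<le> Suc n" by auto
  let ?w = "moore_proj n j x v"
  have w: "?w \<in> V (Suc n) x" by (rule moore_proj_mem[OF x j(2) v])
  have dw: "Tface n j x ?w \<in> V n x" by (rule Tface_mem[OF x j(2) w])
  have eq: "Tface n i x (moore_proj n (Suc j) x v) = tadd (Tface n i x ?w) (tscale (-1) (Tface n i x (Tdegen n j x (Tface n j x ?w))))"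
    by (simp only: moore_proj.simps moore_step_eq[OF x j(1) w] tangent_map_tadd tangent_map_tscale)
  show ?case
  proof (cases "i = j")
    case True
    then show ?thesis unfolding eq using Tface_Tdegen_id[OF x j(1) dw] by (simp add: tadd_tscale_self)
  next
    case False
    then have ij: "i < j" using Suc.prems by simp
    \<comment> \<open>i < j \<le> n excludes n = 0, so s_(j-1) is available one level lower.\<close>
    then obtain n' where n': "n = Suc n'" using j(1) by (cases n) auto
    have jn: "j \<le> Suc n'" "j \<le> Suc (Suc n')" using j n' by auto
    have IH: "Tface n i x ?w = tzero" by (rule Suc.IH[OF ij j(2)])
    have "Tface n i x (Tdegen n j x (Tface n j x ?w)) = Tdegen n' (j - 1) x (Tface n' i x (Tface n j x ?w))"
      using Tface_Tdegen_less[OF x ij jn(1)] dw n' by simp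
    also have "Tface n' i x (Tface n j x ?w) = Tface n' (j - 1) x (Tface n i x ?w)"
      using Tface_Tface[OF x ij jn(2)] w n' by simp
    finally have "Tface n i x (Tdegen n j x (Tface n j x ?w)) = tzero" by (simp only: IH tangent_map_tzero)
    then show ?thesis unfolding eq IH by (simp only: tadd_tzero)
  qed
qed simp

text \<open>Each factor subtracts a degeneracy of a face of v, and these faces all vanish.\<close>

lemma moore_proj_fixes:
  assumes x: "x \<in> mpoints (L 0)" and v: "v \<in> V (Suc n) x" and ker: "\<And>j. j < Suc n \<Longrightarrow> Tface n j x v = tzero"
  shows "j \<le> Suc n \<Longrightarrow> moore_proj n j x v = v"
proof (induction j)
  case (Suc j)
  then have j: "j \<le> n" "j < Suc n" by auto
  have "moore_proj n (Suc j) x v = moore_step n j x v" using Suc by simp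
  then show ?case by (simp only: moore_step_eq[OF x j(1) v] ker[OF j(2)] tangent_map_tzero tadd_tzero)
qed simp

section \<open>The complex, its bundles and its differential\<close>

abbreviation "TX \<equiv> tangent_complex_points X"

lemma TX_0: "(x, v) \<in> TX 0 \<longleftrightarrow> x \<in> mpoints (L 0) \<and> v \<in> V 0 x"
  by (auto simp: tangent_complex_points_def)

lemma TX_Suc: "(x, v) \<in> TX (Suc n) \<longleftrightarrow> x \<in> mpoints (L 0) \<and> v \<in> V (Suc n) x \<and> (\<forall>j<Suc n. Tface n j x v = tzero)"
  unfolding tangent_complex_points_def by simp

lemma TX_mem: "(x, v) \<in> TX n \<Longrightarrow> x \<in> mpoints (L 0) \<and> v \<in> V n x"
  unfolding tangent_complex_points_def by simp

text \<open>The fixed vectors of the full projection are those killed by all faces but the last: its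
  values are killed, and killed vectors are fixed. The same two facts give idempotency. In degree 0
  the identity serves as idempotent.\<close>

lemma smooth_subbundle_TX: "smooth_subbundle (restricted_tangent X n) (TX n)"
proof (cases n)
  case 0
  interpret t: tangent_along_map "L 0" "L 0" "pt 0" by (rule tangent_along_pt)
  have "TX 0 = {e \<in> t.P. snd e = snd e}" using TX_0 by (auto simp: tangent_along_points_def)
  then show ?thesis using t.idempotent_subbundle[OF t.smooth_endo_id] 0 by (simp add: restricted_tangent_def)
next
  case (Suc n')
  interpret t: tangent_along_map "L 0" "L (Suc n')" "pt (Suc n')" by (rule tangent_along_pt)
  let ?Q = "moore_proj n' (Suc n')"
  have ker: "Tface n' j x (?Q x v) = tzero" if "x \<in> mpoints (L 0)" "v \<in> V (Suc n') x" "j < Suc n'" for x v j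
    by (rule Tface_moore_proj[OF that(1,2,3) order_refl])
  have idem: "?Q x (?Q x v) = ?Q x v" if x: "x \<in> mpoints (L 0)" and v: "v \<in> V (Suc n') x" for x v
    by (rule moore_proj_fixes[OF x moore_proj_mem[OF x order_refl v] ker[OF x v] order_refl])
  have fix_iff: "?Q x v = v \<longleftrightarrow> (\<forall>j<Suc n'. Tface n' j x v = tzero)" if x: "x \<in> mpoints (L 0)" and v: "v \<in> V (Suc n') x" for x v
    using ker[OF x v] moore_proj_fixes[OF x v _ order_refl] by metis
  have "TX (Suc n') = {e \<in> t.P. ?Q (fst e) (snd e) = snd e}"
    unfolding set_eq_iff
  proof
    fix e :: "'a \<times> 'a tvec"
    obtain x v where e: "e = (x, v)" by (cases e)
    show "e \<in> TX (Suc n') \<longleftrightarrow> e \<in> {e \<in> t.P. ?Q (fst e) (snd e) = snd e}"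
      unfolding e TX_Suc using fix_iff[of x v] by (auto simp only: tangent_along_points_iff mem_Collect_eq fst_conv snd_conv)
  qed
  then show ?thesis
    using t.idempotent_subbundle[OF smooth_endo_moore_proj[OF order_refl]] idem unfolding Suc restricted_tangent_def by simp
qed

abbreviation "K \<equiv> tangent_complex X"

lemma K_sel: "cbase K = L 0" "cbundle K n = restrict_bundle (restricted_tangent X n) (TX n)"
  "cdiff K n (x, v) = (x, tscale ((-1) ^ n) (tangent_map (L n) (L (n - 1)) (face X n n) (pt n x) v))"
  by (simp_all add: tangent_complex_def)

lemma K_points: "mpoints (total (cbundle K n)) = TX n"
proof -
  have "embedded_submanifold (total (restricted_tangent X n)) (TX n)" using smooth_subbundle_TX by (simp add: smooth_subbundle_def)
  from embedded_submanifold_points[OF this] show ?thesis by (simp add: K_sel restrict_bundle_def)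
qed

lemma K_bundle: "vector_bundle (cbundle K n)" "base (cbundle K n) = L 0" "proj (cbundle K n) = fst" "vzero (cbundle K n) = (\<lambda>x. (x, tzero))"
  using smooth_subbundle_TX[of n]
  by (simp_all add: smooth_subbundle_def K_sel restrict_bundle_def restricted_tangent_def tangent_along_def)

text \<open>The last face preserves the kernel conditions: d_j d_(n+1) = d_n d_j for j < n, and d_j
  already kills v. In degree 0 there is no condition left to check.\<close>

lemma cdiff_mem:
  assumes "(x, v) \<in> TX (Suc n)"
  shows "cdiff K (Suc n) (x, v) \<in> TX n"
proof -
  have x: "x \<in> mpoints (L 0)" and v: "v \<in> V (Suc n) x" and ker: "\<And>j. j < Suc n \<Longrightarrow> Tface n j x v = tzero"
    using assms by (auto simp only: TX_Suc)
  have w: "Tface n (Suc n) x v \<in> V n x" by (rule Tface_mem[OF x order_refl v])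
  show ?thesis
  proof (cases n)
    case 0
    then show ?thesis using w x tangent_space_tscale unfolding K_sel 0 TX_0 by simp
  next
    case (Suc n')
    have "Tface n' j x (Tface n (Suc n) x v) = tzero" if j: "j < n" for j
    proof -
      have "Tface n' j x (Tface n (Suc n) x v) = Tface n' n x (Tface n j x v)"
        using Tface_Tface[OF x, of j "Suc n" n' v] j v Suc by simp
      also have "Tface n j x v = tzero" using ker j by simp
      finally show ?thesis by (simp only: tangent_map_tzero)
    qed
    then have "Tface n' j x (tscale r (Tface n (Suc n) x v)) = tzero" if "j < n" for j r
      using that by (simp only: tangent_map_tscale) (simp add: tscale_def tzero_def)
    then show ?thesis using x tangent_space_tscale[OF w] unfolding K_sel Suc TX_Suc by simp
  qed
qed

text \<open>The square has the identity of X_0 on the base and the last face on the levels; it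
  commutes because this face preserves base points. The sign is the scalar of the square.\<close>

lemma cdiff_morphism: "vbundle_morphism (cbundle K (Suc n)) (cbundle K n) (\<lambda>x. x) (cdiff K (Suc n))"
proof -
  interpret s: tangent_along_square "L 0" "L (Suc n)" "pt (Suc n)" "L 0" "L n" "pt n" "\<lambda>x. x" "face X (Suc n) (Suc n)" "(-1) ^ Suc n"
    by (intro tangent_along_square.intro tangent_along_pt tangent_along_square_axioms.intro smooth_map_id smooth_level smooth_face face_pt order_refl)
  have eq: "cdiff K (Suc n) e = s.bmap e" for e by (cases e) (simp only: K_sel s.bmap_def fst_conv snd_conv diff_Suc_1)
  show ?thesis
    unfolding K_sel(2) restricted_tangent_def
  proof (rule s.vbundle_morphism_bmap)
    fix e assume "e \<in> TX (Suc n)"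
    then show "s.bmap e \<in> TX n" unfolding eq[symmetric] using cdiff_mem by (cases e) simp
  qed (use smooth_subbundle_TX eq in \<open>simp_all add: restricted_tangent_def\<close>)
qed

text \<open>d_(n+1) d_(n+2) = d_(n+1) d_(n+1), and the inner face d_(n+1) is no longer the last one
  in degree n + 2, hence is among those that vanish. Signs do not matter.\<close>

lemma cdiff_cdiff:
  assumes "(x, v) \<in> TX (Suc (Suc n))"
  shows "cdiff K (Suc n) (cdiff K (Suc (Suc n)) (x, v)) = (x, tzero)"
proof -
  have x: "x \<in> mpoints (L 0)" and v: "v \<in> V (Suc (Suc n)) x" and ker: "\<And>j. j < Suc (Suc n) \<Longrightarrow> Tface (Suc n) j x v = tzero"
    using assms by (auto simp only: TX_Suc)
  have "Tface n (Suc n) x (Tface (Suc n) (Suc (Suc n)) x v) = Tface n (Suc n) x (Tface (Suc n) (Suc n) x v)"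
    using Tface_Tface[OF x, of "Suc n" "Suc (Suc n)" n v] v by simp
  also have "\<dots> = tzero" using ker[of "Suc n"] by (simp only: tangent_map_tzero lessI)
  finally have "Tface n (Suc n) x (tscale r (Tface (Suc n) (Suc (Suc n)) x v)) = tzero" for r
    by (simp only: tangent_map_tscale) (simp add: tscale_def tzero_def)
  then show ?thesis unfolding K_sel by simp (simp add: tscale_def tzero_def)
qed

lemma chain_complex_K: "chain_complex K"
proof -
  have "cdiff K (n + 1) (cdiff K (n + 2) e) = vzero (cbundle K n) (proj (cbundle K (n + 2)) e)"
    if "e \<in> mpoints (total (cbundle K (n + 2)))" for n e
    using that cdiff_cdiff[of "fst e" "snd e" n] unfolding K_points K_bundle by simp
  then show ?thesis
    unfolding chain_complex_def using K_bundle(1,2) cdiff_morphism by (simp add: K_sel(1))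
qed

end

section \<open>Action on simplicial morphisms\<close>

locale simplicial_map = S: simplicial_mfd X + S': simplicial_mfd Y for X Y :: "'a smfd" +
  fixes f :: "nat \<Rightarrow> 'a \<Rightarrow> 'a"
  assumes f: "simplicial_morphism X Y f"
begin

lemma smooth_f: "smooth_map (S.L n) (S'.L n) (f n)" and ext_f: "f n \<in> extensional (mpoints (S.L n))"
  using f by (simp_all add: simplicial_morphism_def)

lemma f_face: "j \<le> Suc n \<Longrightarrow> y \<in> mpoints (S.L (Suc n)) \<Longrightarrow> f n (face X (Suc n) j y) = face Y (Suc n) j (f (Suc n) y)"
  using f by (simp add: simplicial_morphism_def)

lemma f_degen: "j \<le> n \<Longrightarrow> y \<in> mpoints (S.L n) \<Longrightarrow> f (Suc n) (degen X n j y) = degen Y n j (f n y)"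
  using f by (simp add: simplicial_morphism_def)

text \<open>Compatibility with degeneracies carries base points to base points, so that every level
  of f covers f 0 on the restricted tangent bundles.\<close>

lemma f_pt: "x \<in> mpoints (S.L 0) \<Longrightarrow> f n (S.pt n x) = S'.pt n (f 0 x)"
  by (induction n) (simp_all add: f_degen S.pt_points)

abbreviation "Tf n x \<equiv> tangent_map (S.L n) (S'.L n) (f n) (S.pt n x)"

lemma Tf_mem: "x \<in> mpoints (S.L 0) \<Longrightarrow> v \<in> S.V n x \<Longrightarrow> Tf n x v \<in> S'.V n (f 0 x)"
  using tangent_map_mem[OF S.smooth_level S'.smooth_level smooth_f S.pt_points] by (simp only: f_pt)

text \<open>The chain rule on both sides of the compatibility of f with a face. For the last face it
  gives the chain map property, for the others \<open>Tf_TX\<close>.\<close>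

lemma Tf_Tface:
  assumes x: "x \<in> mpoints (S.L 0)" and j: "j \<le> Suc n" and v: "v \<in> S.V (Suc n) x"
  shows "Tf n x (S.Tface n j x v) = S'.Tface n j (f 0 x) (Tf (Suc n) x v)"
proof -
  note p = S.pt_points[OF x, of "Suc n"]
  have "Tf n x (S.Tface n j x v) = tangent_map (S.L (Suc n)) (S'.L n) (\<lambda>q. f n (face X (Suc n) j q)) (S.pt (Suc n) x) v"
    using tangent_map_compose[OF S.smooth_level S.smooth_level S'.smooth_level S.smooth_face[OF j] smooth_f p v]
    unfolding S.face_pt[OF x j] by (rule sym)
  also have "\<dots> = tangent_map (S.L (Suc n)) (S'.L n) (\<lambda>q. face Y (Suc n) j (f (Suc n) q)) (S.pt (Suc n) x) v"
    by (rule tangent_map_cong[OF S.smooth_level p f_face[OF j]])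
  also have "\<dots> = S'.Tface n j (f 0 x) (Tf (Suc n) x v)"
    using tangent_map_compose[OF S.smooth_level S'.smooth_level S'.smooth_level smooth_f S'.smooth_face[OF j] p v]
    unfolding f_pt[OF x] .
  finally show ?thesis .
qed

text \<open>A face of the image is the image of a face, so the vanishing of the faces below the last
  is inherited.\<close>

lemma Tf_TX:
  assumes "(x, v) \<in> S.TX n"
  shows "(f 0 x, Tf n x v) \<in> S'.TX n"
proof -
  have x: "x \<in> mpoints (S.L 0)" and v: "v \<in> S.V n x" using S.TX_mem[OF assms] by auto
  have fx: "f 0 x \<in> mpoints (S'.L 0)" by (rule smooth_map_points[OF smooth_f x])
  show ?thesis
  proof (cases n)
    case 0
    then show ?thesis using fx Tf_mem[OF x v] unfolding 0 S'.TX_0 by simp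
  next
    case (Suc n')
    have "S'.Tface n' j (f 0 x) (Tf (Suc n') x v) = tzero" if j: "j < Suc n'" for j
    proof -
      have "S.Tface n' j x v = tzero" using assms j unfolding Suc S.TX_Suc by blast
      then show ?thesis using Tf_Tface[OF x, of j n' v] j v tangent_map_tzero unfolding Suc by (metis less_imp_le)
    qed
    then show ?thesis using fx Tf_mem[OF x v] unfolding Suc S'.TX_Suc by blast
  qed
qed

abbreviation "F n \<equiv> snd (tangent_complex_map X Y f) n"

lemma F_eq: "(x, v) \<in> S.TX n \<Longrightarrow> F n (x, v) = (f 0 x, Tf n x v)"
  by (simp add: tangent_complex_map_def)

lemma chain_morphism_F: "chain_morphism S.K S'.K (tangent_complex_map X Y f)"
proof -
  have fst: "fst (tangent_complex_map X Y f) = f 0" by (simp add: tangent_complex_map_def)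
  have "F n \<in> extensional (mpoints (total (cbundle S.K n)))" for n
    unfolding S.K_points by (simp add: tangent_complex_map_def)
  moreover have "vbundle_morphism (cbundle S.K n) (cbundle S'.K n) (f 0) (F n)" for n
  proof -
    interpret s: tangent_along_square "S.L 0" "S.L n" "S.pt n" "S'.L 0" "S'.L n" "S'.pt n" "f 0" "f n" 1
      by (intro tangent_along_square.intro S.tangent_along_pt S'.tangent_along_pt tangent_along_square_axioms.intro smooth_f f_pt)
    have eq: "s.bmap (x, v) = (f 0 x, Tf n x v)" for x v by (simp add: s.bmap_def tscale_def)
    show ?thesis
      unfolding S.K_sel(2) S'.K_sel(2) restricted_tangent_def
    proof (rule s.vbundle_morphism_bmap)
      fix e assume e: "e \<in> S.TX n"
      then show "s.bmap e \<in> S'.TX n" using Tf_TX by (cases e) (simp add: eq)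
      show "F n e = s.bmap e" using e F_eq by (cases e) (simp only: eq)
    qed (use S.smooth_subbundle_TX S'.smooth_subbundle_TX in \<open>simp_all add: restricted_tangent_def\<close>)
  qed
  moreover have "F n (cdiff S.K (n + 1) e) = cdiff S'.K (n + 1) (F (n + 1) e)" if "e \<in> mpoints (total (cbundle S.K (n + 1)))" for n e
  proof -
    obtain x v where e: "e = (x, v)" by (cases e)
    have xv: "(x, v) \<in> S.TX (Suc n)" using that unfolding S.K_points e by simp
    have x: "x \<in> mpoints (S.L 0)" and v: "v \<in> S.V (Suc n) x" using S.TX_mem[OF xv] by auto
    have "F n (cdiff S.K (Suc n) (x, v)) = (f 0 x, Tf n x (tscale ((-1) ^ Suc n) (S.Tface n (Suc n) x v)))"
      using S.cdiff_mem[OF xv] F_eq unfolding S.K_sel by simp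
    also have "\<dots> = (f 0 x, tscale ((-1) ^ Suc n) (S'.Tface n (Suc n) (f 0 x) (Tf (Suc n) x v)))"
      by (simp only: tangent_map_tscale Tf_Tface[OF x order_refl v])
    also have "\<dots> = cdiff S'.K (Suc n) (F (Suc n) (x, v))" unfolding F_eq[OF xv] S'.K_sel by simp
    finally show ?thesis by (simp add: e)
  qed
  ultimately show ?thesis
    unfolding chain_morphism_def using ext_f[of 0] fst by (simp add: case_prod_unfold S.K_sel(1))
qed

end


section \<open>The categories and the functor\<close>

text \<open>Since morphisms are normalised off the point sets, the identity laws hold as equations
  between functions. Associativity needs in addition that each level maps points to points.\<close>

lemma is_category_sMan: "is_category (sMan :: ('a smfd, _) cat)"
proof -
  have sm: "smooth_manifold (level X n)" if "simplicial_manifold X" for X :: "'a smfd" and n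
    using that by (simp add: simplicial_manifold_def)
  have fp: "face X (Suc n) j x \<in> mpoints (level X n)"
    if X: "simplicial_manifold X" and j: "j \<le> Suc n" and x: "x \<in> mpoints (level X (Suc n))" for X :: "'a smfd" and n j x
    by (rule smooth_map_points[OF simplicial_mfd.smooth_face[OF simplicial_mfd.intro[OF X] j] x])
  have dp: "degen X n i y \<in> mpoints (level X (Suc n))"
    if X: "simplicial_manifold X" and i: "i \<le> n" and y: "y \<in> mpoints (level X n)" for X :: "'a smfd" and n i y
    by (rule smooth_map_points[OF simplicial_mfd.smooth_degen[OF simplicial_mfd.intro[OF X] i] y])
  have mp: "f n x \<in> mpoints (level Y n)" if "simplicial_morphism X Y f" "x \<in> mpoints (level X n)" for X Y :: "'a smfd" and f n x
    using that smooth_map_points[of "level X n" "level Y n" "f n" x] by (simp add: simplicial_morphism_def)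
  have mPi: "f n \<in> mpoints (level X n) \<rightarrow> mpoints (level Y n)" "f n \<in> extensional (mpoints (level X n))"
    if "simplicial_morphism X Y f" for X Y :: "'a smfd" and f n
    using mp[OF that] that by (auto simp: simplicial_morphism_def)
  have id: "simplicial_morphism X X (\<lambda>n. \<lambda>x\<in>mpoints (level X n). x)" if X: "simplicial_manifold X" for X :: "'a smfd"
    unfolding simplicial_morphism_def
    using smooth_map_restrict[OF sm[OF X] sm[OF X] smooth_map_id[OF sm[OF X]]] fp[OF X] dp[OF X] by simp
  have comp: "simplicial_morphism X Z (\<lambda>n. compose (mpoints (level X n)) (g n) (f n))"
    if X: "simplicial_manifold X" and Y: "simplicial_manifold Y" and Z: "simplicial_manifold Z"
      and f: "simplicial_morphism X Y f" and g: "simplicial_morphism Y Z g" for X Y Z :: "'a smfd" and f g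
  proof -
    have "smooth_map (level X n) (level Z n) (compose (mpoints (level X n)) (g n) (f n))" for n
    proof -
      have "smooth_map (level X n) (level Y n) (f n)" "smooth_map (level Y n) (level Z n) (g n)"
        using f g by (simp_all add: simplicial_morphism_def)
      then show ?thesis
        unfolding compose_def by (rule smooth_map_restrict[OF sm[OF X] sm[OF Z] smooth_map_compose[OF sm[OF X] sm[OF Y] sm[OF Z]]])
    qed
    moreover have "g n (f n (face X (Suc n) j x)) = face Z (Suc n) j (g (Suc n) (f (Suc n) x))"
      if "j \<le> Suc n" "x \<in> mpoints (level X (Suc n))" for n j x
      using f g that mp[OF f that(2)] by (simp add: simplicial_morphism_def)
    moreover have "g (Suc n) (f (Suc n) (degen X n j x)) = degen Z n j (g n (f n x))"
      if "j \<le> n" "x \<in> mpoints (level X n)" for n j x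
      using f g that mp[OF f that(2)] by (simp add: simplicial_morphism_def)
    ultimately show ?thesis
      unfolding simplicial_morphism_def using fp[OF X] dp[OF X] by (simp add: compose_def)
  qed
  show ?thesis
    unfolding is_category_def sMan_def cat.simps mem_Collect_eq
  proof (intro conjI ballI)
    fix X Y :: "'a smfd" and f assume "X \<in> {X. simplicial_manifold X}" "Y \<in> {X. simplicial_manifold X}" "f \<in> {f. simplicial_morphism X Y f}"
    then have f: "simplicial_morphism X Y f" by simp
    show "(\<lambda>n. compose (mpoints (level X n)) (f n) (\<lambda>x\<in>mpoints (level X n). x)) = f"
      "(\<lambda>n. compose (mpoints (level X n)) (\<lambda>x\<in>mpoints (level Y n). x) (f n)) = f"
      using compose_Id[OF mPi[OF f]] Id_compose[OF mPi[OF f]] by auto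
  next
    fix W X Y Z :: "'a smfd" and f g h assume "W \<in> {X. simplicial_manifold X}" "f \<in> {f. simplicial_morphism W X f}"
    then have f: "simplicial_morphism W X f" by simp
    show "(\<lambda>n. compose (mpoints (level W n)) (compose (mpoints (level X n)) (h n) (g n)) (f n)) =
      (\<lambda>n. compose (mpoints (level W n)) (h n) (compose (mpoints (level W n)) (g n) (f n)))"
      by (simp only: compose_assoc[OF mPi(1)[OF f]])
  qed (use id comp in auto)
qed

lemma chain_morphism_compose:
  assumes K: "chain_complex K" and L: "chain_complex L" and M: "chain_complex M"
    and f: "chain_morphism K L (f, F)" and g: "chain_morphism L M (g, G)"
  shows "chain_morphism K M (compose (mpoints (cbase K)) g f, \<lambda>n. compose (mpoints (total (cbundle K n))) (G n) (F n))"
proof -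
  have vb: "vector_bundle (cbundle K n)" "vector_bundle (cbundle L n)" "vector_bundle (cbundle M n)" "base (cbundle K n) = cbase K" for n
    using K L M by (simp_all add: chain_complex_def)
  have F: "vbundle_morphism (cbundle K n) (cbundle L n) f (F n)" and G: "vbundle_morphism (cbundle L n) (cbundle M n) g (G n)" for n
    using f g by (simp_all add: chain_morphism_def)
  have d: "cdiff K (n + 1) e \<in> mpoints (total (cbundle K n))" if "e \<in> mpoints (total (cbundle K (n + 1)))" for n e
  proof -
    have "vbundle_morphism (cbundle K (n + 1)) (cbundle K n) (\<lambda>x. x) (cdiff K (n + 1))" using K by (simp add: chain_complex_def)
    from vbundle_morphism_points[OF this that] show ?thesis .
  qed
  have GF: "G n (F n (cdiff K (n + 1) e)) = cdiff M (n + 1) (G (n + 1) (F (n + 1) e))" if "e \<in> mpoints (total (cbundle K (n + 1)))" for n e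
    using f g that vbundle_morphism_points[OF F that] by (simp add: chain_morphism_def)
  show ?thesis
    unfolding chain_morphism_def split_conv
  proof (intro conjI allI ballI)
    show "vbundle_morphism (cbundle K n) (cbundle M n) (compose (mpoints (cbase K)) g f) (compose (mpoints (total (cbundle K n))) (G n) (F n))" for n
      using vbundle_morphism_compose[OF vb(1)[of n] vb(2)[of n] vb(3)[of n] F[of n] G[of n]] unfolding vb(4) .
    fix n e assume e: "e \<in> mpoints (total (cbundle K (n + 1)))"
    show "compose (mpoints (total (cbundle K n))) (G n) (F n) (cdiff K (n + 1) e) =
        cdiff M (n + 1) (compose (mpoints (total (cbundle K (n + 1)))) (G (n + 1)) (F (n + 1)) e)"
      unfolding compose_def restrict_apply' [OF d[OF e]] restrict_apply'[OF e] by (rule GF[OF e])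
  qed simp_all
qed

lemma chain_morphism_id:
  assumes K: "chain_complex K"
  shows "chain_morphism K K (\<lambda>x\<in>mpoints (cbase K). x, \<lambda>n. \<lambda>e\<in>mpoints (total (cbundle K n)). e)"
proof -
  have vb: "vector_bundle (cbundle K n)" "base (cbundle K n) = cbase K" for n using K by (simp_all add: chain_complex_def)
  have d: "cdiff K (n + 1) e \<in> mpoints (total (cbundle K n))" if "e \<in> mpoints (total (cbundle K (n + 1)))" for n e
  proof -
    have "vbundle_morphism (cbundle K (n + 1)) (cbundle K n) (\<lambda>x. x) (cdiff K (n + 1))" using K by (simp add: chain_complex_def)
    from vbundle_morphism_points[OF this that] show ?thesis .
  qed
  show ?thesis unfolding chain_morphism_def using vbundle_morphism_id[OF vb(1)] d by (simp add: vb(2))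
qed

lemma chain_morphism_funcset:
  assumes K: "chain_complex K" and L: "chain_complex L" and f: "chain_morphism K L (f, F)"
  shows "f \<in> mpoints (cbase K) \<rightarrow> mpoints (cbase L)" "f \<in> extensional (mpoints (cbase K))"
    "F n \<in> mpoints (total (cbundle K n)) \<rightarrow> mpoints (total (cbundle L n))" "F n \<in> extensional (mpoints (total (cbundle K n)))"
proof -
  have b: "base (cbundle K n) = cbase K" "base (cbundle L n) = cbase L" for n using K L by (simp_all add: chain_complex_def)
  have F: "vbundle_morphism (cbundle K n) (cbundle L n) f (F n)" for n using f by (simp add: chain_morphism_def)
  show "f \<in> mpoints (cbase K) \<rightarrow> mpoints (cbase L)" using vbundle_morphism_base_points[OF F[of 0]] b[of 0] by auto
  show "F n \<in> mpoints (total (cbundle K n)) \<rightarrow> mpoints (total (cbundle L n))" using vbundle_morphism_points[OF F] by auto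
  show "f \<in> extensional (mpoints (cbase K))" "F n \<in> extensional (mpoints (total (cbundle K n)))" using f by (simp_all add: chain_morphism_def)
qed

lemma is_category_ChVB: "is_category ChVB"
  unfolding is_category_def ChVB_def cat.simps
proof (intro conjI ballI)
  fix K L :: "('a, 'b) vbcomplex" and fF assume KL: "K \<in> {K. chain_complex K}" "L \<in> {K. chain_complex K}" and "fF \<in> {f. chain_morphism K L f}"
  then obtain f F where fF: "fF = (f, F)" and f: "chain_morphism K L (f, F)" by (cases fF) auto
  note fs = chain_morphism_funcset[OF _ _ f]
  show "(case fF of (g, G) \<Rightarrow> \<lambda>(f, F). (compose (mpoints (cbase K)) g f, \<lambda>n. compose (mpoints (total (cbundle K n))) (G n) (F n)))
      (\<lambda>x\<in>mpoints (cbase K). x, \<lambda>n. \<lambda>e\<in>mpoints (total (cbundle K n)). e) = fF"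
    using KL compose_Id[OF fs(1,2)] compose_Id[OF fs(3,4)] by (simp add: fF)
  show "(case (\<lambda>x\<in>mpoints (cbase L). x, \<lambda>n. \<lambda>e\<in>mpoints (total (cbundle L n)). e) of (g, G) \<Rightarrow>
      \<lambda>(f, F). (compose (mpoints (cbase K)) g f, \<lambda>n. compose (mpoints (total (cbundle K n))) (G n) (F n))) fF = fF"
    using KL Id_compose[OF fs(1,2)] Id_compose[OF fs(3,4)] by (simp add: fF)
next
  fix K L M N :: "('a, 'b) vbcomplex" and fF gG hH
  assume KL: "K \<in> {K. chain_complex K}" "L \<in> {K. chain_complex K}" and "fF \<in> {f. chain_morphism K L f}"
  then obtain f F where fF: "fF = (f, F)" and f: "chain_morphism K L (f, F)" by (cases fF) auto
  note fs = chain_morphism_funcset[OF _ _ f]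
  show "(case (case hH of (g, G) \<Rightarrow> \<lambda>(f, F). (compose (mpoints (cbase L)) g f, \<lambda>n. compose (mpoints (total (cbundle L n))) (G n) (F n))) gG of
      (g, G) \<Rightarrow> \<lambda>(f, F). (compose (mpoints (cbase K)) g f, \<lambda>n. compose (mpoints (total (cbundle K n))) (G n) (F n))) fF =
    (case hH of (g, G) \<Rightarrow> \<lambda>(f, F). (compose (mpoints (cbase K)) g f, \<lambda>n. compose (mpoints (total (cbundle K n))) (G n) (F n)))
      ((case gG of (g, G) \<Rightarrow> \<lambda>(f, F). (compose (mpoints (cbase K)) g f, \<lambda>n. compose (mpoints (total (cbundle K n))) (G n) (F n))) fF)"
    using KL by (cases gG; cases hH) (simp add: fF compose_assoc[OF fs(1)] compose_assoc[OF fs(3)])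
qed (auto intro: chain_morphism_id chain_morphism_compose)

section \<open>The functor laws\<close>

lemma tangent_complex_map_id:
  assumes "simplicial_manifold (X :: 'a smfd)"
  shows "tangent_complex_map X X (Ident sMan X) = Ident ChVB (tangent_complex X)"
proof -
  interpret S: simplicial_mfd X by unfold_locales (rule assms)
  have "tangent_map (S.L n) (S.L n) (\<lambda>x\<in>mpoints (S.L n). x) (S.pt n x) v = v" if "(x, v) \<in> S.TX n" for n x v
  proof -
    have xv: "S.pt n x \<in> mpoints (S.L n)" "v \<in> S.V n x" using S.TX_mem[OF that] S.pt_points by auto
    have "tangent_map (S.L n) (S.L n) (\<lambda>x\<in>mpoints (S.L n). x) (S.pt n x) v = tangent_map (S.L n) (S.L n) (\<lambda>x. x) (S.pt n x) v"
      by (rule tangent_map_cong[OF S.smooth_level xv(1)]) simp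
    then show ?thesis using tangent_map_id[OF S.smooth_level xv] by simp
  qed
  then have "(\<lambda>(x, v)\<in>S.TX n. ((\<lambda>x\<in>mpoints (S.L 0). x) x, tangent_map (S.L n) (S.L n) (\<lambda>x\<in>mpoints (S.L n). x) (S.pt n x) v)) = (\<lambda>e\<in>S.TX n. e)" for n
    using S.TX_mem by (intro restrict_ext) (auto simp: split_beta)
  then show ?thesis
    by (simp add: tangent_complex_map_def sMan_def ChVB_def S.K_points S.K_sel(1))
qed

text \<open>The chain rule at base points, where f takes the base point over x to the one over f 0
  x. Composites in \<open>sMan\<close> are normalised; \<open>tangent_map_cong\<close> replaces them
  by plain composites, whose values agree on the points of the level.\<close>

lemma tangent_complex_map_compose:
  assumes "simplicial_manifold (X :: 'a smfd)" "simplicial_manifold Y" "simplicial_manifold Z"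
    and f: "simplicial_morphism X Y f" and g: "simplicial_morphism Y Z g"
  shows "tangent_complex_map X Z (Comp sMan X Y Z g f) =
    Comp ChVB (tangent_complex X) (tangent_complex Y) (tangent_complex Z) (tangent_complex_map Y Z g) (tangent_complex_map X Y f)"
proof -
  interpret F: simplicial_map X Y f by unfold_locales (rule assms)+
  interpret G: simplicial_map Y Z g by unfold_locales (rule assms)+
  have "(\<lambda>(x, v)\<in>F.S.TX n. (compose (mpoints (F.S.L 0)) (g 0) (f 0) x,
      tangent_map (F.S.L n) (G.S'.L n) (compose (mpoints (F.S.L n)) (g n) (f n)) (F.S.pt n x) v)) = compose (F.S.TX n) (G.F n) (F.F n)" for n
    unfolding compose_def
  proof (rule restrict_ext)
    fix e assume e: "e \<in> F.S.TX n"
    obtain x v where xv: "e = (x, v)" by (cases e)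
    have x: "x \<in> mpoints (F.S.L 0)" and v: "v \<in> F.S.V n x" using F.S.TX_mem e xv by auto
    note p = F.S.pt_points[OF x, of n]
    have "tangent_map (F.S.L n) (G.S'.L n) (\<lambda>x\<in>mpoints (F.S.L n). g n (f n x)) (F.S.pt n x) v =
        tangent_map (F.S.L n) (G.S'.L n) (\<lambda>x. g n (f n x)) (F.S.pt n x) v"
      by (rule tangent_map_cong[OF F.S.smooth_level p]) simp
    also have "\<dots> = G.Tf n (f 0 x) (F.Tf n x v)"
      using tangent_map_compose[OF F.S.smooth_level F.S'.smooth_level G.S'.smooth_level F.smooth_f G.smooth_f p v]
      unfolding F.f_pt[OF x] .
    finally show "(case e of (x, v) \<Rightarrow> ((\<lambda>x\<in>mpoints (F.S.L 0). g 0 (f 0 x)) x,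
        tangent_map (F.S.L n) (G.S'.L n) (\<lambda>x\<in>mpoints (F.S.L n). g n (f n x)) (F.S.pt n x) v)) = G.F n (F.F n e)"
      using x F.F_eq[of x v n] G.F_eq[OF F.Tf_TX, of x v n] e unfolding xv by simp
  qed
  then show ?thesis
    unfolding ChVB_def sMan_def cat.simps by (simp add: F.S.K_points F.S.K_sel(1) case_prod_unfold) (simp add: tangent_complex_map_def case_prod_unfold)
qed

text \<open>The first conjunct states the part of well-definedness that the functor does not record:
  objects of \<open>ChVB\<close> consist of vector bundles without reference to the restricted
  tangent bundles in which they lie.\<close>

theorem proposition3p9:
  shows "(\<forall>X :: 'a smfd. simplicial_manifold X \<longrightarrow>
            (\<forall>n. smooth_subbundle (restricted_tangent X n) (tangent_complex_points X n)))
       \<and> is_functor (sMan :: ('a smfd, _) cat) ChVB tangent_complex tangent_complex_map"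
proof -
  have obj: "Obj (sMan :: ('a smfd, _) cat) = {X. simplicial_manifold X}" "Hom (sMan :: ('a smfd, _) cat) = (\<lambda>X Y. {f. simplicial_morphism X Y f})"
    "Obj (ChVB :: (('a \<times> 'a tvec, 'a) vbcomplex, _) cat) = {K. chain_complex K}"
    "Hom (ChVB :: (('a \<times> 'a tvec, 'a) vbcomplex, _) cat) = (\<lambda>K L. {f. chain_morphism K L f})"
    by (simp_all add: sMan_def ChVB_def)
  have "simplicial_manifold X \<Longrightarrow> smooth_subbundle (restricted_tangent X n) (tangent_complex_points X n)" for X :: "'a smfd" and n
    by (rule simplicial_mfd.smooth_subbundle_TX) unfold_locales
  moreover have "simplicial_manifold X \<Longrightarrow> chain_complex (tangent_complex X)" for X :: "'a smfd"
    by (rule simplicial_mfd.chain_complex_K) unfold_locales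
  moreover have "chain_morphism (tangent_complex X) (tangent_complex Y) (tangent_complex_map X Y f)"
    if "simplicial_manifold X" "simplicial_manifold Y" "simplicial_morphism X Y f" for X Y :: "'a smfd" and f
    by (rule simplicial_map.chain_morphism_F) (unfold_locales, (rule that)+)
  ultimately show ?thesis
    unfolding is_functor_def obj mem_Collect_eq
    by (intro conjI allI impI ballI is_category_sMan is_category_ChVB tangent_complex_map_id tangent_complex_map_compose) blast+
qed

end
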